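(* Let $(J,\rho)\in\mathcal J_G^{wc}$, with associated $(\tilde J,\tilde\rho)$ and $\pi=\mathrm{ind}_{\tilde J}^G\tilde\rho$. The following statements are equivalent: (1) The representation $\mathrm{Res}^G_{{}^\flat G}(\pi)$ is multiplicity free. (2) The representation $\mathrm{Res}^{\tilde J}_J(\tilde\rho)$ is multiplicity free. (3) The Hecke algebra $\mathcal H(G,\rho)$ is commutative.
   Context: Setting: $F$ is a non-archimedean local field, $\mathbf G$ a connected reductive $F$-group with center $\mathbf Z$, $G=\mathbf G(F)$, $Z=\mathbf Z(F)$. Representations are smooth and complex; $\mathrm{ind}$ is compact induction. For $g\in G$: $H^g=gHg^{-1}$ and $\sigma^g(x)=\sigma(g^{-1}xg)$. ${}^0G$ is the intersection of the kernels of all unramified characters $g\mapsto|\chi(g)|_F^s$ of $G$ ($\chi$ an $F$-rational character of $\mathbf G$, $s\in\mathbb C$). Fix an open normal subgroup ${}^\flat G$ of $G$, contained in ${}^0G$ with finite index and containing the commutator subgroup of $G$. $\Omega(G)$ is the set of open compact subgroups of $G$; $\Omega(G/Z)$ the set of open subgroups of $G$ containing $Z$ and compact modulo $Z$. For a representation $\sigma$ of $H\subset G$, $\mathcal I_G(\sigma)=\{g\in G:\mathrm{Hom}_{H\cap H^g}(\sigma,\sigma^g)\neq0\}$. $\mathcal J_G$ is the set of pairs $(J,\rho)$, $J\in\Omega(G)$, $\rho\in\mathrm{Irr}(J)$, such that there exist $\tilde J\in\Omega(G/Z)$ with $J=\tilde J\cap{}^\flat G$ and $\tilde\rho\in\mathrm{Irr}(\tilde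 J)$ containing $\rho$ with $\mathcal I_G(\tilde\rho)=\tilde J$ (equivalently $\pi:=\mathrm{ind}_{\tilde J}^G\tilde\rho$ is irreducible, hence supercuspidal). For each $(J,\rho)\in\mathcal J_G$ such a $(\tilde J,\tilde\rho)$ is fixed. $\mathcal J_G^{wc}\subset\mathcal J_G$ is the subset of pairs with $\mathcal I_G(\rho)\subset\tilde J$. $\mathcal H(G,\rho)=\mathrm{End}_G(\mathrm{ind}_J^G\rho)$. *)

theory Defs
  imports
    "HOL-Analysis.Analysis"
    "HOL-Algebra.Algebra"
    "HOL-Algebra.Algebraic_Closure_Type"
    "HOL-Library.Function_Algebras"
begin

section \<open>Complex vector spaces\<close>

class complex_vector = ab_group_add +
  fixes scaleC :: "complex \<Rightarrow> 'a \<Rightarrow> 'a"  (infixr \<open>*\<^sub>C\<close> 75)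
  assumes scaleC_add_right: "a *\<^sub>C (x + y) = a *\<^sub>C x + a *\<^sub>C y"
    and scaleC_add_left: "(a + b) *\<^sub>C x = a *\<^sub>C x + b *\<^sub>C x"
    and scaleC_scaleC: "a *\<^sub>C b *\<^sub>C x = (a * b) *\<^sub>C x"
    and scaleC_one: "1 *\<^sub>C x = x"

interpretation complex_vector: vector_space "scaleC :: complex \<Rightarrow> 'a \<Rightarrow> 'a::complex_vector"
  by unfold_locales
    (simp_all add: scaleC_add_right scaleC_add_left scaleC_scaleC scaleC_one)

instantiation "fun" :: (type, complex_vector) complex_vector
begin

definition scaleC_fun :: "complex \<Rightarrow> ('a \<Rightarrow> 'b) \<Rightarrow> 'a \<Rightarrow> 'b"
  where "scaleC_fun c f = (\<lambda>x. c *\<^sub>C f x)"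

instance
  by standard
    (simp_all add: scaleC_fun_def fun_eq_iff scaleC_add_right scaleC_add_left
      scaleC_scaleC scaleC_one)

end


section \<open>Non-archimedean local fields\<close>

definition valuation_topology :: "('f::field \<Rightarrow> real) \<Rightarrow> 'f topology"
  where "valuation_topology v = Metric_space.mtopology UNIV (\<lambda>x y. v (x - y))"

text \<open>\<open>v\<close> is the normalised absolute value: its value at a uniformiser \<open>\<pi>\<close>, an element of largest
  absolute value below 1, is the inverse of the cardinality of the residue field, whose elements
  are the residue discs \<open>{y. v (y - x) < 1}\<close> with \<open>v x \<le> 1\<close>.\<close>

locale nonarchimedean_local_field =
  fixes v :: "'f::field \<Rightarrow> real"
  assumes nonneg: "v x \<ge> 0"
    and eq_0_iff: "v x = 0 \<longleftrightarrow> x = 0"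
    and mult: "v (x * y) = v x * v y"
    and ultrametric: "v (x + y) \<le> max (v x) (v y)"
    and normalised:
      "\<exists>\<pi>. \<pi> \<noteq> 0 \<and> v \<pi> < 1 \<and> (\<forall>x. v x < 1 \<longrightarrow> v x \<le> v \<pi>) \<and>
        v \<pi> = 1 / real (card ((\<lambda>x. {y. v (y - x) < 1}) ` {x. v x \<le> 1}))"
    and locally_compact: "locally_compact_space (valuation_topology v)"


section \<open>Linear algebraic groups\<close>

definition matrix_group :: "('a::semiring_1^'n^'n) set \<Rightarrow> ('a^'n^'n) monoid"
  where "matrix_group S = \<lparr>carrier = S, mult = (**), one = mat 1\<rparr>"

definition GL :: "('a::semiring_1^'n^'n) set"
  where "GL = {A. invertible A}"

text \<open>Polynomial functions in the matrix entries with coefficients in \<open>C\<close>. They are used only over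
  an algebraically closed, hence infinite, field, where they can be identified with polynomials.\<close>

inductive_set poly_funs :: "'k::comm_ring_1 set \<Rightarrow> ('k^'n^'n \<Rightarrow> 'k) set" for C :: "'k set" where
  const: "c \<in> C \<Longrightarrow> (\<lambda>A. c) \<in> poly_funs C"
| coord: "(\<lambda>A. A $ i $ j) \<in> poly_funs C"
| add: "p \<in> poly_funs C \<Longrightarrow> q \<in> poly_funs C \<Longrightarrow> (\<lambda>A. p A + q A) \<in> poly_funs C"
| mult: "p \<in> poly_funs C \<Longrightarrow> q \<in> poly_funs C \<Longrightarrow> (\<lambda>A. p A * q A) \<in> poly_funs C"

definition zariski :: "('k::field^'n^'n) topology"
  where "zariski = topology_generated_by {{A. p A \<noteq> 0} | p. p \<in> poly_funs UNIV}"

definition linear_algebraic_group :: "('k::alg_closed_field^'n^'n) set \<Rightarrow> bool"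
  where "linear_algebraic_group \<G> \<longleftrightarrow>
    subgroup \<G> (matrix_group GL) \<and> closedin (subtopology zariski GL) \<G>"

definition vanishing_ideal :: "('k::field^'n^'n) set \<Rightarrow> ('k^'n^'n \<Rightarrow> 'k) set"
  where "vanishing_ideal Y = {p \<in> poly_funs UNIV. \<forall>A\<in>Y. p A = 0}"

text \<open>The vanishing ideal is spanned, over the algebraic closure, by the polynomials with
  coefficients in the base field that it contains.  The requirement is stronger than being the
  zero locus of such polynomials if the base field is not perfect.\<close>

definition defined_over_base :: "('f::field alg_closure^'n^'n) set \<Rightarrow> bool"
  where "defined_over_base Y \<longleftrightarrow>
    (\<forall>p\<in>vanishing_ideal Y. \<exists>m c q.
      (\<forall>i<(m::nat). q i \<in> vanishing_ideal Y \<inter> poly_funs (range to_ac)) \<and>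
      p = (\<lambda>A. \<Sum>i<m. c i * q i A))"

definition unipotent :: "'k::field^'n^'n \<Rightarrow> bool"
  where "unipotent A \<longleftrightarrow> (\<exists>k::nat. (((\<lambda>M. (A - mat 1) ** M) ^^ k) (mat 1)) = 0)"

definition reductive :: "('k::alg_closed_field^'n^'n) set \<Rightarrow> bool"
  where "reductive \<G> \<longleftrightarrow>
    (\<forall>U. linear_algebraic_group U \<and> U \<lhd> matrix_group \<G> \<and> connectedin zariski U \<and>
      (\<forall>u\<in>U. unipotent u) \<longrightarrow> U = {mat 1})"

text \<open>An \<open>F\<close>-group is given by its group of points over the algebraic closure of \<open>F\<close>,
  realised as a Zariski closed subgroup of some \<open>GL\<^sub>n\<close>, defined over \<open>F\<close>.\<close>

definition connected_reductive_group :: "('f::field alg_closure^'n^'n) set \<Rightarrow> bool"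
  where "connected_reductive_group \<G> \<longleftrightarrow>
    linear_algebraic_group \<G> \<and> defined_over_base \<G> \<and> connectedin zariski \<G> \<and> reductive \<G>"

definition center_of :: "('k::semiring_1^'n^'n) set \<Rightarrow> ('k^'n^'n) set"
  where "center_of \<G> = {z \<in> \<G>. \<forall>g\<in>\<G>. z ** g = g ** z}"

definition rational_points :: "('f::field alg_closure^'n^'n) set \<Rightarrow> ('f^'n^'n) set"
  where "rational_points Y = {A. map_matrix to_ac A \<in> Y}"

text \<open>Morphisms from \<open>\<G>\<close> to \<open>GL\<^sub>1\<close> defined over the base field; the coordinate ring
  of \<open>GL\<^sub>n\<close> is generated by the matrix entries and the inverse of the determinant.\<close>

definition rational_characters ::
    "('f::field alg_closure^'n^'n) set \<Rightarrow> ('f alg_closure^'n^'n \<Rightarrow> 'f alg_closure) set"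
  where "rational_characters \<G> =
    {\<psi>. (\<exists>p\<in>poly_funs (range to_ac). \<exists>k::nat. \<forall>g\<in>\<G>. \<psi> g = p g / det g ^ k) \<and>
      (\<forall>g\<in>\<G>. \<psi> g \<noteq> 0) \<and> (\<forall>g\<in>\<G>. \<forall>h\<in>\<G>. \<psi> (g ** h) = \<psi> g * \<psi> h)}"


section \<open>Groups of rational points\<close>

definition matrix_topology :: "('f::field \<Rightarrow> real) \<Rightarrow> ('f^'n^'n) topology"
  where "matrix_topology v =
    pullback_topology UNIV (\<lambda>A (i, j). A $ i $ j) (product_topology (\<lambda>_. valuation_topology v) UNIV)"

abbreviation points_group :: "('f::field alg_closure^'n^'n) set \<Rightarrow> ('f^'n^'n) monoid"
  where "points_group \<G> \<equiv> matrix_group (rational_points \<G>)"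

definition points_topology ::
    "('f::field \<Rightarrow> real) \<Rightarrow> ('f alg_closure^'n^'n) set \<Rightarrow> ('f^'n^'n) topology"
  where "points_topology v \<G> = subtopology (matrix_topology v) (rational_points \<G>)"

abbreviation points_center :: "('f::field alg_closure^'n^'n) set \<Rightarrow> ('f^'n^'n) set"
  where "points_center \<G> \<equiv> rational_points (center_of \<G>)"

definition unramified_character ::
    "('f::field \<Rightarrow> real) \<Rightarrow> ('f alg_closure^'n^'n \<Rightarrow> 'f alg_closure) \<Rightarrow> complex \<Rightarrow> 'f^'n^'n \<Rightarrow> complex"
  where "unramified_character v \<psi> s g =
    complex_of_real (v (of_ac (\<psi> (map_matrix to_ac g)))) powr s"

definition zero_subgroup ::
    "('f::field \<Rightarrow> real) \<Rightarrow> ('f alg_closure^'n^'n) set \<Rightarrow> ('f^'n^'n) set"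
  where "zero_subgroup v \<G> =
    {g \<in> rational_points \<G>. \<forall>\<psi>\<in>rational_characters \<G>. \<forall>s. unramified_character v \<psi> s g = 1}"

definition flat_subgroup ::
    "('f::field \<Rightarrow> real) \<Rightarrow> ('f alg_closure^'n^'n) set \<Rightarrow> ('f^'n^'n) set \<Rightarrow> bool"
  where "flat_subgroup v \<G> B \<longleftrightarrow>
    B \<lhd> points_group \<G> \<and> openin (points_topology v \<G>) B \<and>
    B \<subseteq> zero_subgroup v \<G> \<and> finite (rcosets\<^bsub>matrix_group (zero_subgroup v \<G>)\<^esub> B) \<and>
    derived (points_group \<G>) (rational_points \<G>) \<subseteq> B"


section \<open>Smooth representations\<close>

text \<open>Throughout, \<open>T\<close> is a topology on the carrier of the group \<open>G\<close>. A representation does not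
  record the subgroup \<open>H\<close> that acts; restriction to a smaller subgroup therefore leaves the
  record unchanged.\<close>

record ('g, 'v) rep =
  rspace :: "'v set"
  act :: "'g \<Rightarrow> 'v \<Rightarrow> 'v"

definition linear_between ::
    "'v::complex_vector set \<Rightarrow> 'w::complex_vector set \<Rightarrow> ('v \<Rightarrow> 'w) \<Rightarrow> bool"
  where "linear_between V W f \<longleftrightarrow>
    f ` V \<subseteq> W \<and> (\<forall>x\<in>V. \<forall>y\<in>V. f (x + y) = f x + f y) \<and> (\<forall>c. \<forall>x\<in>V. f (c *\<^sub>C x) = c *\<^sub>C f x)"

definition representation ::
    "('g, 'b) monoid_scheme \<Rightarrow> 'g set \<Rightarrow> ('g, 'v::complex_vector) rep \<Rightarrow> bool"
  where "representation G H \<sigma> \<longleftrightarrow>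
    complex_vector.subspace (rspace \<sigma>) \<and>
    (\<forall>h\<in>H. linear_between (rspace \<sigma>) (rspace \<sigma>) (act \<sigma> h)) \<and>
    (\<forall>x\<in>rspace \<sigma>. act \<sigma> \<one>\<^bsub>G\<^esub> x = x) \<and>
    (\<forall>h\<in>H. \<forall>k\<in>H. \<forall>x\<in>rspace \<sigma>. act \<sigma> (h \<otimes>\<^bsub>G\<^esub> k) x = act \<sigma> h (act \<sigma> k x))"

definition smooth :: "'g topology \<Rightarrow> 'g set \<Rightarrow> ('g, 'v::complex_vector) rep \<Rightarrow> bool"
  where "smooth T H \<sigma> \<longleftrightarrow>
    (\<forall>x\<in>rspace \<sigma>. openin (subtopology T H) {h \<in> H. act \<sigma> h x = x})"

definition subrep :: "'g set \<Rightarrow> 'v::complex_vector set \<Rightarrow> ('g, 'v) rep \<Rightarrow> bool"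
  where "subrep H W \<sigma> \<longleftrightarrow>
    complex_vector.subspace W \<and> W \<subseteq> rspace \<sigma> \<and> (\<forall>h\<in>H. act \<sigma> h ` W \<subseteq> W)"

definition irreducible_rep :: "'g set \<Rightarrow> ('g, 'v::complex_vector) rep \<Rightarrow> bool"
  where "irreducible_rep H \<sigma> \<longleftrightarrow>
    rspace \<sigma> \<noteq> {0} \<and> (\<forall>W. subrep H W \<sigma> \<longrightarrow> W = {0} \<or> W = rspace \<sigma>)"

definition Irr ::
    "('g, 'b) monoid_scheme \<Rightarrow> 'g topology \<Rightarrow> 'g set \<Rightarrow> ('g, 'v::complex_vector) rep set"
  where "Irr G T H = {\<sigma>. representation G H \<sigma> \<and> smooth T H \<sigma> \<and> irreducible_rep H \<sigma>}"

definition Hom ::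
    "'g set \<Rightarrow> ('g, 'v::complex_vector) rep \<Rightarrow> ('g, 'w::complex_vector) rep \<Rightarrow> ('v \<Rightarrow> 'w) set"
  where "Hom H \<sigma> \<tau> =
    {f \<in> extensional (rspace \<sigma>). linear_between (rspace \<sigma>) (rspace \<tau>) f \<and>
      (\<forall>h\<in>H. \<forall>x\<in>rspace \<sigma>. f (act \<sigma> h x) = act \<tau> h (f x))}"

definition contains_rep ::
    "'g set \<Rightarrow> ('g, 'v::complex_vector) rep \<Rightarrow> ('g, 'w::complex_vector) rep \<Rightarrow> bool"
  where "contains_rep H \<tau> \<sigma> \<longleftrightarrow> (\<exists>f\<in>Hom H \<sigma> \<tau>. inj_on f (rspace \<sigma>))"

definition isomorphic_rep ::
    "'g set \<Rightarrow> ('g, 'v::complex_vector) rep \<Rightarrow> ('g, 'w::complex_vector) rep \<Rightarrow> bool"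
  where "isomorphic_rep H \<sigma> \<tau> \<longleftrightarrow> (\<exists>f\<in>Hom H \<sigma> \<tau>. bij_betw f (rspace \<sigma>) (rspace \<tau>))"

text \<open>The restriction of \<open>\<sigma>\<close> to \<open>H\<close> is a direct sum of pairwise inequivalent irreducible
  representations.\<close>

definition multiplicity_free :: "'g set \<Rightarrow> ('g, 'v::complex_vector) rep \<Rightarrow> bool"
  where "multiplicity_free H \<sigma> \<longleftrightarrow>
    (\<exists>\<W>. (\<forall>W\<in>\<W>. subrep H W \<sigma> \<and> irreducible_rep H (\<sigma>\<lparr>rspace := W\<rparr>)) \<and>
      complex_vector.span (\<Union>\<W>) = rspace \<sigma> \<and>
      (\<forall>W\<in>\<W>. W \<inter> complex_vector.span (\<Union>(\<W> - {W})) = {0}) \<and>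
      (\<forall>W\<in>\<W>. \<forall>W'\<in>\<W>. W \<noteq> W' \<longrightarrow>
        \<not> isomorphic_rep H (\<sigma>\<lparr>rspace := W\<rparr>) (\<sigma>\<lparr>rspace := W'\<rparr>)))"


section \<open>Conjugation and intertwining\<close>

definition conj_set :: "('g, 'b) monoid_scheme \<Rightarrow> 'g set \<Rightarrow> 'g \<Rightarrow> 'g set"
  where "conj_set G H g = (\<lambda>h. g \<otimes>\<^bsub>G\<^esub> h \<otimes>\<^bsub>G\<^esub> inv\<^bsub>G\<^esub> g) ` H"

definition conj_rep :: "('g, 'b) monoid_scheme \<Rightarrow> ('g, 'v) rep \<Rightarrow> 'g \<Rightarrow> ('g, 'v) rep"
  where "conj_rep G \<sigma> g =
    \<lparr>rspace = rspace \<sigma>, act = (\<lambda>x. act \<sigma> (inv\<^bsub>G\<^esub> g \<otimes>\<^bsub>G\<^esub> x \<otimes>\<^bsub>G\<^esub> g))\<rparr>"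

definition intertwining ::
    "('g, 'b) monoid_scheme \<Rightarrow> 'g set \<Rightarrow> ('g, 'v::complex_vector) rep \<Rightarrow> 'g set"
  where "intertwining G H \<sigma> =
    {g \<in> carrier G. \<exists>f\<in>Hom (H \<inter> conj_set G H g) \<sigma> (conj_rep G \<sigma> g). \<exists>x\<in>rspace \<sigma>. f x \<noteq> 0}"


section \<open>Compact induction and Hecke algebras\<close>

definition quotient_topology :: "'a topology \<Rightarrow> ('a \<Rightarrow> 'b) \<Rightarrow> 'b topology"
  where "quotient_topology Y q =
    topology (\<lambda>U. U \<subseteq> q ` topspace Y \<and> openin Y {x \<in> topspace Y. q x \<in> U})"

lemma istopology_quotient:
  "istopology (\<lambda>U. U \<subseteq> q ` topspace Y \<and> openin Y {x \<in> topspace Y. q x \<in> U})" (is "istopology ?P")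
proof -
  have Int: "?P (S \<inter> S')" if "?P S" "?P S'" for S S'
  proof
    have "{x \<in> topspace Y. q x \<in> S \<inter> S'} =
        {x \<in> topspace Y. q x \<in> S} \<inter> {x \<in> topspace Y. q x \<in> S'}"
      by auto
    then show "openin Y {x \<in> topspace Y. q x \<in> S \<inter> S'}"
      using openin_Int[OF conjunct2[OF that(1)] conjunct2[OF that(2)]] by simp
    show "S \<inter> S' \<subseteq> q ` topspace Y"
      using that(1) by blast
  qed
  have Un: "?P (\<Union>\<K>)" if K: "\<forall>K\<in>\<K>. ?P K" for \<K>
  proof
    have eq: "{x \<in> topspace Y. q x \<in> \<Union>\<K>} = \<Union>((\<lambda>K. {x \<in> topspace Y. q x \<in> K}) ` \<K>)"
      by blast
    show "openin Y {x \<in> topspace Y. q x \<in> \<Union>\<K>}"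
      unfolding eq by (rule openin_Union) (use K in blast)
    show "\<Union>\<K> \<subseteq> q ` topspace Y"
      using K by blast
  qed
  show ?thesis
    unfolding istopology_def using Int Un by presburger
qed

lemma openin_quotient_topology:
  "openin (quotient_topology Y q) U \<longleftrightarrow>
    U \<subseteq> q ` topspace Y \<and> openin Y {x \<in> topspace Y. q x \<in> U}"
  unfolding quotient_topology_def topology_inverse'[OF istopology_quotient] by (rule refl)

lemma quotient_map_quotient_topology: "quotient_map Y (quotient_topology Y q) q"
proof -
  have sub: "{x \<in> topspace Y. q x \<in> q ` topspace Y} = topspace Y" by auto
  have top: "topspace (quotient_topology Y q) = q ` topspace Y"
  proof
    show "topspace (quotient_topology Y q) \<subseteq> q ` topspace Y"
      using openin_quotient_topology[of Y q "topspace (quotient_topology Y q)"] by simp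
    have "openin (quotient_topology Y q) (q ` topspace Y)"
      unfolding openin_quotient_topology sub by simp
    then show "q ` topspace Y \<subseteq> topspace (quotient_topology Y q)"
      by (rule openin_subset)
  qed
  show ?thesis
    unfolding quotient_map_def top openin_quotient_topology by simp
qed

text \<open>\<open>S\<close> has compact image in the space of cosets \<open>H g\<close>.\<close>

definition compact_modulo ::
    "('g, 'b) monoid_scheme \<Rightarrow> 'g topology \<Rightarrow> 'g set \<Rightarrow> 'g set \<Rightarrow> bool"
  where "compact_modulo G T H S \<longleftrightarrow>
    compactin (quotient_topology T (\<lambda>g. H #>\<^bsub>G\<^esub> g)) ((\<lambda>g. H #>\<^bsub>G\<^esub> g) ` S)"

text \<open>Functions on \<open>G\<close> are extended by zero to the ambient type.\<close>

definition compact_induction ::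
    "('g, 'b) monoid_scheme \<Rightarrow> 'g topology \<Rightarrow> 'g set \<Rightarrow> ('g, 'v::complex_vector) rep \<Rightarrow>
      ('g, 'g \<Rightarrow> 'v) rep"
  where "compact_induction G T H \<sigma> =
    \<lparr>rspace =
      {f. (\<forall>g\<in>carrier G. f g \<in> rspace \<sigma>) \<and> (\<forall>g. g \<notin> carrier G \<longrightarrow> f g = 0) \<and>
        (\<forall>h\<in>H. \<forall>g\<in>carrier G. f (h \<otimes>\<^bsub>G\<^esub> g) = act \<sigma> h (f g)) \<and>
        (\<exists>K. subgroup K G \<and> openin T K \<and> (\<forall>g\<in>carrier G. \<forall>k\<in>K. f (g \<otimes>\<^bsub>G\<^esub> k) = f g)) \<and>
        compact_modulo G T H {g \<in> carrier G. f g \<noteq> 0}},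
     act = (\<lambda>x f g. if g \<in> carrier G then f (g \<otimes>\<^bsub>G\<^esub> x) else 0)\<rparr>"

definition End_algebra ::
    "'g set \<Rightarrow> ('g, 'v::complex_vector) rep \<Rightarrow> (complex, 'v \<Rightarrow> 'v) module"
  where "End_algebra H \<sigma> =
    \<lparr>carrier = Hom H \<sigma> \<sigma>, mult = compose (rspace \<sigma>), one = (\<lambda>x\<in>rspace \<sigma>. x),
     ring.zero = (\<lambda>x\<in>rspace \<sigma>. 0), add = (\<lambda>f g. \<lambda>x\<in>rspace \<sigma>. f x + g x),
     smult = (\<lambda>c f. \<lambda>x\<in>rspace \<sigma>. c *\<^sub>C f x)\<rparr>"

definition hecke_algebra ::
    "('g, 'b) monoid_scheme \<Rightarrow> 'g topology \<Rightarrow> 'g set \<Rightarrow> ('g, 'v::complex_vector) rep \<Rightarrow>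
      (complex, ('g \<Rightarrow> 'v) \<Rightarrow> 'g \<Rightarrow> 'v) module"
  where "hecke_algebra G T J \<rho> = End_algebra (carrier G) (compact_induction G T J \<rho>)"


section \<open>Cuspidal pairs\<close>

definition open_compact_subgroups :: "('g, 'b) monoid_scheme \<Rightarrow> 'g topology \<Rightarrow> 'g set set"
  where "open_compact_subgroups G T = {H. subgroup H G \<and> openin T H \<and> compactin T H}"

definition open_compact_mod_subgroups ::
    "('g, 'b) monoid_scheme \<Rightarrow> 'g topology \<Rightarrow> 'g set \<Rightarrow> 'g set set"
  where "open_compact_mod_subgroups G T Z =
    {H. subgroup H G \<and> openin T H \<and> Z \<subseteq> H \<and> compact_modulo G T Z H}"

definition associated_pairs ::
    "('g, 'b) monoid_scheme \<Rightarrow> 'g topology \<Rightarrow> 'g set \<Rightarrow> 'g set \<Rightarrow>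
      'g set \<times> ('g, 'v::complex_vector) rep \<Rightarrow> ('g set \<times> ('g, 'v) rep) set"
  where "associated_pairs G T Z B = (\<lambda>(J, \<rho>).
    {(Jt, \<rho>t). Jt \<in> open_compact_mod_subgroups G T Z \<and> J = Jt \<inter> B \<and>
      \<rho>t \<in> Irr G T Jt \<and> contains_rep J \<rho>t \<rho> \<and> intertwining G Jt \<rho>t = Jt})"

text \<open>All spaces of representations in the following definitions are subspaces of one type \<open>'v\<close>.
  This is no restriction, as any two given complex vector spaces embed into a common one.\<close>

definition cuspidal_pairs ::
    "('g, 'b) monoid_scheme \<Rightarrow> 'g topology \<Rightarrow> 'g set \<Rightarrow> 'g set \<Rightarrow>
      ('g set \<times> ('g, 'v::complex_vector) rep) set"
  where "cuspidal_pairs G T Z B =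
    {(J, \<rho>). J \<in> open_compact_subgroups G T \<and> \<rho> \<in> Irr G T J \<and>
      associated_pairs G T Z B (J, \<rho>) \<noteq> {}}"

text \<open>\<open>assoc\<close> is the fixed choice of associated pairs.\<close>

definition wc_cuspidal_pairs ::
    "('g, 'b) monoid_scheme \<Rightarrow> 'g topology \<Rightarrow> 'g set \<Rightarrow> 'g set \<Rightarrow>
      ('g set \<times> ('g, 'v) rep \<Rightarrow> 'g set \<times> ('g, 'v) rep) \<Rightarrow>
      ('g set \<times> ('g, 'v::complex_vector) rep) set"
  where "wc_cuspidal_pairs G T Z B assoc =
    {(J, \<rho>) \<in> cuspidal_pairs G T Z B. intertwining G J \<rho> \<subseteq> fst (assoc (J, \<rho>))}"

end

theory Submission
  imports Defs
begin

text \<open>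
Write \<open>Jt\<close> and \<open>\<rho>t\<close> for the pair associated with \<open>J\<close> and \<open>\<rho>\<close>, and \<open>W0\<close> for a copy of \<open>\<rho>\<close> inside \<open>\<rho>t\<close>.
The quotient of \<open>G\<close> by \<open>B\<close> is abelian, \<open>J\<close> is normal in \<open>Jt\<close>, and the intertwining of \<open>\<rho>\<close> is contained in
\<open>Jt\<close>. These facts are combined with Clifford theory, with averaging over the compact group \<open>J\<close> and with Schur's lemma for
representations of countable dimension.

Clifford theory. If a representation of a group is spanned by the translates of one irreducible
subrepresentation \<open>W\<close> of a normal subgroup, its restriction to the normal subgroup is multiplicity free exactly
if every equivariant map from \<open>W\<close> to the whole space has values in \<open>W\<close> (\<open>clifford.multiplicity_free_iff\<close>).
This applies to \<open>W0\<close> in \<open>\<rho>t\<close>, and to \<open>X0\<close> in the induced representation \<open>\<pi>\<close>, where \<open>X0\<close> consists of the functions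
supported on \<open>Jt B\<close> whose values on \<open>B\<close> lie in \<open>W0\<close>; as a representation of \<open>B\<close> it is induced from \<open>W0\<close>.

The restriction of \<open>\<pi>\<close>. The bound on the intertwining shows that a \<open>J\<close>-equivariant map from \<open>W0\<close>
to \<open>\<pi>\<close> has values supported on \<open>Jt\<close> (\<open>W0_into_\<pi>\<close>). Hence \<open>X0\<close> is irreducible, by Mackey's argument, and
equivariant maps from \<open>X0\<close> to \<open>\<pi>\<close> correspond to equivariant maps from \<open>W0\<close> to \<open>\<rho>t\<close>. The two Clifford
criteria are therefore the same condition (\<open>multiplicity_free_\<pi>_iff\<close>).

The Hecke algebra. If \<open>\<rho>t\<close> is multiplicity free on \<open>J\<close>, then all \<open>J\<close>-equivariant maps from \<open>\<rho>\<close> to \<open>\<rho>t\<close>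
are multiples of the given embedding. After composition with it, an element of the Hecke algebra becomes a
linear combination of operators indexed by \<open>Jt\<close>, which commute with each other because \<open>Jt / J\<close> is abelian
(\<open>hecke_formula\<close>). Conversely, a map \<open>a\<close> on \<open>\<rho>\<close> that is equivariant up to conjugation by some \<open>g\<close> in \<open>Jt\<close>
defines a Hecke operator, and it also twists the space \<open>M\<close> of \<open>J\<close>-equivariant maps from \<open>\<rho>\<close> to \<open>\<rho>t\<close>. The space
\<open>M\<close> is irreducible under all twists, because \<open>\<rho>t\<close> is irreducible (\<open>multiplicity_rep_irreducible\<close>). If
the Hecke algebra is commutative, the twists commute, so they are scalar by Schur's lemma: \<open>M\<close> has
countable dimension because \<open>Jt\<close> has only countably many cosets modulo an open subgroup, which in turn
follows from the separability of the local field. Scalar twists are what the Clifford criterion requires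
(\<open>commutative_imp_multiplicity_free\<close>).
\<close>

(* The dollar sign denotes the components of a vector. *)
unbundle no fps_syntax

section \<open>Equivariant maps and irreducible subrepresentations\<close>

abbreviation cspan :: "'v::complex_vector set \<Rightarrow> 'v set"
  where "cspan \<equiv> complex_vector.span"

abbreviation csubspace :: "'v::complex_vector set \<Rightarrow> bool"
  where "csubspace \<equiv> complex_vector.subspace"

definition linear_action :: "'g set \<Rightarrow> ('g, 'v::complex_vector) rep \<Rightarrow> bool"
  where "linear_action H \<sigma> \<longleftrightarrow>
    csubspace (rspace \<sigma>) \<and> (\<forall>h\<in>H. linear_between (rspace \<sigma>) (rspace \<sigma>) (act \<sigma> h))"

text \<open>In contrast to the elements of \<open>Hom\<close>, an equivariant map is not normalised outside the space of \<open>\<sigma>\<close>, so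
  that equivariant maps can be composed and restricted without adjusting their values there.\<close>

definition equivariant ::
    "'g set \<Rightarrow> ('g, 'v::complex_vector) rep \<Rightarrow> ('g, 'w::complex_vector) rep \<Rightarrow> ('v \<Rightarrow> 'w) \<Rightarrow> bool"
  where "equivariant H \<sigma> \<tau> f \<longleftrightarrow> linear_between (rspace \<sigma>) (rspace \<tau>) f \<and>
    (\<forall>h\<in>H. \<forall>x\<in>rspace \<sigma>. f (act \<sigma> h x) = act \<tau> h (f x))"

text \<open>The irreducible subrepresentations of \<open>\<sigma>\<close> are represented by their underlying subspaces; the
  representation on \<open>W\<close> is \<open>\<sigma>\<lparr>rspace := W\<rparr>\<close>.\<close>

definition irreducible_subrep :: "'g set \<Rightarrow> ('g, 'v::complex_vector) rep \<Rightarrow> 'v set \<Rightarrow> bool"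
  where "irreducible_subrep H \<sigma> W \<longleftrightarrow> subrep H W \<sigma> \<and> irreducible_rep H (\<sigma>\<lparr>rspace := W\<rparr>)"

lemma linear_betweenD:
  assumes "linear_between V W f"
  shows "x \<in> V \<Longrightarrow> f x \<in> W"
    and "x \<in> V \<Longrightarrow> y \<in> V \<Longrightarrow> f (x + y) = f x + f y"
    and "x \<in> V \<Longrightarrow> f (c *\<^sub>C x) = c *\<^sub>C f x"
  using assms by (auto simp: linear_between_def)

lemma linear_betweenI:
  assumes "\<And>x. x \<in> V \<Longrightarrow> f x \<in> W"
    and "\<And>x y. x \<in> V \<Longrightarrow> y \<in> V \<Longrightarrow> f (x + y) = f x + f y"
    and "\<And>c x. x \<in> V \<Longrightarrow> f (c *\<^sub>C x) = c *\<^sub>C f x"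
  shows "linear_between V W f"
  using assms by (auto simp: linear_between_def)

lemma linear_between_zero:
  assumes "linear_between V W f" "csubspace V"
  shows "f 0 = 0"
proof -
  have "f (0 *\<^sub>C 0) = 0 *\<^sub>C f 0"
    using assms by (metis linear_betweenD(3) complex_vector.subspace_0)
  then show ?thesis
    by (metis complex_vector.scale_zero_left)
qed

lemma scaleC_minus1: "(- 1) *\<^sub>C x = - x"
  by (metis complex_vector.scale_minus_left scaleC_one)

lemma linear_between_diff:
  assumes "linear_between V W f" "csubspace V" "x \<in> V" "y \<in> V"
  shows "f (x - y) = f x - f y"
proof -
  have "- y \<in> V" "f (- y) = - f y"
    using assms linear_betweenD(3)[OF assms(1,4), of "-1"]
    by (auto simp: scaleC_minus1 complex_vector.subspace_neg)
  then show ?thesis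
    using linear_betweenD(2)[OF assms(1,3) \<open>- y \<in> V\<close>] by simp
qed

lemma linear_between_sum:
  assumes "linear_between V W f" "csubspace V" "\<And>i. i \<in> I \<Longrightarrow> x i \<in> V"
  shows "f (\<Sum>i\<in>I. x i) = (\<Sum>i\<in>I. f (x i))"
  using assms(3)
proof (induction I rule: infinite_finite_induct)
  case (insert i I)
  then have "(\<Sum>i\<in>I. x i) \<in> V"
    by (intro complex_vector.subspace_sum[OF assms(2)]) auto
  then show ?case
    using insert by (simp add: linear_betweenD(2)[OF assms(1)])
qed (auto simp: linear_between_zero[OF assms(1,2)])

lemma linear_between_mono:
  assumes "linear_between V W f" "V' \<subseteq> V" "\<And>x. x \<in> V' \<Longrightarrow> f x \<in> W'"
  shows "linear_between V' W' f"
  using assms by (auto simp: linear_between_def subset_iff)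

lemma subspace_image_linear_between:
  assumes "linear_between V W f" "csubspace V"
  shows "csubspace (f ` V)"
proof (rule complex_vector.subspaceI)
  show "0 \<in> f ` V"
    using linear_between_zero[OF assms] complex_vector.subspace_0[OF assms(2)] by force
next
  fix x y assume "x \<in> f ` V" "y \<in> f ` V"
  then obtain a b where "a \<in> V" "b \<in> V" "x = f a" "y = f b" by blast
  then show "x + y \<in> f ` V"
    using linear_betweenD(2)[OF assms(1)] complex_vector.subspace_add[OF assms(2)] by (metis image_eqI)
next
  fix c x assume "x \<in> f ` V"
  then obtain a where "a \<in> V" "x = f a" by blast
  then show "c *\<^sub>C x \<in> f ` V"
    using linear_betweenD(3)[OF assms(1)] complex_vector.subspace_scale[OF assms(2)] by (metis image_eqI)
qed

lemma subspace_preimage_linear_between: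
  assumes "linear_between V W f" "csubspace V" "csubspace U"
  shows "csubspace {x \<in> V. f x \<in> U}"
  by (rule complex_vector.subspaceI)
    (auto simp: linear_betweenD[OF assms(1)] linear_between_zero[OF assms(1,2)]
      complex_vector.subspace_0 complex_vector.subspace_add complex_vector.subspace_scale assms)

lemma linear_between_span_subset:
  assumes "linear_between V W f" "csubspace V" "S \<subseteq> V" "\<And>x. x \<in> S \<Longrightarrow> f x \<in> U" "csubspace U"
    and "x \<in> cspan S"
  shows "f x \<in> U"
proof -
  have "cspan S \<subseteq> {x \<in> V. f x \<in> U}"
    using assms by (intro complex_vector.span_minimal subspace_preimage_linear_between) auto
  then show ?thesis using assms(6) by auto
qed

lemma span_union_subspaces:
  assumes "csubspace A" "csubspace C"
  shows "x \<in> cspan (A \<union> C) \<longleftrightarrow> (\<exists>a\<in>A. \<exists>c\<in>C. x = a + c)"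
proof -
  have "cspan A = A" "cspan C = C"
    using assms by (metis complex_vector.span_eq_iff)+
  then show ?thesis
    unfolding complex_vector.span_Un \<open>cspan A = A\<close> \<open>cspan C = C\<close> by auto
qed

lemma linear_actionD:
  assumes "linear_action H \<sigma>"
  shows "csubspace (rspace \<sigma>)"
    and "h \<in> H \<Longrightarrow> linear_between (rspace \<sigma>) (rspace \<sigma>) (act \<sigma> h)"
  using assms by (auto simp: linear_action_def)

lemma representation_linear_action: "representation G H \<sigma> \<Longrightarrow> linear_action H \<sigma>"
  by (simp add: representation_def linear_action_def)

lemma equivariantD:
  assumes "equivariant H \<sigma> \<tau> f"
  shows "linear_between (rspace \<sigma>) (rspace \<tau>) f"
    and "h \<in> H \<Longrightarrow> x \<in> rspace \<sigma> \<Longrightarrow> f (act \<sigma> h x) = act \<tau> h (f x)"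
  using assms by (auto simp: equivariant_def)

lemma subrepD:
  assumes "subrep H W \<sigma>"
  shows "csubspace W" "W \<subseteq> rspace \<sigma>" "h \<in> H \<Longrightarrow> x \<in> W \<Longrightarrow> act \<sigma> h x \<in> W"
  using assms by (auto simp: subrep_def)

lemma subrep_rspace: "linear_action H \<sigma> \<Longrightarrow> subrep H (rspace \<sigma>) \<sigma>"
  by (auto simp: subrep_def linear_action_def linear_between_def)

lemma linear_action_subrep:
  "linear_action H \<sigma> \<Longrightarrow> subrep H W \<sigma> \<Longrightarrow> linear_action H (\<sigma>\<lparr>rspace := W\<rparr>)"
  by (auto simp: subrep_def linear_action_def linear_between_def subset_iff image_subset_iff)

lemma subrep_rspace_update:
  "subrep H W \<sigma> \<Longrightarrow> subrep H U (\<sigma>\<lparr>rspace := W\<rparr>) \<longleftrightarrow> subrep H U \<sigma> \<and> U \<subseteq> W"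
  by (auto simp: subrep_def)

lemma irreducible_subrepD:
  assumes "irreducible_subrep H \<sigma> W"
  shows "subrep H W \<sigma>" "W \<noteq> {0}" "subrep H U \<sigma> \<Longrightarrow> U \<subseteq> W \<Longrightarrow> U = {0} \<or> U = W"
  using assms by (auto simp: irreducible_subrep_def irreducible_rep_def subrep_rspace_update)

lemma irreducible_subrepI:
  assumes "subrep H W \<sigma>" "W \<noteq> {0}" "\<And>U. subrep H U \<sigma> \<Longrightarrow> U \<subseteq> W \<Longrightarrow> U = {0} \<or> U = W"
  shows "irreducible_subrep H \<sigma> W"
  using assms by (auto simp: irreducible_subrep_def irreducible_rep_def subrep_rspace_update)

lemma subrep_Int: "subrep H A \<sigma> \<Longrightarrow> subrep H C \<sigma> \<Longrightarrow> subrep H (A \<inter> C) \<sigma>"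
  by (auto simp: subrep_def complex_vector.subspace_inter image_subset_iff)

lemma subrep_span:
  assumes "linear_action H \<sigma>" "\<And>W. W \<in> \<W> \<Longrightarrow> subrep H W \<sigma>"
  shows "subrep H (cspan (\<Union>\<W>)) \<sigma>"
proof -
  have sub: "\<Union>\<W> \<subseteq> rspace \<sigma>"
    using assms(2) by (auto simp: subrep_def)
  have "act \<sigma> h x \<in> cspan (\<Union>\<W>)" if "h \<in> H" "x \<in> cspan (\<Union>\<W>)" for h x
  proof (rule linear_between_span_subset[OF linear_actionD(2)[OF assms(1) that(1)] _ sub _ _ that(2)])
    show "act \<sigma> h x \<in> cspan (\<Union>\<W>)" if "x \<in> \<Union>\<W>" for x
      using assms(2) \<open>h \<in> H\<close> that by (meson UnionE UnionI complex_vector.span_base subrepD(3))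
  qed (use assms linear_actionD in auto)
  moreover have "cspan (\<Union>\<W>) \<subseteq> rspace \<sigma>"
    using sub linear_actionD(1)[OF assms(1)] by (rule complex_vector.span_minimal)
  ultimately show ?thesis
    by (auto simp: subrep_def)
qed

lemma subrep_span_Un:
  assumes "linear_action H \<sigma>" "subrep H A \<sigma>" "subrep H C \<sigma>"
  shows "subrep H (cspan (A \<union> C)) \<sigma>"
  using subrep_span[OF assms(1), of "{A, C}"] assms(2,3) by auto

lemma irreducible_not_subset_Int:
  assumes "irreducible_subrep H \<sigma> W" "subrep H A \<sigma>" "\<not> W \<subseteq> A"
  shows "A \<inter> W = {0}"
  using irreducible_subrepD(3)[OF assms(1) subrep_Int[OF assms(2) irreducible_subrepD(1)[OF assms(1)]]]
    assms(3) by auto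

lemma subrep_kernel:
  assumes "linear_action H \<sigma>" "equivariant H \<sigma> \<tau> f" "linear_action H \<tau>"
  shows "subrep H {x \<in> rspace \<sigma>. f x = 0} \<sigma>"
proof -
  have "csubspace {x \<in> rspace \<sigma>. f x \<in> {0}}"
    using assms by (intro subspace_preimage_linear_between[OF equivariantD(1)[OF assms(2)]])
      (auto simp: linear_action_def)
  moreover have "f (act \<sigma> h x) = 0" if "h \<in> H" "x \<in> rspace \<sigma>" "f x = 0" for h x
    using equivariantD(2)[OF assms(2) that(1,2)] that(3)
      linear_between_zero[OF linear_actionD(2)[OF assms(3) that(1)] linear_actionD(1)[OF assms(3)]] by simp
  ultimately show ?thesis
    using linear_betweenD(1)[OF linear_actionD(2)[OF assms(1)]] by (auto simp: subrep_def)
qed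

lemma subrep_image:
  assumes "linear_action H \<sigma>" "equivariant H \<sigma> \<tau> f"
  shows "subrep H (f ` rspace \<sigma>) \<tau>"
proof -
  have "act \<tau> h (f x) \<in> f ` rspace \<sigma>" if "h \<in> H" "x \<in> rspace \<sigma>" for h x
    using equivariantD(2)[OF assms(2) that] linear_betweenD(1)[OF linear_actionD(2)[OF assms(1) that(1)] that(2)]
    by (metis image_eqI)
  then show ?thesis
    using subspace_image_linear_between[OF equivariantD(1)[OF assms(2)] linear_actionD(1)[OF assms(1)]]
      linear_betweenD(1)[OF equivariantD(1)[OF assms(2)]]
    by (auto simp: subrep_def)
qed

lemma linear_between_inj_on_iff:
  assumes "linear_between V W f" "csubspace V"
  shows "inj_on f V \<longleftrightarrow> (\<forall>x\<in>V. f x = 0 \<longrightarrow> x = 0)"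
proof
  show "\<forall>x\<in>V. f x = 0 \<longrightarrow> x = 0" if "inj_on f V"
    using that linear_between_zero[OF assms] complex_vector.subspace_0[OF assms(2)]
    by (metis inj_onD)
  show "inj_on f V" if *: "\<forall>x\<in>V. f x = 0 \<longrightarrow> x = 0"
  proof (rule inj_onI)
    fix x y assume "x \<in> V" "y \<in> V" "f x = f y"
    then have "f (x - y) = 0" "x - y \<in> V"
      using linear_between_diff[OF assms] complex_vector.subspace_diff[OF assms(2)] by auto
    then show "x = y" using * by force
  qed
qed

lemma equivariant_inj_on:
  assumes "linear_action H \<sigma>" "irreducible_rep H \<sigma>" "linear_action H \<tau>" "equivariant H \<sigma> \<tau> f"
    and "x \<in> rspace \<sigma>" "f x \<noteq> 0"
  shows "inj_on f (rspace \<sigma>)"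
proof -
  have "{x \<in> rspace \<sigma>. f x = 0} = {0} \<or> {x \<in> rspace \<sigma>. f x = 0} = rspace \<sigma>"
    using subrep_kernel[OF assms(1,4,3)] assms(2) by (auto simp: irreducible_rep_def)
  then show ?thesis
    using assms(5,6) linear_between_inj_on_iff[OF equivariantD(1)[OF assms(4)] linear_actionD(1)[OF assms(1)]]
    by blast
qed

lemma equivariant_inv_into:
  assumes "linear_action H \<sigma>" "equivariant H \<sigma> \<tau> f" "inj_on f (rspace \<sigma>)"
  shows "equivariant H (\<tau>\<lparr>rspace := f ` rspace \<sigma>\<rparr>) \<sigma> (inv_into (rspace \<sigma>) f)"
proof -
  let ?V = "rspace \<sigma>"
  note V = linear_actionD(1)[OF assms(1)]
  note lin = linear_betweenD[OF equivariantD(1)[OF assms(2)]]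
  have "linear_between (f ` ?V) ?V (inv_into ?V f)"
  proof (rule linear_betweenI)
    show "inv_into ?V f x \<in> ?V" if "x \<in> f ` ?V" for x
      using that by (rule inv_into_into)
    show "inv_into ?V f (x + y) = inv_into ?V f x + inv_into ?V f y"
      if xy: "x \<in> f ` ?V" "y \<in> f ` ?V" for x y
    proof -
      obtain a b where "a \<in> ?V" "b \<in> ?V" "x = f a" "y = f b" using xy by blast
      moreover have "x + y = f (a + b)" "a + b \<in> ?V"
        using calculation lin V by (auto simp: complex_vector.subspace_add)
      ultimately show ?thesis using assms(3) by simp
    qed
    show "inv_into ?V f (c *\<^sub>C x) = c *\<^sub>C inv_into ?V f x" if x: "x \<in> f ` ?V" for c x
    proof -
      obtain a where "a \<in> ?V" "x = f a" using x by blast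
      moreover have "c *\<^sub>C x = f (c *\<^sub>C a)" "c *\<^sub>C a \<in> ?V"
        using calculation lin V by (auto simp: complex_vector.subspace_scale)
      ultimately show ?thesis using assms(3) by simp
    qed
  qed
  moreover have "inv_into ?V f (act \<tau> h x) = act \<sigma> h (inv_into ?V f x)"
    if hx: "h \<in> H" "x \<in> f ` ?V" for h x
  proof -
    obtain a where "a \<in> ?V" "x = f a" using hx(2) by blast
    moreover have "act \<tau> h x = f (act \<sigma> h a)" "act \<sigma> h a \<in> ?V"
      using calculation equivariantD(2)[OF assms(2) hx(1)] linear_betweenD(1)[OF linear_actionD(2)[OF assms(1) hx(1)]]
      by auto
    ultimately show ?thesis using assms(3) by simp
  qed
  ultimately show ?thesis
    by (simp add: equivariant_def)
qed

lemma equivariant_compose: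
  "equivariant H \<sigma> \<tau> f \<Longrightarrow> equivariant H \<tau> \<upsilon> g \<Longrightarrow> equivariant H \<sigma> \<upsilon> (\<lambda>x. g (f x))"
  by (auto simp: equivariant_def linear_between_def image_subset_iff)

lemma equivariant_subspace:
  "equivariant H \<sigma> \<tau> f \<Longrightarrow> U \<subseteq> rspace \<sigma> \<Longrightarrow> equivariant H (\<sigma>\<lparr>rspace := U\<rparr>) \<tau> f"
  by (auto simp: equivariant_def linear_between_def image_subset_iff subset_iff)

lemma equivariant_codomain:
  "equivariant H \<sigma> \<tau> f \<Longrightarrow> (\<And>x. x \<in> rspace \<sigma> \<Longrightarrow> f x \<in> U) \<Longrightarrow> equivariant H \<sigma> (\<tau>\<lparr>rspace := U\<rparr>) f"
  by (auto simp: equivariant_def linear_between_def image_subset_iff)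

lemma equivariant_codomain_superspace:
  "equivariant H \<sigma> (\<tau>\<lparr>rspace := U\<rparr>) f \<Longrightarrow> U \<subseteq> rspace \<tau> \<Longrightarrow> equivariant H \<sigma> \<tau> f"
  by (auto simp: equivariant_def linear_between_def image_subset_iff)

lemma isomorphic_rep_iff:
  assumes "linear_action H \<sigma>"
  shows "isomorphic_rep H \<sigma> \<tau> \<longleftrightarrow> (\<exists>f. equivariant H \<sigma> \<tau> f \<and> bij_betw f (rspace \<sigma>) (rspace \<tau>))"
proof
  show "isomorphic_rep H \<sigma> \<tau> \<Longrightarrow> \<exists>f. equivariant H \<sigma> \<tau> f \<and> bij_betw f (rspace \<sigma>) (rspace \<tau>)"
    by (auto simp: isomorphic_rep_def Hom_def equivariant_def)
next
  assume "\<exists>f. equivariant H \<sigma> \<tau> f \<and> bij_betw f (rspace \<sigma>) (rspace \<tau>)"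
  then obtain f where f: "equivariant H \<sigma> \<tau> f" "bij_betw f (rspace \<sigma>) (rspace \<tau>)" by blast
  let ?f = "restrict f (rspace \<sigma>)"
  have "linear_between (rspace \<sigma>) (rspace \<tau>) ?f"
    using equivariantD(1)[OF f(1)] linear_actionD(1)[OF assms]
    by (auto simp: linear_between_def complex_vector.subspace_add complex_vector.subspace_scale)
  moreover have "act \<sigma> h x \<in> rspace \<sigma>" if "h \<in> H" "x \<in> rspace \<sigma>" for h x
    using that linear_betweenD(1)[OF linear_actionD(2)[OF assms]] by blast
  ultimately have "?f \<in> Hom H \<sigma> \<tau>"
    using f(1) by (auto simp: Hom_def equivariant_def)
  moreover have "bij_betw ?f (rspace \<sigma>) (rspace \<tau>)"
    using f(2) by (simp add: bij_betw_restrict_eq)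
  ultimately show "isomorphic_rep H \<sigma> \<tau>"
    unfolding isomorphic_rep_def by blast
qed

lemma isomorphic_rep_sym:
  assumes "linear_action H \<sigma>" "linear_action H \<tau>" "isomorphic_rep H \<sigma> \<tau>"
  shows "isomorphic_rep H \<tau> \<sigma>"
proof -
  obtain f where f: "equivariant H \<sigma> \<tau> f" "bij_betw f (rspace \<sigma>) (rspace \<tau>)"
    using assms isomorphic_rep_iff by blast
  have "f ` rspace \<sigma> = rspace \<tau>" "inj_on f (rspace \<sigma>)"
    using f(2) by (auto simp: bij_betw_def)
  then have "equivariant H \<tau> \<sigma> (inv_into (rspace \<sigma>) f)"
    using equivariant_inv_into[OF assms(1) f(1)] by simp
  then show ?thesis
    using isomorphic_rep_iff[OF assms(2)] bij_betw_inv_into[OF f(2)] by blast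
qed

lemma isomorphic_rep_trans:
  assumes "linear_action H \<sigma>" "linear_action H \<tau>" "isomorphic_rep H \<sigma> \<tau>" "isomorphic_rep H \<tau> \<upsilon>"
  shows "isomorphic_rep H \<sigma> \<upsilon>"
proof -
  obtain f where "equivariant H \<sigma> \<tau> f" "bij_betw f (rspace \<sigma>) (rspace \<tau>)"
    using isomorphic_rep_iff[OF assms(1)] assms(3) by blast
  moreover obtain g where "equivariant H \<tau> \<upsilon> g" "bij_betw g (rspace \<tau>) (rspace \<upsilon>)"
    using isomorphic_rep_iff[OF assms(2)] assms(4) by blast
  ultimately have "equivariant H \<sigma> \<upsilon> (\<lambda>x. g (f x))" "bij_betw (\<lambda>x. g (f x)) (rspace \<sigma>) (rspace \<upsilon>)"
    using equivariant_compose bij_betw_trans[unfolded comp_def] by blast+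
  then show ?thesis
    using isomorphic_rep_iff[OF assms(1)] by blast
qed

lemma isomorphic_image:
  assumes "linear_action H \<sigma>" "equivariant H \<sigma> \<tau> f" "inj_on f (rspace \<sigma>)"
  shows "isomorphic_rep H \<sigma> (\<tau>\<lparr>rspace := f ` rspace \<sigma>\<rparr>)"
  unfolding isomorphic_rep_iff[OF assms(1)]
  using equivariant_codomain[OF assms(2), of "f ` rspace \<sigma>"] assms(3) by (auto simp: bij_betw_def)

lemma irreducible_subrep_image:
  assumes "linear_action H \<sigma>" "irreducible_rep H \<sigma>" "linear_action H \<tau>" "equivariant H \<sigma> \<tau> f"
    and "inj_on f (rspace \<sigma>)"
  shows "irreducible_subrep H \<tau> (f ` rspace \<sigma>)"
proof (rule irreducible_subrepI)
  note lin = equivariantD(1)[OF assms(4)] and V = linear_actionD(1)[OF assms(1)]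
  show "subrep H (f ` rspace \<sigma>) \<tau>"
    using assms(1,4) by (rule subrep_image)
  show "f ` rspace \<sigma> \<noteq> {0}"
  proof
    assume "f ` rspace \<sigma> = {0}"
    then have "x = 0" if "x \<in> rspace \<sigma>" for x
      using that assms(5) linear_between_inj_on_iff[OF lin V] by blast
    then show False
      using assms(2) complex_vector.subspace_0[OF V] by (auto simp: irreducible_rep_def)
  qed
  fix U assume U: "subrep H U \<tau>" "U \<subseteq> f ` rspace \<sigma>"
  let ?P = "{x \<in> rspace \<sigma>. f x \<in> U}"
  have "subrep H ?P \<sigma>"
    unfolding subrep_def
    using subspace_preimage_linear_between[OF lin V subrepD(1)[OF U(1)]]
      linear_betweenD(1)[OF linear_actionD(2)[OF assms(1)]] equivariantD(2)[OF assms(4)] subrepD(3)[OF U(1)]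
    by auto
  then have "?P = {0} \<or> ?P = rspace \<sigma>"
    using assms(2) by (simp add: irreducible_rep_def)
  moreover have "f ` ?P = U" using U(2) by auto
  ultimately show "U = {0} \<or> U = f ` rspace \<sigma>"
    using linear_between_zero[OF lin V] by auto
qed

section \<open>Semisimple representations\<close>

text \<open>A sum of irreducible subrepresentations splits over any subrepresentation: by Zorn's lemma there
  is a subrepresentation \<open>M\<close> containing \<open>A\<close> and maximal among those that avoid \<open>x\<close>. Adding to it an
  irreducible \<open>W\<close> that it does not contain captures \<open>x\<close>; a further independent irreducible would
  capture \<open>x\<close> as well, which is impossible because the two enlargements intersect in \<open>M\<close>. So \<open>M\<close> is a
  complement of \<open>W\<close>, and the projection to \<open>W\<close> separates \<open>x\<close> from \<open>A\<close>.\<close>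

lemma semisimple_separation:
  assumes "linear_action H \<sigma>" "\<And>W. W \<in> \<W> \<Longrightarrow> irreducible_subrep H \<sigma> W" "subrep H A \<sigma>"
    and "rspace \<sigma> \<subseteq> cspan (A \<union> \<Union>\<W>)" "x \<in> rspace \<sigma>" "x \<notin> A"
  shows "\<exists>W\<in>\<W>. \<exists>p. equivariant H \<sigma> (\<sigma>\<lparr>rspace := W\<rparr>) p \<and> (\<forall>a\<in>A. p a = 0) \<and> p x \<noteq> 0"
proof -
  define \<M> where "\<M> = {M. subrep H M \<sigma> \<and> A \<subseteq> M \<and> x \<notin> M}"
  have "\<Union>\<C> \<in> \<M>" if \<C>: "\<C> \<noteq> {}" "subset.chain \<M> \<C>" for \<C>
  proof -
    have mem: "subrep H M \<sigma>" "A \<subseteq> M" "x \<notin> M" if "M \<in> \<C>" for M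
      using \<C>(2) that by (auto simp: \<M>_def subset_chain_def)
    have "csubspace (\<Union>\<C>)"
    proof (rule complex_vector.subspaceI)
      obtain M where "M \<in> \<C>" using \<C>(1) by blast
      then show "0 \<in> \<Union>\<C>"
        using complex_vector.subspace_0[OF subrepD(1)[OF mem(1)]] by blast
    next
      fix a b assume "a \<in> \<Union>\<C>" "b \<in> \<Union>\<C>"
      then obtain M1 M2 where "M1 \<in> \<C>" "a \<in> M1" "M2 \<in> \<C>" "b \<in> M2" by blast
      moreover have "M1 \<subseteq> M2 \<or> M2 \<subseteq> M1"
        using \<C>(2) calculation(1,3) by (simp add: subset_chain_def)
      ultimately obtain M where "M \<in> \<C>" "a \<in> M" "b \<in> M" by blast
      then show "a + b \<in> \<Union>\<C>"
        using complex_vector.subspace_add[OF subrepD(1)[OF mem(1)]] by blast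
    next
      fix c a assume "a \<in> \<Union>\<C>"
      then obtain M where "M \<in> \<C>" "a \<in> M" by blast
      then show "c *\<^sub>C a \<in> \<Union>\<C>"
        using complex_vector.subspace_scale[OF subrepD(1)[OF mem(1)]] by blast
    qed
    moreover have "\<Union>\<C> \<subseteq> rspace \<sigma>"
      using subrepD(2)[OF mem(1)] by blast
    moreover have "act \<sigma> h y \<in> \<Union>\<C>" if hy: "h \<in> H" "y \<in> \<Union>\<C>" for h y
    proof -
      obtain M where "M \<in> \<C>" "y \<in> M" using hy(2) by blast
      then show ?thesis using subrepD(3)[OF mem(1) hy(1)] by blast
    qed
    moreover have "A \<subseteq> \<Union>\<C>" "x \<notin> \<Union>\<C>"
      using mem \<C>(1) by blast+
    ultimately show ?thesis
      by (simp add: \<M>_def subrep_def image_subset_iff)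
  qed
  moreover have "A \<in> \<M>" using assms by (simp add: \<M>_def)
  ultimately obtain M where M: "M \<in> \<M>" and max: "\<And>M'. M' \<in> \<M> \<Longrightarrow> M \<subseteq> M' \<Longrightarrow> M' = M"
    using subset_Zorn_nonempty[of \<M>] by blast
  have sM: "subrep H M \<sigma>" "A \<subseteq> M" "x \<notin> M" using M by (auto simp: \<M>_def)
  note subM = subrepD(1)[OF sM(1)]
  have "\<exists>W\<in>\<W>. \<not> W \<subseteq> M"
  proof (rule ccontr)
    assume "\<not> ?thesis"
    then have "A \<union> \<Union>\<W> \<subseteq> M" using sM(2) by blast
    then have "cspan (A \<union> \<Union>\<W>) \<subseteq> M"
      using subM by (rule complex_vector.span_minimal)
    then show False using assms(4,5) sM(3) by blast
  qed
  then obtain W where W: "W \<in> \<W>" "\<not> W \<subseteq> M" by blast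
  note sW = irreducible_subrepD(1)[OF assms(2)[OF W(1)]]
  \<comment> \<open>Enlarging \<open>M\<close> by any subrepresentation outside it destroys the maximality, so it adds \<open>x\<close>.\<close>
  have capture: "x \<in> cspan (M \<union> W')" if "subrep H W' \<sigma>" "\<not> W' \<subseteq> M" for W'
  proof (rule ccontr)
    assume "x \<notin> cspan (M \<union> W')"
    moreover have "M \<subseteq> cspan (M \<union> W')" "W' \<subseteq> cspan (M \<union> W')"
      using complex_vector.span_superset[of "M \<union> W'"] by simp_all
    ultimately have "cspan (M \<union> W') \<in> \<M>"
      using subrep_span_Un[OF assms(1) sM(1) that(1)] sM(2) unfolding \<M>_def by simp
    then have "cspan (M \<union> W') = M"
      using \<open>M \<subseteq> cspan (M \<union> W')\<close> by (rule max)
    then show False using that(2) \<open>W' \<subseteq> cspan (M \<union> W')\<close> by simp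
  qed
  have MW: "M \<inter> W = {0}"
    using irreducible_not_subset_Int[OF assms(2)[OF W(1)] sM(1) W(2)] .
  have all: "rspace \<sigma> \<subseteq> cspan (M \<union> W)"
  proof -
    have "W' \<subseteq> cspan (M \<union> W)" if W': "W' \<in> \<W>" for W'
    proof (rule ccontr)
      assume *: "\<not> W' \<subseteq> cspan (M \<union> W)"
      note sW' = irreducible_subrepD(1)[OF assms(2)[OF W']]
      have "\<not> W' \<subseteq> M"
        using * complex_vector.span_superset[of "M \<union> W"] by blast
      then obtain m w m' w' where eq: "x = m + w" "x = m' + w'" "m \<in> M" "w \<in> W" "m' \<in> M" "w' \<in> W'"
        using capture[OF sW W(2)] capture[OF sW']
        unfolding span_union_subspaces[OF subM subrepD(1)[OF sW]] span_union_subspaces[OF subM subrepD(1)[OF sW']]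
        by blast
      \<comment> \<open>The two ways of writing \<open>x\<close> put \<open>w'\<close> into the intersection of \<open>W'\<close> with \<open>M + W\<close>, which is zero.\<close>
      have "w' = (m - m') + w" using eq by (simp add: algebra_simps)
      moreover have "m - m' \<in> M" using eq subM by (simp add: complex_vector.subspace_diff)
      ultimately have "w' \<in> cspan (M \<union> W)"
        using eq(4) unfolding span_union_subspaces[OF subM subrepD(1)[OF sW]] by blast
      then have "w' = 0"
        using irreducible_not_subset_Int[OF assms(2)[OF W'] subrep_span_Un[OF assms(1) sM(1) sW] *] eq
        by blast
      then show False using eq sM(3) by simp
    qed
    then have "A \<union> \<Union>\<W> \<subseteq> cspan (M \<union> W)"
      using sM(2) complex_vector.span_superset[of "M \<union> W"] by auto
    then have "cspan (A \<union> \<Union>\<W>) \<subseteq> cspan (M \<union> W)"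
      by (rule complex_vector.span_minimal) (rule complex_vector.subspace_span)
    then show ?thesis using assms(4) by blast
  qed
  have ex: "\<exists>w. w \<in> W \<and> y - w \<in> M" if y: "y \<in> rspace \<sigma>" for y
  proof -
    obtain a c where "a \<in> M" "c \<in> W" "y = a + c"
      using subsetD[OF all y] unfolding span_union_subspaces[OF subM subrepD(1)[OF sW]] by blast
    then show ?thesis by (intro exI[of _ c]) simp
  qed
  have unique: "w = w'" if "w \<in> W" "y - w \<in> M" "w' \<in> W" "y - w' \<in> M" for w w' y
  proof -
    have "w - w' = (y - w') - (y - w)" by simp
    then have "w - w' \<in> M \<inter> W"
      using complex_vector.subspace_diff[OF subM that(4,2)]
        complex_vector.subspace_diff[OF subrepD(1)[OF sW] that(1,3)] by simp
    then show ?thesis using MW by simp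
  qed
  define p where "p y = (THE w. w \<in> W \<and> y - w \<in> M)" for y
  have p_eq: "p y = w" if "w \<in> W" "y - w \<in> M" for y w
    unfolding p_def using that unique by (intro the_equality) blast+
  have p: "p y \<in> W" "y - p y \<in> M" if "y \<in> rspace \<sigma>" for y
    using ex[OF that] p_eq by blast+
  have "linear_between (rspace \<sigma>) W p"
  proof (rule linear_betweenI)
    fix y z assume "y \<in> rspace \<sigma>" "z \<in> rspace \<sigma>"
    note yz = p[OF this(1)] p[OF this(2)]
    show "p (y + z) = p y + p z"
    proof (rule p_eq)
      show "p y + p z \<in> W"
        using complex_vector.subspace_add[OF subrepD(1)[OF sW] yz(1,3)] .
      show "y + z - (p y + p z) \<in> M"
        using complex_vector.subspace_add[OF subM yz(2,4)] by (simp add: algebra_simps)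
    qed
  next
    fix c y assume "y \<in> rspace \<sigma>"
    note y = p[OF this]
    show "p (c *\<^sub>C y) = c *\<^sub>C p y"
    proof (rule p_eq)
      show "c *\<^sub>C p y \<in> W"
        using complex_vector.subspace_scale[OF subrepD(1)[OF sW] y(1)] .
      show "c *\<^sub>C y - c *\<^sub>C p y \<in> M"
        using complex_vector.subspace_scale[OF subM y(2)]
        by (simp add: complex_vector.scale_right_diff_distrib)
    qed
  qed (use p in auto)
  moreover have "p (act \<sigma> h y) = act \<sigma> h (p y)" if "h \<in> H" "y \<in> rspace \<sigma>" for h y
  proof (rule p_eq)
    have "p y \<in> rspace \<sigma>" using p(1)[OF that(2)] subrepD(2)[OF sW] by blast
    then have "act \<sigma> h y - act \<sigma> h (p y) = act \<sigma> h (y - p y)"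
      using linear_between_diff[OF linear_actionD(2)[OF assms(1) that(1)] linear_actionD(1)[OF assms(1)] that(2)]
      by simp
    then show "act \<sigma> h y - act \<sigma> h (p y) \<in> M"
      using subrepD(3)[OF sM(1) that(1) p(2)[OF that(2)]] by simp
    show "act \<sigma> h (p y) \<in> W"
      using subrepD(3)[OF sW that(1) p(1)[OF that(2)]] .
  qed
  ultimately have "equivariant H \<sigma> (\<sigma>\<lparr>rspace := W\<rparr>) p"
    by (simp add: equivariant_def)
  moreover have "p a = 0" if "a \<in> A" for a
    using that sM(2) subrepD(1)[OF sW] by (intro p_eq) (auto simp: complex_vector.subspace_0)
  moreover have "p x \<noteq> 0"
    using p(2)[OF assms(5)] sM(3) by force
  ultimately show ?thesis using W(1) by blast
qed

text \<open>The projection of \<open>semisimple_separation\<close> that kills \<open>A\<close> does not vanish on \<open>U\<close>; its restriction to \<open>U\<close> is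
  an isomorphism onto its target, both being irreducible.\<close>

lemma irreducible_subset_span:
  assumes "linear_action H \<sigma>" "\<And>W. W \<in> \<W> \<Longrightarrow> irreducible_subrep H \<sigma> W" "subrep H A \<sigma>"
    and "irreducible_subrep H \<sigma> U" "U \<subseteq> cspan (A \<union> \<Union>\<W>)" "\<not> U \<subseteq> A"
  shows "\<exists>W\<in>\<W>. isomorphic_rep H (\<sigma>\<lparr>rspace := U\<rparr>) (\<sigma>\<lparr>rspace := W\<rparr>)"
proof -
  obtain x where x: "x \<in> U" "x \<notin> A" using assms(6) by blast
  let ?S = "cspan (A \<union> \<Union>\<W>)"
  let ?\<sigma> = "\<sigma>\<lparr>rspace := ?S\<rparr>"
  have "?S = cspan (\<Union>(insert A \<W>))" by simp
  then have S: "subrep H ?S \<sigma>"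
    using subrep_span[OF assms(1), of "insert A \<W>"] irreducible_subrepD(1)[OF assms(2)] assms(3) by auto
  have sub: "W \<subseteq> ?S" if "W \<in> \<W>" for W
    using that complex_vector.span_superset[of "A \<union> \<Union>\<W>"] by blast
  have "A \<subseteq> ?S"
    using complex_vector.span_superset[of "A \<union> \<Union>\<W>"] by blast
  then have A: "subrep H A ?\<sigma>" using assms(3) S subrep_rspace_update by blast
  have irr: "irreducible_subrep H ?\<sigma> W" if "W \<in> \<W>" for W
    using assms(2)[OF that] sub[OF that] S
    by (auto simp: irreducible_subrep_def subrep_rspace_update)
  note lin = linear_action_subrep[OF assms(1) S]
  have "\<exists>W\<in>\<W>. \<exists>p. equivariant H ?\<sigma> (?\<sigma>\<lparr>rspace := W\<rparr>) p \<and> (\<forall>a\<in>A. p a = 0) \<and> p x \<noteq> 0"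
    by (rule semisimple_separation[OF lin irr A _ _ x(2)]) (use x(1) assms(5) in auto)
  then obtain W p where W: "W \<in> \<W>" and p: "equivariant H ?\<sigma> (?\<sigma>\<lparr>rspace := W\<rparr>) p" "p x \<noteq> 0"
    by blast
  have p': "equivariant H (\<sigma>\<lparr>rspace := U\<rparr>) (\<sigma>\<lparr>rspace := W\<rparr>) p"
    using equivariant_subspace[OF p(1), of U] assms(5) by simp
  note linU = linear_action_subrep[OF assms(1) irreducible_subrepD(1)[OF assms(4)]]
  note linW = linear_action_subrep[OF assms(1) irreducible_subrepD(1)[OF assms(2)[OF W]]]
  have inj: "inj_on p U"
    using equivariant_inj_on[OF linU _ linW p', of x] assms(4) x(1) p(2) by (simp add: irreducible_subrep_def)
  then have irrW: "irreducible_subrep H (\<sigma>\<lparr>rspace := W\<rparr>) (p ` U)"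
    using irreducible_subrep_image[OF linU _ linW p'] assms(4) by (simp add: irreducible_subrep_def)
  have "subrep H (p ` U) \<sigma>" "p ` U \<subseteq> W" "p ` U \<noteq> {0}"
    using irreducible_subrepD(1,2)[OF irrW]
    unfolding subrep_rspace_update[OF irreducible_subrepD(1)[OF assms(2)[OF W]]] by simp_all
  then have "p ` U = W"
    using irreducible_subrepD(3)[OF assms(2)[OF W]] by blast
  then have "isomorphic_rep H (\<sigma>\<lparr>rspace := U\<rparr>) (\<sigma>\<lparr>rspace := W\<rparr>)"
    using isomorphic_image[OF linU p'] inj by simp
  then show ?thesis using W by blast
qed

lemma irreducible_subrep_nonzero:
  assumes "irreducible_subrep H \<sigma> W"
  shows "\<not> W \<subseteq> {0}"
  using irreducible_subrepD(2)[OF assms]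
    complex_vector.subspace_0[OF subrepD(1)[OF irreducible_subrepD(1)[OF assms]]] by blast

text \<open>The directness of the sum is automatic: if \<open>W\<close> met the span of the other members, it would be contained in that span and
  hence isomorphic to one of them.\<close>

lemma multiplicity_freeI:
  assumes "linear_action H \<sigma>" "\<And>W. W \<in> \<W> \<Longrightarrow> irreducible_subrep H \<sigma> W"
    and "cspan (\<Union>\<W>) = rspace \<sigma>"
    and "\<And>W W'. W \<in> \<W> \<Longrightarrow> W' \<in> \<W> \<Longrightarrow>
      isomorphic_rep H (\<sigma>\<lparr>rspace := W\<rparr>) (\<sigma>\<lparr>rspace := W'\<rparr>) \<Longrightarrow> W = W'"
  shows "multiplicity_free H \<sigma>"
proof -
  have zero: "subrep H {0} \<sigma>"
    using subrep_span[OF assms(1), of "{}"] by simp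
  have "W \<inter> cspan (\<Union>(\<W> - {W})) = {0}" if W: "W \<in> \<W>" for W
  proof (rule ccontr)
    let ?C = "cspan (\<Union>(\<W> - {W}))"
    assume ne: "W \<inter> ?C \<noteq> {0}"
    have "subrep H ?C \<sigma>"
      using irreducible_subrepD(1)[OF assms(2)] by (intro subrep_span[OF assms(1)]) simp
    then have "W \<subseteq> ?C"
      using irreducible_not_subset_Int[OF assms(2)[OF W], of ?C] ne by blast
    moreover have "?C \<subseteq> cspan ({0} \<union> \<Union>(\<W> - {W}))"
      by (rule complex_vector.span_mono) blast
    moreover have "\<not> W \<subseteq> {0}"
      using irreducible_subrep_nonzero[OF assms(2)[OF W]] .
    moreover have "W \<subseteq> cspan ({0} \<union> \<Union>(\<W> - {W}))"
      using calculation(1,2) by (rule subset_trans)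
    ultimately have "\<exists>W'\<in>\<W> - {W}. isomorphic_rep H (\<sigma>\<lparr>rspace := W\<rparr>) (\<sigma>\<lparr>rspace := W'\<rparr>)"
      using irreducible_subset_span[OF assms(1) _ zero assms(2)[OF W], of "\<W> - {W}"] assms(2) by simp
    then show False using assms(4)[OF W] by auto
  qed
  moreover have "subrep H W \<sigma> \<and> irreducible_rep H (\<sigma>\<lparr>rspace := W\<rparr>)" if "W \<in> \<W>" for W
    using assms(2)[OF that] by (simp add: irreducible_subrep_def)
  ultimately show ?thesis
    unfolding multiplicity_free_def using assms(3,4)
    by (intro exI[of _ \<W>] conjI ballI impI notI) simp_all
qed

text \<open>Every irreducible subrepresentation \<open>V\<close> is a member of the decomposition. It is isomorphic to some member \<open>W\<close>;
  if it were not contained in \<open>W\<close>, it would also be isomorphic to a member other than \<open>W\<close>, since it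
  is contained in the sum of \<open>W\<close> and the others.\<close>

lemma multiplicity_freeD:
  assumes "linear_action H \<sigma>" "multiplicity_free H \<sigma>"
    and "irreducible_subrep H \<sigma> U" "irreducible_subrep H \<sigma> U'"
    and "isomorphic_rep H (\<sigma>\<lparr>rspace := U\<rparr>) (\<sigma>\<lparr>rspace := U'\<rparr>)"
  shows "U = U'"
proof -
  obtain \<W> where irr: "\<And>W. W \<in> \<W> \<Longrightarrow> irreducible_subrep H \<sigma> W"
    and span: "cspan (\<Union>\<W>) = rspace \<sigma>"
    and noniso: "\<And>W W'. W \<in> \<W> \<Longrightarrow> W' \<in> \<W> \<Longrightarrow>
      isomorphic_rep H (\<sigma>\<lparr>rspace := W\<rparr>) (\<sigma>\<lparr>rspace := W'\<rparr>) \<Longrightarrow> W = W'"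
  proof -
    obtain \<W> where *: "(\<forall>W\<in>\<W>. subrep H W \<sigma> \<and> irreducible_rep H (\<sigma>\<lparr>rspace := W\<rparr>)) \<and>
      cspan (\<Union>\<W>) = rspace \<sigma> \<and> (\<forall>W\<in>\<W>. W \<inter> cspan (\<Union>(\<W> - {W})) = {0}) \<and>
      (\<forall>W\<in>\<W>. \<forall>W'\<in>\<W>. W \<noteq> W' \<longrightarrow>
        \<not> isomorphic_rep H (\<sigma>\<lparr>rspace := W\<rparr>) (\<sigma>\<lparr>rspace := W'\<rparr>))"
      using assms(2) unfolding multiplicity_free_def by (rule exE)
    show thesis
    proof (rule that[of \<W>])
      show "irreducible_subrep H \<sigma> W" if "W \<in> \<W>" for W
        using bspec[OF conjunct1[OF *] that] unfolding irreducible_subrep_def .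
      show "cspan (\<Union>\<W>) = rspace \<sigma>"
        by (rule conjunct1[OF conjunct2[OF *]])
      show "W = W'" if "W \<in> \<W>" "W' \<in> \<W>"
        "isomorphic_rep H (\<sigma>\<lparr>rspace := W\<rparr>) (\<sigma>\<lparr>rspace := W'\<rparr>)" for W W'
        using bspec[OF bspec[OF conjunct2[OF conjunct2[OF conjunct2[OF *]]] that(1)] that(2)] that(3)
        by blast
    qed
  qed
  have zero: "subrep H {0} \<sigma>"
    using subrep_span[OF assms(1), of "{}"] by simp
  note lin = linear_action_subrep[OF assms(1) irreducible_subrepD(1)]
  have mem: "V \<in> \<W>" if V: "irreducible_subrep H \<sigma> V" for V
  proof -
    note sV = irreducible_subrepD(1)[OF V]
    have "rspace \<sigma> \<subseteq> cspan ({0} \<union> \<Union>\<W>)"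
      unfolding span[symmetric] by (rule complex_vector.span_mono) blast
    moreover have "\<not> V \<subseteq> {0}"
      using irreducible_subrep_nonzero[OF V] .
    moreover have "V \<subseteq> cspan ({0} \<union> \<Union>\<W>)"
      using subrepD(2)[OF sV] calculation(1) by (rule subset_trans)
    ultimately have "\<exists>W\<in>\<W>. isomorphic_rep H (\<sigma>\<lparr>rspace := V\<rparr>) (\<sigma>\<lparr>rspace := W\<rparr>)"
      using irreducible_subset_span[OF assms(1) irr zero V, of \<W>] by simp
    then obtain W where W: "W \<in> \<W>" "isomorphic_rep H (\<sigma>\<lparr>rspace := V\<rparr>) (\<sigma>\<lparr>rspace := W\<rparr>)"
      by auto
    have "V \<subseteq> W"
    proof (rule ccontr)
      assume *: "\<not> V \<subseteq> W"
      have "W \<union> \<Union>(\<W> - {W}) = \<Union>\<W>" using W(1) by blast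
      then have "V \<subseteq> cspan (W \<union> \<Union>(\<W> - {W}))"
        using subrepD(2)[OF sV] span by simp
      then have "\<exists>W'\<in>\<W> - {W}. isomorphic_rep H (\<sigma>\<lparr>rspace := V\<rparr>) (\<sigma>\<lparr>rspace := W'\<rparr>)"
        using irreducible_subset_span[OF assms(1) _ irreducible_subrepD(1)[OF irr[OF W(1)]] V _ *,
            of "\<W> - {W}"] irr by simp
      then obtain W' where W': "W' \<in> \<W> - {W}" "isomorphic_rep H (\<sigma>\<lparr>rspace := V\<rparr>) (\<sigma>\<lparr>rspace := W'\<rparr>)"
        by auto
      have "isomorphic_rep H (\<sigma>\<lparr>rspace := W\<rparr>) (\<sigma>\<lparr>rspace := V\<rparr>)"
        by (rule isomorphic_rep_sym[OF lin[OF V] lin[OF irr[OF W(1)]] W(2)])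
      then have "isomorphic_rep H (\<sigma>\<lparr>rspace := W\<rparr>) (\<sigma>\<lparr>rspace := W'\<rparr>)"
        using W'(2) by (rule isomorphic_rep_trans[OF lin[OF irr[OF W(1)]] lin[OF V]])
      then have "W = W'" using W(1) W'(1) by (intro noniso) simp_all
      then show False using W'(1) by simp
    qed
    then have "V = W"
      using irreducible_subrepD(3)[OF irr[OF W(1)] sV] irreducible_subrepD(2)[OF V] by blast
    then show ?thesis using W(1) by simp
  qed
  show ?thesis
    using noniso[OF mem[OF assms(3)] mem[OF assms(4)] assms(5)] .
qed

subsection \<open>Translates of a subrepresentation of a normal subgroup\<close>

locale clifford =
  fixes G :: "('g, 'b) monoid_scheme" and P H :: "'g set" and \<sigma> :: "('g, 'v::complex_vector) rep"
  assumes group: "group G" and subgroup: "subgroup P G" and sub: "H \<subseteq> P"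
    and normalised: "p \<in> P \<Longrightarrow> h \<in> H \<Longrightarrow> inv\<^bsub>G\<^esub> p \<otimes>\<^bsub>G\<^esub> h \<otimes>\<^bsub>G\<^esub> p \<in> H"
    and rep: "representation G P \<sigma>"
begin

lemma act_one: "x \<in> rspace \<sigma> \<Longrightarrow> act \<sigma> \<one>\<^bsub>G\<^esub> x = x"
  using rep by (simp add: representation_def)

lemma act_mult:
  "p \<in> P \<Longrightarrow> q \<in> P \<Longrightarrow> x \<in> rspace \<sigma> \<Longrightarrow> act \<sigma> (p \<otimes>\<^bsub>G\<^esub> q) x = act \<sigma> p (act \<sigma> q x)"
  using rep by (simp add: representation_def)

lemma act_linear: "p \<in> P \<Longrightarrow> linear_between (rspace \<sigma>) (rspace \<sigma>) (act \<sigma> p)"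
  using rep by (simp add: representation_def)

lemma linear_action: "linear_action H \<sigma>"
  using rep sub by (auto simp: representation_def linear_action_def)

lemma inv_in: "p \<in> P \<Longrightarrow> inv\<^bsub>G\<^esub> p \<in> P"
  using subgroup by (rule subgroup.m_inv_closed)

lemma act_inv:
  assumes "p \<in> P" "x \<in> rspace \<sigma>"
  shows "act \<sigma> (inv\<^bsub>G\<^esub> p) (act \<sigma> p x) = x" "act \<sigma> p (act \<sigma> (inv\<^bsub>G\<^esub> p) x) = x"
proof -
  interpret group G by (rule group)
  have "p \<in> carrier G" using subgroup.subset[OF subgroup] assms(1) by blast
  then show "act \<sigma> (inv\<^bsub>G\<^esub> p) (act \<sigma> p x) = x" "act \<sigma> p (act \<sigma> (inv\<^bsub>G\<^esub> p) x) = x"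
    using act_mult[OF inv_in[OF assms(1)] assms] act_mult[OF assms(1) inv_in[OF assms(1)] assms(2)]
      act_one[OF assms(2)] by simp_all
qed

lemma act_exchange:
  assumes "p \<in> P" "h \<in> H" "x \<in> rspace \<sigma>"
  shows "act \<sigma> h (act \<sigma> p x) = act \<sigma> p (act \<sigma> (inv\<^bsub>G\<^esub> p \<otimes>\<^bsub>G\<^esub> h \<otimes>\<^bsub>G\<^esub> p) x)"
proof -
  interpret group G by (rule group)
  have P: "h \<in> P" "inv\<^bsub>G\<^esub> p \<otimes>\<^bsub>G\<^esub> h \<otimes>\<^bsub>G\<^esub> p \<in> P"
    using sub normalised[OF assms(1,2)] assms by auto
  then have "p \<in> carrier G" "h \<in> carrier G"
    using subgroup.subset[OF subgroup] assms(1) by auto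
  then have "h \<otimes>\<^bsub>G\<^esub> p = p \<otimes>\<^bsub>G\<^esub> (inv\<^bsub>G\<^esub> p \<otimes>\<^bsub>G\<^esub> h \<otimes>\<^bsub>G\<^esub> p)"
    by (simp add: inv_solve_left m_assoc[symmetric])
  then show ?thesis
    using act_mult[OF P(1) assms(1,3)] act_mult[OF assms(1) P(2) assms(3)] by simp
qed

lemma translate_subrep:
  assumes "p \<in> P" "subrep H W \<sigma>"
  shows "subrep H (act \<sigma> p ` W) \<sigma>"
proof -
  note lin = act_linear[OF assms(1)] and W = subrepD[OF assms(2)]
  have "csubspace (act \<sigma> p ` W)"
    using linear_between_mono[OF lin W(2), of UNIV] W(1) by (intro subspace_image_linear_between) auto
  moreover have "act \<sigma> p ` W \<subseteq> rspace \<sigma>"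
    using linear_betweenD(1)[OF lin] W(2) by blast
  moreover have "act \<sigma> h (act \<sigma> p x) \<in> act \<sigma> p ` W" if "h \<in> H" "x \<in> W" for h x
    using act_exchange[OF assms(1) that(1) subsetD[OF W(2) that(2)]] W(3)[OF normalised[OF assms(1) that(1)] that(2)]
    by (metis image_eqI)
  ultimately show ?thesis by (auto simp: subrep_def)
qed

lemma translate_inv_image:
  assumes "p \<in> P" "W \<subseteq> rspace \<sigma>"
  shows "act \<sigma> (inv\<^bsub>G\<^esub> p) ` act \<sigma> p ` W = W" "act \<sigma> p ` act \<sigma> (inv\<^bsub>G\<^esub> p) ` W = W"
proof -
  have "(\<lambda>x. act \<sigma> (inv\<^bsub>G\<^esub> p) (act \<sigma> p x)) ` W = (\<lambda>x. x) ` W"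
    "(\<lambda>x. act \<sigma> p (act \<sigma> (inv\<^bsub>G\<^esub> p) x)) ` W = (\<lambda>x. x) ` W"
    using act_inv[OF assms(1)] assms(2) by (intro image_cong; auto)+
  then show "act \<sigma> (inv\<^bsub>G\<^esub> p) ` act \<sigma> p ` W = W" "act \<sigma> p ` act \<sigma> (inv\<^bsub>G\<^esub> p) ` W = W"
    by (simp_all add: image_image)
qed

lemma translate_zero: "p \<in> P \<Longrightarrow> act \<sigma> p ` {0} = {0}"
  using linear_between_zero[OF act_linear linear_actionD(1)[OF linear_action]] by simp

lemma translate_irreducible:
  assumes "p \<in> P" "irreducible_subrep H \<sigma> W"
  shows "irreducible_subrep H \<sigma> (act \<sigma> p ` W)"
proof (rule irreducible_subrepI)
  note W = irreducible_subrepD(1)[OF assms(2)]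
  show "subrep H (act \<sigma> p ` W) \<sigma>" using assms(1) W by (rule translate_subrep)
  show "act \<sigma> p ` W \<noteq> {0}"
    using irreducible_subrepD(2)[OF assms(2)] translate_inv_image(1)[OF assms(1) subrepD(2)[OF W]]
      translate_zero[OF inv_in[OF assms(1)]] by metis
  fix U assume U: "subrep H U \<sigma>" "U \<subseteq> act \<sigma> p ` W"
  let ?U = "act \<sigma> (inv\<^bsub>G\<^esub> p) ` U"
  have "?U \<subseteq> W"
    using image_mono[OF U(2), of "act \<sigma> (inv\<^bsub>G\<^esub> p)"] translate_inv_image(1)[OF assms(1) subrepD(2)[OF W]]
    by simp
  then have "?U = {0} \<or> ?U = W"
    using irreducible_subrepD(3)[OF assms(2) translate_subrep[OF inv_in[OF assms(1)] U(1)]] by blast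
  then show "U = {0} \<or> U = act \<sigma> p ` W"
    using translate_inv_image(2)[OF assms(1) subrepD(2)[OF U(1)]] translate_zero[OF assms(1)] by metis
qed

text \<open>The translates of \<open>W\<close> are irreducible and span. If the translates by \<open>p\<close> and \<open>q\<close> are isomorphic,
  then conjugating the isomorphism by \<open>p\<close> gives an equivariant map from \<open>W\<close> onto its translate
  by \<open>p\<^sup>-\<^sup>1 q\<close>, so that the hypothesis makes the two translates equal.\<close>

lemma multiplicity_free_translates:
  assumes "irreducible_subrep H \<sigma> W" "cspan (\<Union>p\<in>P. act \<sigma> p ` W) = rspace \<sigma>"
    and "\<And>p \<phi>. p \<in> P \<Longrightarrow> equivariant H (\<sigma>\<lparr>rspace := W\<rparr>) \<sigma> \<phi> \<Longrightarrow> \<phi> ` W = act \<sigma> p ` W \<Longrightarrow> act \<sigma> p ` W = W"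
  shows "multiplicity_free H \<sigma>"
proof (rule multiplicity_freeI[OF linear_action])
  let ?\<W> = "(\<lambda>p. act \<sigma> p ` W) ` P"
  note W = subrepD[OF irreducible_subrepD(1)[OF assms(1)]]
  show "irreducible_subrep H \<sigma> V" if "V \<in> ?\<W>" for V
    using that translate_irreducible assms(1) by auto
  show "cspan (\<Union>?\<W>) = rspace \<sigma>" using assms(2) by simp
  fix V V' assume "V \<in> ?\<W>" "V' \<in> ?\<W>"
    and iso: "isomorphic_rep H (\<sigma>\<lparr>rspace := V\<rparr>) (\<sigma>\<lparr>rspace := V'\<rparr>)"
  then obtain p q where p: "p \<in> P" "V = act \<sigma> p ` W" and q: "q \<in> P" "V' = act \<sigma> q ` W" by blast
  have V: "subrep H V \<sigma>" "subrep H V' \<sigma>"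
    using p q irreducible_subrepD(1)[OF assms(1)] translate_subrep by simp_all
  obtain f where f: "equivariant H (\<sigma>\<lparr>rspace := V\<rparr>) (\<sigma>\<lparr>rspace := V'\<rparr>) f" "bij_betw f V V'"
    using iso unfolding isomorphic_rep_iff[OF linear_action_subrep[OF linear_action V(1)]] by auto
  note flin = equivariantD(1)[OF f(1), simplified]
  note ip = inv_in[OF p(1)]
  let ?\<phi> = "\<lambda>w. act \<sigma> (inv\<^bsub>G\<^esub> p) (f (act \<sigma> p w))"
  have pw: "act \<sigma> p w \<in> V" if "w \<in> W" for w using that p(2) by simp
  have fpw: "f (act \<sigma> p w) \<in> rspace \<sigma>" if "w \<in> W" for w
    using linear_betweenD(1)[OF flin pw[OF that]] subrepD(2)[OF V(2)] by blast
  have "linear_between W (rspace \<sigma>) ?\<phi>"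
  proof (rule linear_betweenI)
    show "?\<phi> x \<in> rspace \<sigma>" if "x \<in> W" for x
      using linear_betweenD(1)[OF act_linear[OF ip] fpw[OF that]] .
    show "?\<phi> (x + y) = ?\<phi> x + ?\<phi> y" if "x \<in> W" "y \<in> W" for x y
      using that W(2) by (simp add: linear_betweenD(2)[OF act_linear] linear_betweenD(2)[OF flin] p(1) ip pw fpw subsetD)
    show "?\<phi> (c *\<^sub>C x) = c *\<^sub>C ?\<phi> x" if "x \<in> W" for c x
      using that W(2) by (simp add: linear_betweenD(3)[OF act_linear] linear_betweenD(3)[OF flin] p(1) ip pw fpw subsetD)
  qed
  moreover have "?\<phi> (act \<sigma> h w) = act \<sigma> h (?\<phi> w)" if h: "h \<in> H" and w: "w \<in> W" for h w
  proof -
    interpret group G by (rule group)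
    have car: "p \<in> carrier G" "h \<in> carrier G"
      using subgroup.subset[OF subgroup] sub p(1) h by auto
    let ?k = "p \<otimes>\<^bsub>G\<^esub> h \<otimes>\<^bsub>G\<^esub> inv\<^bsub>G\<^esub> p"
    have k: "?k \<in> H" using normalised[OF ip h] car by simp
    have eq: "inv\<^bsub>G\<^esub> p \<otimes>\<^bsub>G\<^esub> ?k \<otimes>\<^bsub>G\<^esub> p = h" "inv\<^bsub>G\<^esub> (inv\<^bsub>G\<^esub> p) \<otimes>\<^bsub>G\<^esub> h \<otimes>\<^bsub>G\<^esub> inv\<^bsub>G\<^esub> p = ?k"
      using car by (simp_all add: m_assoc inv_solve_left')
    have "act \<sigma> p (act \<sigma> h w) = act \<sigma> ?k (act \<sigma> p w)"
      using act_exchange[OF p(1) k subsetD[OF W(2) w]] unfolding eq by simp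
    then have "f (act \<sigma> p (act \<sigma> h w)) = act \<sigma> ?k (f (act \<sigma> p w))"
      using equivariantD(2)[OF f(1) k, simplified, OF pw[OF w]] by simp
    then show ?thesis
      using act_exchange[OF ip h fpw[OF w]] unfolding eq by simp
  qed
  ultimately have "equivariant H (\<sigma>\<lparr>rspace := W\<rparr>) \<sigma> ?\<phi>"
    by (simp add: equivariant_def)
  moreover have img: "?\<phi> ` W = act \<sigma> (inv\<^bsub>G\<^esub> p \<otimes>\<^bsub>G\<^esub> q) ` W"
  proof -
    have "?\<phi> ` W = act \<sigma> (inv\<^bsub>G\<^esub> p) ` f ` V" unfolding p(2) by (simp add: image_image)
    also have "\<dots> = act \<sigma> (inv\<^bsub>G\<^esub> p) ` act \<sigma> q ` W" using f(2) q(2) by (simp add: bij_betw_def)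
    also have "\<dots> = act \<sigma> (inv\<^bsub>G\<^esub> p \<otimes>\<^bsub>G\<^esub> q) ` W"
      unfolding image_image using act_mult[OF ip q(1)] W(2) by (intro image_cong) auto
    finally show ?thesis .
  qed
  moreover have "inv\<^bsub>G\<^esub> p \<otimes>\<^bsub>G\<^esub> q \<in> P" using ip q(1) subgroup by (simp add: subgroup.m_closed)
  ultimately have "act \<sigma> (inv\<^bsub>G\<^esub> p \<otimes>\<^bsub>G\<^esub> q) ` W = W"
    using assms(3) by simp
  moreover have "act \<sigma> (inv\<^bsub>G\<^esub> p \<otimes>\<^bsub>G\<^esub> q) ` W = act \<sigma> (inv\<^bsub>G\<^esub> p) ` V'"
    unfolding q(2) image_image using act_mult[OF ip q(1)] W(2) by (intro image_cong) auto
  ultimately show "V = V'"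
    using translate_inv_image(2)[OF p(1) subrepD(2)[OF V(2)]] p(2) by simp
qed

text \<open>In a multiplicity free representation isomorphic irreducible subrepresentations are equal, so that the image of a nonzero
  \<open>\<phi>\<close>, which is isomorphic to \<open>W\<close>, is \<open>W\<close> itself. Conversely the condition applies to maps from \<open>W\<close> onto one of its translates.\<close>

theorem multiplicity_free_iff:
  assumes "irreducible_subrep H \<sigma> W" "cspan (\<Union>p\<in>P. act \<sigma> p ` W) = rspace \<sigma>"
  shows "multiplicity_free H \<sigma> \<longleftrightarrow> (\<forall>\<phi>. equivariant H (\<sigma>\<lparr>rspace := W\<rparr>) \<sigma> \<phi> \<longrightarrow> \<phi> ` W \<subseteq> W)"
proof (intro iffI allI impI)
  note W = irreducible_subrepD[OF assms(1)]
  note lin = linear_action_subrep[OF linear_action W(1)]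
  have irr: "irreducible_rep H (\<sigma>\<lparr>rspace := W\<rparr>)"
    using assms(1) by (simp add: irreducible_subrep_def)
  fix \<phi> assume mf: "multiplicity_free H \<sigma>" and \<phi>: "equivariant H (\<sigma>\<lparr>rspace := W\<rparr>) \<sigma> \<phi>"
  show "\<phi> ` W \<subseteq> W"
  proof (cases "\<exists>x\<in>W. \<phi> x \<noteq> 0")
    case True
    then have inj: "inj_on \<phi> W"
      using equivariant_inj_on[OF lin irr linear_action \<phi>] by auto
    have "irreducible_subrep H \<sigma> (\<phi> ` W)"
      using irreducible_subrep_image[OF lin irr linear_action \<phi>] inj by simp
    moreover have "isomorphic_rep H (\<sigma>\<lparr>rspace := W\<rparr>) (\<sigma>\<lparr>rspace := \<phi> ` W\<rparr>)"
      using isomorphic_image[OF lin \<phi>] inj by simp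
    ultimately have "W = \<phi> ` W"
      using multiplicity_freeD[OF linear_action mf assms(1)] by blast
    then show ?thesis by blast
  next
    case False
    then show ?thesis using complex_vector.subspace_0[OF subrepD(1)[OF W(1)]] by auto
  qed
next
  assume *: "\<forall>\<phi>. equivariant H (\<sigma>\<lparr>rspace := W\<rparr>) \<sigma> \<phi> \<longrightarrow> \<phi> ` W \<subseteq> W"
  show "multiplicity_free H \<sigma>"
  proof (rule multiplicity_free_translates[OF assms])
    fix p \<phi> assume p: "p \<in> P" and "equivariant H (\<sigma>\<lparr>rspace := W\<rparr>) \<sigma> \<phi>" "\<phi> ` W = act \<sigma> p ` W"
    then have "act \<sigma> p ` W \<subseteq> W" using * by metis
    then show "act \<sigma> p ` W = W"
      using irreducible_subrepD(1,2)[OF translate_irreducible[OF p assms(1)]] irreducible_subrepD(3)[OF assms(1)]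
      by blast
  qed
qed

end

section \<open>Schur's lemma in countable dimension\<close>

text \<open>An independent set meets the span of each of the countably many finite subsets of \<open>C\<close> in a finite set.\<close>

lemma countable_independent_in_span:
  assumes "countable C" "S \<subseteq> cspan C" "complex_vector.independent S"
  shows "countable S"
proof -
  let ?\<F> = "{F. F \<subseteq> C \<and> finite F}"
  have cover: "S \<subseteq> (\<Union>F\<in>?\<F>. S \<inter> cspan F)"
  proof
    fix x assume x: "x \<in> S"
    then have "x \<in> cspan C" using assms(2) by blast
    then obtain t r where t: "finite t" "t \<subseteq> C" "x = (\<Sum>a\<in>t. r a *\<^sub>C a)"
      unfolding complex_vector.span_explicit by blast
    then have "x \<in> cspan t"
      by (simp add: complex_vector.span_sum complex_vector.span_scale complex_vector.span_base)
    then show "x \<in> (\<Union>F\<in>?\<F>. S \<inter> cspan F)" using x t by blast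
  qed
  have fin: "finite (S \<inter> cspan F)" if "F \<in> ?\<F>" for F
    using complex_vector.independent_span_bound[of F "S \<inter> cspan F"]
      complex_vector.independent_mono[OF assms(3), of "S \<inter> cspan F"] that by auto
  have "countable ?\<F>"
  proof -
    have "?\<F> = {F. finite F \<and> F \<subseteq> C}" by blast
    then show ?thesis using countable_Collect_finite_subset[OF assms(1)] by simp
  qed
  then have "countable (\<Union>F\<in>?\<F>. S \<inter> cspan F)"
    by (rule countable_UN) (rule countable_finite[OF fin])
  with cover show ?thesis by (rule countable_subset)
qed

text \<open>The value of the polynomial \<open>p\<close> in the operator \<open>T\<close> on the vector \<open>x\<close>, by Horner's scheme.\<close>

definition poly_apply :: "('v \<Rightarrow> 'v) \<Rightarrow> 'v \<Rightarrow> complex poly \<Rightarrow> 'v::complex_vector"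
  where "poly_apply T x p = fold_coeffs (\<lambda>a y. a *\<^sub>C x + T y) p 0"

lemma poly_apply_0: "poly_apply T x 0 = 0"
  by (simp add: poly_apply_def)

lemma poly_apply_pCons:
  assumes "T 0 = 0"
  shows "poly_apply T x (pCons a p) = a *\<^sub>C x + T (poly_apply T x p)"
  using assms by (cases "p = 0"; cases "a = 0") (simp_all add: poly_apply_def)

context
  fixes V :: "'v::complex_vector set" and T :: "'v \<Rightarrow> 'v" and x :: 'v
  assumes T: "linear_between V V T" and V: "csubspace V" and x: "x \<in> V"
begin

lemma T_zero: "T 0 = 0" using linear_between_zero[OF T V] .

lemma poly_apply_closed: "poly_apply T x p \<in> V"
  by (induction p) (simp_all add: poly_apply_0 poly_apply_pCons T_zero linear_betweenD(1)[OF T] x V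
      complex_vector.subspace_0 complex_vector.subspace_add complex_vector.subspace_scale)

lemma poly_apply_add: "poly_apply T x (p + q) = poly_apply T x p + poly_apply T x q"
proof (induction p arbitrary: q)
  case (pCons a p)
  show ?case
    by (cases q) (simp add: poly_apply_pCons T_zero pCons.IH linear_betweenD(2)[OF T] poly_apply_closed
        scaleC_add_left)
qed (simp add: poly_apply_0)

lemma poly_apply_smult: "poly_apply T x (Polynomial.smult c p) = c *\<^sub>C poly_apply T x p"
  by (induction p) (simp_all add: poly_apply_0 poly_apply_pCons T_zero linear_betweenD(3)[OF T]
      poly_apply_closed scaleC_add_right scaleC_scaleC)

lemma poly_apply_linear_factor:
  "poly_apply T x ([:- c, 1:] * p) = T (poly_apply T x p) - c *\<^sub>C poly_apply T x p"
proof -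
  have eq: "[:- c, 1:] * p = pCons 0 p + Polynomial.smult (- c) p" by simp
  show ?thesis
    unfolding eq poly_apply_add poly_apply_smult
    by (simp add: poly_apply_pCons T_zero)
qed

text \<open>The hypothesis says that every \<open>T - c\<close> is injective. As the complex polynomial \<open>p\<close> is a product of linear factors,
  it acts injectively as well.\<close>

lemma poly_apply_eq_0:
  assumes "x \<noteq> 0" "\<And>c y. y \<in> V \<Longrightarrow> T y - c *\<^sub>C y = 0 \<Longrightarrow> y = 0"
  shows "poly_apply T x p = 0 \<Longrightarrow> p = 0"
proof (induction "Polynomial.degree p" arbitrary: p rule: less_induct)
  case less
  show ?case
  proof (rule ccontr)
    assume "p \<noteq> 0"
    show False
    proof (cases "Polynomial.degree p = 0")
      case True
      then obtain a where a: "p = [:a:]" using degree_eq_zeroE by blast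
      then show False
        using less.prems \<open>p \<noteq> 0\<close> assms(1) by (simp add: poly_apply_pCons poly_apply_0 T_zero)
    next
      case False
      then obtain c where "poly p c = 0"
        using fundamental_theorem_of_algebra[of p] by (auto simp: constant_degree)
      then obtain q where q: "p = [:- c, 1:] * q" using poly_eq_0_iff_dvd by blast
      then have "q \<noteq> 0" using \<open>p \<noteq> 0\<close> by auto
      then have "Polynomial.degree q < Polynomial.degree p" unfolding q by (subst degree_mult_eq) auto
      moreover have "poly_apply T x q = 0"
        using less.prems assms(2)[OF poly_apply_closed] unfolding q poly_apply_linear_factor by blast
      ultimately show False using less.hyps \<open>q \<noteq> 0\<close> by blast
    qed
  qed
qed

text \<open>Partial fractions: a linear relation between the resolvents \<open>R c = (T - c)\<^sup>-\<^sup>1 x\<close> becomes, after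
  multiplication with \<open>T - d\<close>, a relation with one resolvent less.\<close>

lemma resolvents_independent:
  assumes "x \<noteq> 0" "\<And>c y. y \<in> V \<Longrightarrow> T y - c *\<^sub>C y = 0 \<Longrightarrow> y = 0"
    and R: "\<And>c. R c \<in> V" "\<And>c. T (R c) - c *\<^sub>C R c = x"
    and "finite F"
  shows "poly_apply T x p + (\<Sum>c\<in>F. a c *\<^sub>C R c) = 0 \<Longrightarrow> p = 0 \<and> (\<forall>c\<in>F. a c = 0)"
  using \<open>finite F\<close>
proof (induction F arbitrary: p a rule: finite_induct)
  case empty
  have "p = 0"
  proof (rule poly_apply_eq_0[OF assms(1)])
    show "y = 0" if "y \<in> V" "T y - c *\<^sub>C y = 0" for c y
      using that by (rule assms(2))
    show "poly_apply T x p = 0" using empty by simp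
  qed
  then show ?case by simp
next
  case (insert d F)
  let ?s = "\<Sum>c\<in>insert d F. a c"
  let ?y = "poly_apply T x p + (\<Sum>c\<in>insert d F. a c *\<^sub>C R c)"
  have shift: "T (R c) - d *\<^sub>C R c = x + (c - d) *\<^sub>C R c" for c
    using R(2)[of c] by (simp add: complex_vector.scale_left_diff_distrib algebra_simps)
  have mem: "a c *\<^sub>C R c \<in> V" "(\<Sum>c\<in>insert d F. a c *\<^sub>C R c) \<in> V" for c
    using R(1) V by (auto intro!: complex_vector.subspace_sum complex_vector.subspace_scale)
  have "T ?y - d *\<^sub>C ?y = poly_apply T x ([:- d, 1:] * p) + (\<Sum>c\<in>insert d F. a c *\<^sub>C (T (R c) - d *\<^sub>C R c))"
    using linear_between_sum[OF T V, of "insert d F" "\<lambda>c. a c *\<^sub>C R c"] mem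
    unfolding poly_apply_linear_factor
    by (simp add: linear_betweenD(2)[OF T poly_apply_closed mem(2)] linear_betweenD(3)[OF T R(1)]
        scaleC_add_right complex_vector.scale_sum_right complex_vector.scale_right_diff_distrib
        sum_subtractf scaleC_scaleC mult.commute del: sum.insert)
  also have "(\<Sum>c\<in>insert d F. a c *\<^sub>C (T (R c) - d *\<^sub>C R c)) =
      ?s *\<^sub>C x + (\<Sum>c\<in>insert d F. (a c * (c - d)) *\<^sub>C R c)"
    unfolding shift
    by (simp add: scaleC_add_right scaleC_scaleC sum.distrib complex_vector.scale_sum_left del: sum.insert)
  also have "(\<Sum>c\<in>insert d F. (a c * (c - d)) *\<^sub>C R c) = (\<Sum>c\<in>F. (a c * (c - d)) *\<^sub>C R c)"
    using insert.hyps by simp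
  finally have "T ?y - d *\<^sub>C ?y =
      poly_apply T x ([:- d, 1:] * p + [:?s:]) + (\<Sum>c\<in>F. (a c * (c - d)) *\<^sub>C R c)"
    by (simp add: poly_apply_add poly_apply_pCons poly_apply_0 T_zero)
  moreover have "T ?y - d *\<^sub>C ?y = 0"
    unfolding insert.prems using T_zero by simp
  ultimately have "poly_apply T x ([:- d, 1:] * p + [:?s:]) + (\<Sum>c\<in>F. (a c * (c - d)) *\<^sub>C R c) = 0"
    by simp
  note zero = conjunct1[OF insert.IH[OF this]] conjunct2[OF insert.IH[OF this]]
  have "p = 0"
  proof (rule ccontr)
    assume "p \<noteq> 0"
    then have "Polynomial.degree ([:- d, 1:] * p) = 1 + Polynomial.degree p" by (subst degree_mult_eq) auto
    then have "Polynomial.degree ([:- d, 1:] * p + [:?s:]) = 1 + Polynomial.degree p"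
      by (subst degree_add_eq_left) auto
    then show False using zero(1) by simp
  qed
  moreover have F0: "a c = 0" if "c \<in> F" for c
    using zero(2) that insert.hyps(2) by auto
  moreover have "a d = 0"
    using zero(1) \<open>p = 0\<close> F0 insert.hyps by simp
  ultimately show ?case by blast
qed

end

lemma uncountable_complex: "uncountable (UNIV :: complex set)"
proof
  assume "countable (UNIV :: complex set)"
  then have "countable (range complex_of_real)" by (rule countable_subset[rotated]) simp
  then have "countable (UNIV :: real set)"
    by (rule countable_image_inj_on) (simp add: inj_of_real)
  then show False using uncountable_UNIV_real by simp
qed

text \<open>An endomorphism \<open>T\<close> that is not scalar would make \<open>T - c\<close> invertible for every complex number \<open>c\<close>,
  and the resolvents of a nonzero vector would be an uncountable independent set.\<close>

theorem schur_countable_dimension: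
  assumes lin: "linear_action H \<sigma>" and irr: "irreducible_rep H \<sigma>"
    and countable: "\<And>S. S \<subseteq> rspace \<sigma> \<Longrightarrow> complex_vector.independent S \<Longrightarrow> countable S"
    and T: "equivariant H \<sigma> \<sigma> T"
  shows "\<exists>c. \<forall>x\<in>rspace \<sigma>. T x = c *\<^sub>C x"
proof (rule ccontr)
  assume *: "\<not> ?thesis"
  let ?V = "rspace \<sigma>"
  note V = linear_actionD(1)[OF lin] and Tlin = equivariantD(1)[OF T]
  obtain x where x: "x \<in> ?V" "x \<noteq> 0"
    using irr complex_vector.subspace_0[OF V] unfolding irreducible_rep_def by blast
  have eq: "equivariant H \<sigma> \<sigma> (\<lambda>y. T y - c *\<^sub>C y)" for c
  proof -
    have "linear_between ?V ?V (\<lambda>y. T y - c *\<^sub>C y)"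
      using V by (intro linear_betweenI)
        (simp_all add: linear_betweenD[OF Tlin] complex_vector.subspace_diff complex_vector.subspace_scale
          scaleC_add_right scaleC_scaleC mult.commute complex_vector.scale_right_diff_distrib)
    moreover have "T (act \<sigma> h y) - c *\<^sub>C act \<sigma> h y = act \<sigma> h (T y - c *\<^sub>C y)" if "h \<in> H" "y \<in> ?V" for h y
      using that V by (simp add: equivariantD(2)[OF T] linear_between_diff[OF linear_actionD(2)[OF lin]]
          linear_betweenD(3)[OF linear_actionD(2)[OF lin]] linear_betweenD(1)[OF Tlin] complex_vector.subspace_scale)
    ultimately show ?thesis by (simp add: equivariant_def)
  qed
  have inj: "inj_on (\<lambda>y. T y - c *\<^sub>C y) ?V" for c
  proof -
    obtain y where "y \<in> ?V" "T y \<noteq> c *\<^sub>C y" using * by blast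
    then show ?thesis using equivariant_inj_on[OF lin irr lin eq, of y] by simp
  qed
  then have kernel: "y = 0" if "y \<in> ?V" "T y - c *\<^sub>C y = 0" for c y
    using that linear_between_inj_on_iff[OF equivariantD(1)[OF eq] V] by blast
  have img: "(\<lambda>y. T y - c *\<^sub>C y) ` ?V = ?V" for c
  proof -
    have "irreducible_subrep H \<sigma> ((\<lambda>y. T y - c *\<^sub>C y) ` ?V)"
      using irreducible_subrep_image[OF lin irr lin eq inj] .
    then have "subrep H ((\<lambda>y. T y - c *\<^sub>C y) ` ?V) \<sigma>" "(\<lambda>y. T y - c *\<^sub>C y) ` ?V \<noteq> {0}"
      by (rule irreducible_subrepD)+
    then show ?thesis using conjunct2[OF irr[unfolded irreducible_rep_def], rule_format] by auto
  qed
  have "\<forall>c. \<exists>y. y \<in> ?V \<and> T y - c *\<^sub>C y = x"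
  proof
    fix c
    have "x \<in> (\<lambda>y. T y - c *\<^sub>C y) ` ?V" using x(1) img by simp
    then show "\<exists>y. y \<in> ?V \<and> T y - c *\<^sub>C y = x" by auto
  qed
  from choice[OF this] obtain R where "\<forall>c. R c \<in> ?V \<and> T (R c) - c *\<^sub>C R c = x" by (rule exE)
  then have R: "\<And>c. R c \<in> ?V" "\<And>c. T (R c) - c *\<^sub>C R c = x" by simp_all
  have relation: "a c = 0" if "finite F" "(\<Sum>c\<in>F. a c *\<^sub>C R c) = 0" "c \<in> F" for F a c
  proof -
    have "(0 :: complex poly) = 0 \<and> (\<forall>c\<in>F. a c = 0)"
    proof (rule resolvents_independent[OF Tlin V x])
      show "y = 0" if "y \<in> ?V" "T y - c *\<^sub>C y = 0" for c y using that by (rule kernel)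
      show "poly_apply T x 0 + (\<Sum>c\<in>F. a c *\<^sub>C R c) = 0" using that(2) by (simp add: poly_apply_0)
    qed (use R that(1) in simp_all)
    then show ?thesis using that(3) by simp
  qed
  have injR: "inj R"
  proof (rule injI, rule ccontr)
    fix c d assume "R c = R d" "c \<noteq> d"
    then have "(\<Sum>e\<in>{c, d}. (if e = c then 1 else - 1) *\<^sub>C R e) = 0"
      by (simp add: scaleC_minus1 scaleC_one)
    then have "(if c = c then 1 else - 1 :: complex) = 0"
      by (intro relation[of "{c, d}"]) auto
    then show False by simp
  qed
  have "complex_vector.independent (range R)"
    unfolding complex_vector.independent_explicit_module
  proof (intro allI impI)
    fix S u v assume S: "finite S" "S \<subseteq> range R" "(\<Sum>v\<in>S. u v *\<^sub>C v) = 0" "v \<in> S"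
    obtain F where F: "S = R ` F" "finite F"
      using finite_subset_image[OF S(1,2)] by blast
    obtain c where c: "c \<in> F" "v = R c" using S(4) F by blast
    have "(\<Sum>c\<in>F. u (R c) *\<^sub>C R c) = 0"
      using S(3) unfolding F(1) by (subst (asm) sum.reindex) (auto intro: inj_on_subset[OF injR])
    then show "u v = 0"
      using relation[OF F(2), of "\<lambda>c. u (R c)"] c by simp
  qed
  then have "countable (range R)" using countable R(1) by blast
  then have "countable (UNIV :: complex set)" using injR by (rule countable_image_inj_on)
  then show False using uncountable_complex by simp
qed

section \<open>The topology of matrices over a local field\<close>

context nonarchimedean_local_field
begin

lemma v_one: "v 1 = 1"
  using mult[of 1 1] eq_0_iff[of 1] by simp

lemma v_minus_one: "v (- 1) = 1"
proof -
  have "v (- 1) * v (- 1) = 1" using mult[of "- 1" "- 1"] v_one by simp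
  then show ?thesis using nonneg[of "- 1"] by (auto simp: square_eq_1_iff)
qed

lemma v_minus: "v (- x) = v x"
  using mult[of "- 1" x] v_minus_one by simp

lemma v_minus_commute: "v (x - y) = v (y - x)"
  using v_minus[of "x - y"] by simp

lemma v_add_less: "v x < r \<Longrightarrow> v y < r \<Longrightarrow> v (x + y) < r"
  using ultrametric[of x y] by simp

lemma v_sum_less:
  assumes "finite I" "0 < r" "\<And>i. i \<in> I \<Longrightarrow> v (f i) < r"
  shows "v (\<Sum>i\<in>I. f i) < r"
  using assms(1,3)
proof (induction I rule: finite_induct)
  case empty
  then show ?case using assms(2) eq_0_iff[of 0] by simp
qed (simp add: v_add_less)

lemma v_power: "v (x ^ n) = v x ^ n"
  by (induction n) (simp_all add: v_one mult)

sublocale metric: Metric_space UNIV "\<lambda>x y. v (x - y)"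
proof
  show "v (x - z) \<le> v (x - y) + v (y - z)" for x y z
    using ultrametric[of "x - y" "y - z"] nonneg[of "x - y"] nonneg[of "y - z"] by simp
qed (simp_all add: nonneg eq_0_iff v_minus_commute)

lemma openin_valuation_topology:
  "openin (valuation_topology v) U \<longleftrightarrow> (\<forall>x\<in>U. \<exists>r>0. \<forall>y. v (y - x) < r \<longrightarrow> y \<in> U)"
  unfolding valuation_topology_def metric.openin_mtopology metric.mball_def
  by (auto simp: subset_iff v_minus_commute)

lemma topspace_valuation_topology: "topspace (valuation_topology v) = UNIV"
  unfolding valuation_topology_def by simp

lemma topspace_matrix_topology: "topspace (matrix_topology v) = UNIV"
  unfolding matrix_topology_def topspace_pullback_topology
  by (auto simp: topspace_valuation_topology PiE_def)

text \<open>The topology is that of the maximum of the absolute values of the entries; this form serves for continuity and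
  for countability.\<close>

lemma openin_matrix_topology:
  fixes U :: "('f^'n^'n) set"
  shows "openin (matrix_topology v) U \<longleftrightarrow>
    (\<forall>A\<in>U. \<exists>r>0. \<forall>B. (\<forall>i j. v (B $ i $ j - A $ i $ j) < r) \<longrightarrow> B \<in> U)"
proof
  assume "openin (matrix_topology v) U"
  then obtain W where W: "openin (product_topology (\<lambda>_. valuation_topology v) UNIV) W"
    and U: "U = (\<lambda>A (i, j). A $ i $ j) -` W"
    unfolding matrix_topology_def openin_pullback_topology by auto
  show "\<forall>A\<in>U. \<exists>r>0. \<forall>B. (\<forall>i j. v (B $ i $ j - A $ i $ j) < r) \<longrightarrow> B \<in> U"
  proof
    fix A assume "A \<in> U"
    then have "(\<lambda>(i, j). A $ i $ j) \<in> W" using U by simp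
    from W[unfolded openin_product_topology_alt, rule_format, OF this]
    obtain N where N: "\<forall>p\<in>UNIV. openin (valuation_topology v) (N p)"
      "(\<lambda>(i, j). A $ i $ j) \<in> Pi\<^sub>E UNIV N" "Pi\<^sub>E UNIV N \<subseteq> W" by blast
    have "\<exists>r>0. \<forall>y. v (y - A $ fst p $ snd p) < r \<longrightarrow> y \<in> N p" for p
    proof -
      have "A $ fst p $ snd p \<in> N p" using N(2) by (cases p) (auto simp: PiE_def Pi_def)
      then show ?thesis using bspec[OF N(1), of p] unfolding openin_valuation_topology by simp
    qed
    then have "\<forall>p. \<exists>r. r > 0 \<and> (\<forall>y. v (y - A $ fst p $ snd p) < r \<longrightarrow> y \<in> N p)" by simp
    from choice[OF this] obtain r where
      "\<forall>p. r p > 0 \<and> (\<forall>y. v (y - A $ fst p $ snd p) < r p \<longrightarrow> y \<in> N p)" by (rule exE)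
    then have r: "\<And>p. 0 < r p" "\<And>p y. v (y - A $ fst p $ snd p) < r p \<Longrightarrow> y \<in> N p" by blast+
    have "B \<in> U" if B: "\<forall>i j. v (B $ i $ j - A $ i $ j) < Min (range r)" for B
    proof -
      have "v (B $ fst p $ snd p - A $ fst p $ snd p) < r p" for p
        by (rule order_less_le_trans[OF B[rule_format] Min_le]) auto
      then have "B $ fst p $ snd p \<in> N p" for p by (rule r(2))
      from this[of "(i, j)" for i j] have "(\<lambda>(i, j). B $ i $ j) \<in> Pi\<^sub>E UNIV N" by (simp add: PiE_def Pi_def split_beta)
      then show ?thesis using N(3) U by auto
    qed
    moreover have "Min (range r) > 0" using r(1) by (subst Min_gr_iff) auto
    ultimately show "\<exists>r>0. \<forall>B. (\<forall>i j. v (B $ i $ j - A $ i $ j) < r) \<longrightarrow> B \<in> U" by blast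
  qed
next
  assume *: "\<forall>A\<in>U. \<exists>r>0. \<forall>B. (\<forall>i j. v (B $ i $ j - A $ i $ j) < r) \<longrightarrow> B \<in> U"
  define W where "W = {h :: 'n \<times> 'n \<Rightarrow> 'f. (\<chi> i j. h (i, j)) \<in> U}"
  have "openin (product_topology (\<lambda>_. valuation_topology v) UNIV) W"
    unfolding openin_product_topology_alt
  proof
    fix h assume "h \<in> W"
    then have "(\<chi> i j. h (i, j)) \<in> U" by (simp add: W_def)
    from bspec[OF * this] obtain r where r: "r > 0"
      "\<And>B :: 'f^'n^'n. (\<forall>i j. v (B $ i $ j - h (i, j)) < r) \<Longrightarrow> B \<in> U" by auto
    define N where "N p = {y. v (y - h p) < r}" for p
    have "openin (valuation_topology v) (N p)" for p
      unfolding openin_valuation_topology N_def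
    proof
      fix x assume x: "x \<in> {y. v (y - h p) < r}"
      have "v (y - h p) < r" if "v (y - x) < r" for y
        using v_add_less[of "y - x" r "x - h p"] that x by simp
      then show "\<exists>s>0. \<forall>y. v (y - x) < s \<longrightarrow> y \<in> {y. v (y - h p) < r}" using r(1) by blast
    qed
    moreover have "h \<in> Pi\<^sub>E UNIV N" using r(1) eq_0_iff[of 0] by (simp add: PiE_def N_def)
    moreover have mem: "f \<in> W" if f: "f \<in> Pi\<^sub>E UNIV N" for f
    proof -
      have "v (f p - h p) < r" for p using f by (cases p) (auto simp: PiE_def Pi_def N_def)
      then show ?thesis unfolding W_def using r(2)[of "\<chi> i j. f (i, j)"] by simp
    qed
    have "Pi\<^sub>E UNIV N \<subseteq> W" using mem by (rule subsetI)
    ultimately show "\<exists>N. finite {p \<in> UNIV. N p \<noteq> topspace (valuation_topology v)} \<and>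
        (\<forall>p\<in>UNIV. openin (valuation_topology v) (N p)) \<and> h \<in> Pi\<^sub>E UNIV N \<and> Pi\<^sub>E UNIV N \<subseteq> W"
      by (intro exI[of _ N]) simp
  qed
  moreover have "U = (\<lambda>A (i, j). A $ i $ j) -` W"
    by (auto simp: W_def)
  ultimately show "openin (matrix_topology v) U"
    unfolding matrix_topology_def openin_pullback_topology by auto
qed

lemma openin_matrix_preimage:
  fixes U :: "('f^'n^'n) set"
  assumes "openin (matrix_topology v) U"
  shows "openin (matrix_topology v) {A. g ** A \<in> U}" "openin (matrix_topology v) {A. A ** g \<in> U}"
proof -
  define M where "M = Max (range (\<lambda>p. v (g $ fst p $ snd p)))"
  have M: "v (g $ i $ j) \<le> M" for i j
    unfolding M_def by (rule Max_ge) (auto intro!: image_eqI[of _ _ "(i, j)"])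
  have "0 \<le> M" using M nonneg order_trans by blast
  have bound: "v (g $ i $ j * y) < r" "v (y * g $ i $ j) < r" if "r > 0" "v y < r / (M + 1)" for i j y r
  proof -
    have "v (g $ i $ j) * v y \<le> M * v y" using M nonneg by (simp add: mult_right_mono)
    also have "\<dots> \<le> (M + 1) * v y" using nonneg by (simp add: mult_right_mono)
    also have "\<dots> < r" using that(2) \<open>0 \<le> M\<close> by (simp add: field_simps)
    finally show "v (g $ i $ j * y) < r" "v (y * g $ i $ j) < r"
      by (simp_all add: mult mult.commute)
  qed
  show "openin (matrix_topology v) {A. g ** A \<in> U}"
    unfolding openin_matrix_topology
  proof
    fix A assume "A \<in> {A. g ** A \<in> U}"
    then obtain r where r: "r > 0" "\<And>B. (\<forall>i j. v (B $ i $ j - (g ** A) $ i $ j) < r) \<Longrightarrow> B \<in> U"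
      using assms unfolding openin_matrix_topology by blast
    have "g ** B \<in> U" if B: "\<forall>i j. v (B $ i $ j - A $ i $ j) < r / (M + 1)" for B
    proof (rule r(2), intro allI)
      fix i j
      have diff: "(g ** B) $ i $ j - (g ** A) $ i $ j = (\<Sum>k\<in>UNIV. g $ i $ k * (B $ k $ j - A $ k $ j))"
        by (simp add: matrix_matrix_mult_def sum_subtractf right_diff_distrib)
      show "v ((g ** B) $ i $ j - (g ** A) $ i $ j) < r"
        unfolding diff by (intro v_sum_less[OF _ r(1)] bound(1)[OF r(1)] B[rule_format]) simp
    qed
    then show "\<exists>s>0. \<forall>B. (\<forall>i j. v (B $ i $ j - A $ i $ j) < s) \<longrightarrow> B \<in> {A. g ** A \<in> U}"
      using r(1) \<open>0 \<le> M\<close> by (intro exI[of _ "r / (M + 1)"]) simp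
  qed
  show "openin (matrix_topology v) {A. A ** g \<in> U}"
    unfolding openin_matrix_topology
  proof
    fix A assume "A \<in> {A. A ** g \<in> U}"
    then obtain r where r: "r > 0" "\<And>B. (\<forall>i j. v (B $ i $ j - (A ** g) $ i $ j) < r) \<Longrightarrow> B \<in> U"
      using assms unfolding openin_matrix_topology by blast
    have "B ** g \<in> U" if B: "\<forall>i j. v (B $ i $ j - A $ i $ j) < r / (M + 1)" for B
    proof (rule r(2), intro allI)
      fix i j
      have diff: "(B ** g) $ i $ j - (A ** g) $ i $ j = (\<Sum>k\<in>UNIV. (B $ i $ k - A $ i $ k) * g $ k $ j)"
        by (simp add: matrix_matrix_mult_def sum_subtractf left_diff_distrib)
      show "v ((B ** g) $ i $ j - (A ** g) $ i $ j) < r"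
        unfolding diff by (intro v_sum_less[OF _ r(1)] bound(2)[OF r(1)] B[rule_format]) simp
    qed
    then show "\<exists>s>0. \<forall>B. (\<forall>i j. v (B $ i $ j - A $ i $ j) < s) \<longrightarrow> B \<in> {A. A ** g \<in> U}"
      using r(1) \<open>0 \<le> M\<close> by (intro exI[of _ "r / (M + 1)"]) simp
  qed
qed

text \<open>The residue field is finite, since the inverse of its cardinality is the absolute value of an
  element different from 0. Expanding integral elements in powers of the uniformiser with digits in a
  finite set of representatives of the residue field approximates them up to any precision, and division by
  powers of the uniformiser extends this to the whole field.\<close>

lemma countable_dense: "\<exists>C. countable C \<and> (\<forall>x. \<forall>r>0. \<exists>c\<in>C. v (x - c) < r)"
proof -
  let ?O = "{x. v x \<le> 1}" and ?disc = "\<lambda>x. {y. v (y - x) < 1}"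
  obtain \<pi> where \<pi>: "\<pi> \<noteq> 0" "v \<pi> < 1" "\<And>x. v x < 1 \<Longrightarrow> v x \<le> v \<pi>"
    "v \<pi> = 1 / real (card (?disc ` ?O))"
    using normalised by auto
  have pos: "0 < v \<pi>" using \<pi>(1) eq_0_iff nonneg less_eq_real_def by metis
  then have "finite (?disc ` ?O)" using \<pi>(4) by (intro card_ge_0_finite) (simp add: zero_less_divide_iff)
  then obtain R where R: "finite R" "R \<subseteq> ?O" "?disc ` ?O = ?disc ` R"
    using finite_subset_image[of "?disc ` ?O" ?disc ?O] by auto
  \<comment> \<open>Absolute values below 1 are at most \<open>v \<pi>\<close>, so residue discs are balls of radius \<open>v \<pi>\<close>.\<close>
  have digit: "\<exists>d\<in>R. v (x - d) \<le> v \<pi>" if "v x \<le> 1" for x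
  proof -
    have "?disc x \<in> ?disc ` R" unfolding R(3)[symmetric] using that by (intro imageI) simp
    then obtain d where d: "?disc x = ?disc d" "d \<in> R" by (rule imageE)
    have "x \<in> ?disc x" using eq_0_iff[of 0] by simp
    then show ?thesis using d \<pi>(3) by blast
  qed
  have "\<exists>D. finite D \<and> (\<forall>x. v x \<le> 1 \<longrightarrow> (\<exists>d\<in>D. v (x - d) \<le> v \<pi> ^ n))" for n
  proof (induction n)
    case 0
    show ?case by (intro exI[of _ "{0}"]) simp
  next
    case (Suc n)
    then obtain D where D: "finite D" "\<And>x. v x \<le> 1 \<Longrightarrow> \<exists>d\<in>D. v (x - d) \<le> v \<pi> ^ n" by auto
    let ?D = "(\<lambda>(r, d). r + \<pi> * d) ` (R \<times> D)"
    have "\<exists>d\<in>?D. v (x - d) \<le> v \<pi> ^ Suc n" if x: "v x \<le> 1" for x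
    proof -
      obtain r where r: "r \<in> R" "v (x - r) \<le> v \<pi>" using digit[OF x] by blast
      let ?y = "(x - r) / \<pi>"
      have y: "\<pi> * ?y = x - r" using \<pi>(1) by simp
      then have "v \<pi> * v ?y \<le> v \<pi> * 1" using r(2) mult[of \<pi> ?y] by simp
      then have "v ?y \<le> 1" using pos by simp
      then obtain d where d: "d \<in> D" "v (?y - d) \<le> v \<pi> ^ n" using D(2) by blast
      have "x - (r + \<pi> * d) = \<pi> * (?y - d)" using y by (simp add: algebra_simps)
      then have "v (x - (r + \<pi> * d)) \<le> v \<pi> ^ Suc n" using d(2) pos by (simp add: mult)
      then show ?thesis using r(1) d(1) by force
    qed
    then show ?case using D(1) R(1) by (intro exI[of _ ?D]) simp
  qed
  then have "\<forall>n. \<exists>D. finite D \<and> (\<forall>x. v x \<le> 1 \<longrightarrow> (\<exists>d\<in>D. v (x - d) \<le> v \<pi> ^ n))" by (rule allI)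
  from choice[OF this] obtain D where
    "\<forall>n. finite (D n) \<and> (\<forall>x. v x \<le> 1 \<longrightarrow> (\<exists>d\<in>D n. v (x - d) \<le> v \<pi> ^ n))" by (rule exE)
  then have D: "\<And>n. finite (D n)" "\<And>n x. v x \<le> 1 \<Longrightarrow> \<exists>d\<in>D n. v (x - d) \<le> v \<pi> ^ n" by simp_all
  let ?C = "\<Union>n. \<Union>m. (\<lambda>d. d / \<pi> ^ m) ` D n"
  have "countable ?C" using D(1) by (auto intro!: countable_UN countable_image intro: countable_finite)
  moreover have "\<exists>c\<in>?C. v (x - c) < r" if r: "r > 0" for x r
  proof -
    have small: "\<exists>n. a * v \<pi> ^ n < b" if "b > 0" "a \<ge> 0" for a b
    proof -
      have "0 < b / (a + 1)" using that by simp
      then obtain n where "v \<pi> ^ n < b / (a + 1)"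
        using real_arch_pow_inv \<pi>(2) by blast
      then have "(a + 1) * v \<pi> ^ n < b" using that by (simp add: field_simps)
      moreover have "a * v \<pi> ^ n \<le> (a + 1) * v \<pi> ^ n" using pos by (simp add: mult_right_mono)
      ultimately show ?thesis by (intro exI[of _ n]) simp
    qed
    obtain m where m: "v x * v \<pi> ^ m < 1" using small[of 1 "v x"] nonneg by auto
    obtain n where n: "(1 / v \<pi> ^ m) * v \<pi> ^ n < r" using small[of r "1 / v \<pi> ^ m"] r pos by auto
    have "v (x * \<pi> ^ m) \<le> 1" using m by (simp add: mult v_power)
    then obtain d where d: "d \<in> D n" "v (x * \<pi> ^ m - d) \<le> v \<pi> ^ n" using D(2) by blast
    have "(x - d / \<pi> ^ m) * \<pi> ^ m = x * \<pi> ^ m - d" using \<pi>(1) by (simp add: left_diff_distrib)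
    then have "v (x - d / \<pi> ^ m) * v \<pi> ^ m \<le> v \<pi> ^ n" using d(2) by (metis mult v_power)
    then have "v (x - d / \<pi> ^ m) \<le> v \<pi> ^ n / v \<pi> ^ m" using pos by (simp add: field_simps)
    then have "v (x - d / \<pi> ^ m) < r" using n by simp
    then show ?thesis using d(1) by blast
  qed
  ultimately show ?thesis by (intro exI[of _ ?C]) simp
qed

lemma second_countable_matrix_topology:
  "second_countable (matrix_topology v :: ('f^'n^'n) topology)"
proof -
  obtain C where C: "countable C" "\<And>x r. r > 0 \<Longrightarrow> \<exists>c\<in>C. v (x - c) < r"
    using countable_dense by auto
  define box :: "'f^'n^'n \<Rightarrow> nat \<Rightarrow> ('f^'n^'n) set"
    where "box A n = {B. \<forall>i j. v (B $ i $ j - A $ i $ j) < 1 / Suc n}" for A n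
  let ?M = "{A :: 'f^'n^'n. \<forall>i j. A $ i $ j \<in> C}"
  let ?\<B> = "(\<lambda>(A, n). box A n) ` (?M \<times> UNIV)"
  \<comment> \<open>In an ultrametric space every point of a ball is a centre of it.\<close>
  have box_mem: "box A n = box B n" if "B \<in> box A n" for A B n
  proof -
    have "v (B $ i $ j - A $ i $ j) < 1 / Suc n" "v (A $ i $ j - B $ i $ j) < 1 / Suc n" for i j
      using that by (auto simp: box_def v_minus_commute)
    then have "v (D $ i $ j - A $ i $ j) < 1 / Suc n \<longleftrightarrow> v (D $ i $ j - B $ i $ j) < 1 / Suc n" for D :: "'f^'n^'n" and i j
      using v_add_less[of "D $ i $ j - A $ i $ j" "1 / Suc n" "A $ i $ j - B $ i $ j"]
        v_add_less[of "D $ i $ j - B $ i $ j" "1 / Suc n" "B $ i $ j - A $ i $ j"] by auto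
    then show ?thesis by (simp add: box_def)
  qed
  have "?M \<subseteq> (\<lambda>f. \<chi> i j. f (i, j)) ` (Pi\<^sub>E UNIV (\<lambda>_. C))"
  proof
    fix A assume A: "A \<in> ?M"
    have "A = (\<chi> i j. (\<lambda>p. A $ fst p $ snd p) (i, j))" by (simp add: vec_eq_iff)
    moreover have "(\<lambda>p. A $ fst p $ snd p) \<in> Pi\<^sub>E UNIV (\<lambda>_. C)" using A by (auto simp: PiE_def)
    ultimately show "A \<in> (\<lambda>f. \<chi> i j. f (i, j)) ` (Pi\<^sub>E UNIV (\<lambda>_. C))" by (rule image_eqI)
  qed
  moreover have "countable (Pi\<^sub>E (UNIV :: ('n \<times> 'n) set) (\<lambda>_. C))"
    using C(1) by (intro countable_PiE) auto
  then have "countable ((\<lambda>f. \<chi> i j. f (i, j)) ` (Pi\<^sub>E (UNIV :: ('n \<times> 'n) set) (\<lambda>_. C)))"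
    by (rule countable_image)
  ultimately have "countable ?M" by (rule countable_subset)
  then have "countable ?\<B>" by simp
  moreover have "openin (matrix_topology v) (box A n)" for A n
    unfolding openin_matrix_topology
  proof
    fix B assume "B \<in> box A n"
    from box_mem[OF this] have "\<forall>D. (\<forall>i j. v (D $ i $ j - B $ i $ j) < 1 / Suc n) \<longrightarrow> D \<in> box A n"
      by (simp add: box_def)
    then show "\<exists>r>0. \<forall>D. (\<forall>i j. v (D $ i $ j - B $ i $ j) < r) \<longrightarrow> D \<in> box A n"
      by (intro exI[of _ "1 / Suc n"]) simp
  qed
  moreover have "\<exists>V\<in>?\<B>. A \<in> V \<and> V \<subseteq> U" if U: "openin (matrix_topology v) U" "A \<in> U" for U A
  proof -
    obtain r where r: "r > 0" "\<And>B. (\<forall>i j. v (B $ i $ j - A $ i $ j) < r) \<Longrightarrow> B \<in> U"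
      using U unfolding openin_matrix_topology by blast
    obtain n where n: "1 / Suc n < r" using nat_approx_posE[OF r(1)] by blast
    have "\<forall>i j. \<exists>c\<in>C. v (A $ i $ j - c) < 1 / Suc n" using C(2) by simp
    then have "\<forall>p. \<exists>c. c \<in> C \<and> v (A $ fst p $ snd p - c) < 1 / Suc n" by blast
    from choice[OF this] obtain d where
      "\<forall>p. d p \<in> C \<and> v (A $ fst p $ snd p - d p) < 1 / Suc n" by (rule exE)
    then have c: "d (i, j) \<in> C" "v (A $ i $ j - d (i, j)) < 1 / Suc n" for i j by (metis fst_conv snd_conv)+
    let ?D = "\<chi> i j. d (i, j)"
    have A: "A \<in> box ?D n" using c(2) by (simp add: box_def)
    have "box ?D n \<subseteq> U"
      unfolding box_mem[OF A]
    proof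
      fix B assume "B \<in> box A n"
      then have "v (B $ i $ j - A $ i $ j) < 1 / Suc n" for i j by (simp add: box_def)
      then show "B \<in> U" using n by (intro r(2) allI) (rule order_less_trans)
    qed
    moreover have "(?D, n) \<in> ?M \<times> UNIV" using c(1) by simp
    then have "box ?D n \<in> ?\<B>" by (rule rev_image_eqI) simp
    ultimately show ?thesis using A by (intro bexI[of _ "box ?D n"] conjI)
  qed
  ultimately show ?thesis unfolding second_countable_def by (intro exI[of _ ?\<B>] conjI) auto
qed

end

section \<open>Groups with continuous translations\<close>

locale translation_group = group G for G (structure) +
  fixes T :: "'a topology"
  assumes topspace_eq: "topspace T = carrier G"
    and left_translation: "openin T U \<Longrightarrow> g \<in> carrier G \<Longrightarrow> openin T {x \<in> carrier G. g \<otimes> x \<in> U}"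
    and right_translation: "openin T U \<Longrightarrow> g \<in> carrier G \<Longrightarrow> openin T {x \<in> carrier G. x \<otimes> g \<in> U}"
    and second_countable: "second_countable T"
begin

lemma open_subset: "openin T U \<Longrightarrow> U \<subseteq> carrier G"
  using openin_subset topspace_eq by blast

lemma open_l_coset:
  assumes "openin T U" "g \<in> carrier G"
  shows "openin T (g <# U)"
proof -
  have "g <# U = {x \<in> carrier G. inv g \<otimes> x \<in> U}"
  proof (intro equalityI subsetI)
    fix x assume "x \<in> g <# U"
    then obtain u where "u \<in> U" "x = g \<otimes> u" by (auto simp: l_coset_def)
    then show "x \<in> {x \<in> carrier G. inv g \<otimes> x \<in> U}"
      using open_subset[OF assms(1)] assms(2) by (auto simp: m_assoc[symmetric])
  next
    fix x assume "x \<in> {x \<in> carrier G. inv g \<otimes> x \<in> U}"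
    then have "x = g \<otimes> (inv g \<otimes> x)" "inv g \<otimes> x \<in> U"
      using assms(2) by (auto simp: m_assoc[symmetric])
    then show "x \<in> g <# U" unfolding l_coset_def by blast
  qed
  then show ?thesis using left_translation[OF assms(1), of "inv g"] assms(2) by simp
qed

lemma open_r_coset:
  assumes "openin T U" "g \<in> carrier G"
  shows "openin T (U #> g)"
proof -
  have "U #> g = {x \<in> carrier G. x \<otimes> inv g \<in> U}"
  proof (intro equalityI subsetI)
    fix x assume "x \<in> U #> g"
    then obtain u where "u \<in> U" "x = u \<otimes> g" by (auto simp: r_coset_def)
    then show "x \<in> {x \<in> carrier G. x \<otimes> inv g \<in> U}"
      using open_subset[OF assms(1)] assms(2) by (auto simp: m_assoc)
  next
    fix x assume "x \<in> {x \<in> carrier G. x \<otimes> inv g \<in> U}"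
    then have "x = x \<otimes> inv g \<otimes> g" "x \<otimes> inv g \<in> U"
      using assms(2) by (auto simp: m_assoc)
    then show "x \<in> U #> g" unfolding r_coset_def by blast
  qed
  then show ?thesis using right_translation[OF assms(1), of "inv g"] assms(2) by simp
qed

lemma open_subgroup_superset:
  assumes "subgroup S G" "openin T K" "\<one> \<in> K" "K \<subseteq> S"
  shows "openin T S"
proof -
  have "S = (\<Union>s\<in>S. s <# K)"
  proof (intro equalityI subsetI)
    fix s assume "s \<in> S"
    moreover have "s = s \<otimes> \<one>" using subgroup.subset[OF assms(1)] \<open>s \<in> S\<close> by auto
    ultimately show "s \<in> (\<Union>s\<in>S. s <# K)" using assms(3) unfolding l_coset_def by blast
  next
    fix x assume "x \<in> (\<Union>s\<in>S. s <# K)"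
    then show "x \<in> S" using assms(4) subgroup.m_closed[OF assms(1)] unfolding l_coset_def by blast
  qed
  moreover have "openin T (\<Union>s\<in>S. s <# K)"
    using open_l_coset[OF assms(2)] subgroup.subset[OF assms(1)] by (intro openin_Union) blast
  ultimately show ?thesis by simp
qed

text \<open>Since \<open>H\<close> is open, the quotient topology on the cosets of \<open>H\<close> is discrete.\<close>

lemma compact_modulo_iff:
  assumes "subgroup H G" "openin T H" "S \<subseteq> carrier G"
  shows "compact_modulo G T H S \<longleftrightarrow> finite ((\<lambda>g. H #> g) ` S)"
proof -
  let ?q = "\<lambda>g. H #> g" and ?Q = "quotient_topology T (\<lambda>g. H #> g)"
  have fibre: "openin ?Q {?q a}" if a: "a \<in> carrier G" for a
  proof -
    have "{x \<in> topspace T. ?q x \<in> {?q a}} = H #> a"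
    proof (intro equalityI subsetI)
      fix x assume "x \<in> {x \<in> topspace T. ?q x \<in> {?q a}}"
      then show "x \<in> H #> a" using rcos_self[OF _ assms(1), of x] topspace_eq by auto
    next
      fix x assume x: "x \<in> H #> a"
      then have "x \<in> carrier G" using a r_coset_subset_G[OF subgroup.subset[OF assms(1)]] by blast
      then show "x \<in> {x \<in> topspace T. ?q x \<in> {?q a}}"
        using repr_independence[OF x a assms(1)] topspace_eq by simp
    qed
    then show ?thesis
      unfolding openin_quotient_topology using open_r_coset[OF assms(2) a] a topspace_eq by auto
  qed
  have top: "topspace ?Q = ?q ` carrier G"
    using quotient_imp_surjective_map[OF quotient_map_quotient_topology[of T ?q]] topspace_eq by simp
  show ?thesis
    unfolding compact_modulo_def
  proof
    assume c: "compactin ?Q (?q ` S)"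
    have "\<forall>U\<in>(\<lambda>a. {?q a}) ` S. openin ?Q U" using fibre assms(3) by auto
    moreover have "?q ` S \<subseteq> \<Union>((\<lambda>a. {?q a}) ` S)" by auto
    ultimately obtain \<F> where \<F>: "finite \<F>" "\<F> \<subseteq> (\<lambda>a. {?q a}) ` S" "?q ` S \<subseteq> \<Union>\<F>"
      using conjunct2[OF c[unfolded compactin_def], rule_format, of "(\<lambda>a. {?q a}) ` S"] by blast
    have "finite (\<Union>\<F>)" using \<F>(1,2) by (intro finite_Union) auto
    then show "finite (?q ` S)" using \<F>(3) by (rule finite_subset[rotated])
  next
    assume "finite (?q ` S)"
    then show "compactin ?Q (?q ` S)"
      using assms(3) top by (intro finite_imp_compactin) auto
  qed
qed

text \<open>Choosing a nonempty basic open set inside every fibre embeds the image into the countable base.\<close>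

lemma countable_image_open_fibres:
  assumes "\<And>y. y \<in> f ` S \<Longrightarrow> openin T {h \<in> S. f h = y}"
  shows "countable (f ` S)"
proof -
  obtain \<B> where \<B>: "countable \<B>" "\<And>U x. openin T U \<Longrightarrow> x \<in> U \<Longrightarrow> \<exists>V\<in>\<B>. x \<in> V \<and> V \<subseteq> U"
  proof -
    from second_countable[unfolded second_countable_def] obtain \<B> where
      *: "countable \<B> \<and> (\<forall>V\<in>\<B>. openin T V) \<and>
        (\<forall>U x. openin T U \<and> x \<in> U \<longrightarrow> (\<exists>V\<in>\<B>. x \<in> V \<and> V \<subseteq> U))" by (rule exE)
    show thesis
    proof (rule that)
      show "countable \<B>" using * by simp
      show "\<exists>V\<in>\<B>. x \<in> V \<and> V \<subseteq> U" if "openin T U" "x \<in> U" for U x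
        using conjunct2[OF conjunct2[OF *], rule_format, OF conjI[OF that]] .
    qed
  qed
  have "\<exists>V. V \<in> \<B> \<and> V \<noteq> {} \<and> V \<subseteq> {h \<in> S. f h = y}" if y: "y \<in> f ` S" for y
  proof -
    obtain h where "h \<in> S" "y = f h" using y by blast
    then show ?thesis using \<B>(2)[OF assms[OF y], of h] by blast
  qed
  then have "\<forall>y\<in>f ` S. \<exists>V. V \<in> \<B> \<and> V \<noteq> {} \<and> V \<subseteq> {h \<in> S. f h = y}" by (rule ballI)
  from bchoice[OF this] obtain N where
    *: "\<forall>y\<in>f ` S. N y \<in> \<B> \<and> N y \<noteq> {} \<and> N y \<subseteq> {h \<in> S. f h = y}" by (rule exE)
  have N: "N y \<in> \<B>" "N y \<noteq> {}" "N y \<subseteq> {h \<in> S. f h = y}" if "y \<in> f ` S" for y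
    using bspec[OF * that] by blast+
  have "inj_on N (f ` S)"
  proof (rule inj_onI)
    fix y z assume yz: "y \<in> f ` S" "z \<in> f ` S" "N y = N z"
    obtain h where "h \<in> N y" using N(2)[OF yz(1)] by blast
    then show "y = z" using N(3)[OF yz(1)] N(3)[OF yz(2)] yz(3) by blast
  qed
  moreover have "N ` f ` S \<subseteq> \<B>" using N(1) by auto
  then have "countable (N ` f ` S)" using \<B>(1) by (rule countable_subset)
  ultimately show ?thesis by (rule countable_image_inj_on[rotated])
qed

lemma finite_image_open_fibres:
  assumes "compactin T S" "\<And>y. y \<in> f ` S \<Longrightarrow> openin T {h \<in> S. f h = y}"
  shows "finite (f ` S)"
proof -
  let ?\<U> = "(\<lambda>y. {h \<in> S. f h = y}) ` f ` S"
  have "\<forall>U\<in>?\<U>. openin T U" using assms(2) by auto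
  moreover have "S \<subseteq> \<Union>?\<U>" by auto
  ultimately obtain \<F> where \<F>: "finite \<F>" "\<F> \<subseteq> ?\<U>" "S \<subseteq> \<Union>\<F>"
    using conjunct2[OF assms(1)[unfolded compactin_def], rule_format, of ?\<U>] by blast
  obtain Y where Y: "finite Y" "\<F> = (\<lambda>y. {h \<in> S. f h = y}) ` Y"
    using finite_subset_image[OF \<F>(1,2)] by blast
  have "f ` S \<subseteq> Y" using \<F>(3) Y(2) by auto
  then show ?thesis using Y(1) by (rule finite_subset)
qed

text \<open>The fibres of the orbit map are the left cosets of the stabiliser of \<open>x\<close>, which is open by smoothness.\<close>

lemma orbit_fibre_open:
  assumes "subgroup H G" "openin T H" "representation G H \<sigma>" "smooth T H \<sigma>" "x \<in> rspace \<sigma>" "h \<in> H"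
  shows "openin T {k \<in> H. act \<sigma> k x = act \<sigma> h x}"
proof -
  note H = subgroup.subset[OF assms(1)]
  note mult = assms(3)[unfolded representation_def, THEN conjunct2, THEN conjunct2, THEN conjunct2, rule_format]
  have one: "act \<sigma> \<one> y = y" if "y \<in> rspace \<sigma>" for y
    using assms(3) that unfolding representation_def by blast
  let ?S = "{k \<in> H. act \<sigma> k x = x}"
  have "openin T ?S"
    using assms(4,5) unfolding smooth_def by (intro openin_trans_full[OF _ assms(2)]) simp
  then have "openin T (h <# ?S)" using open_l_coset assms(6) H by blast
  moreover have "h <# ?S = {k \<in> H. act \<sigma> k x = act \<sigma> h x}"
  proof (intro equalityI subsetI)
    fix k assume "k \<in> h <# ?S"
    then obtain s where "s \<in> H" "act \<sigma> s x = x" "k = h \<otimes> s" by (auto simp: l_coset_def)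
    then show "k \<in> {k \<in> H. act \<sigma> k x = act \<sigma> h x}"
      using mult[OF assms(6) _ assms(5)] subgroup.m_closed[OF assms(1) assms(6)] by simp
  next
    fix k assume "k \<in> {k \<in> H. act \<sigma> k x = act \<sigma> h x}"
    then have k: "k \<in> H" "act \<sigma> k x = act \<sigma> h x" by auto
    note ih = subgroup.m_inv_closed[OF assms(1) assms(6)]
    have "act \<sigma> (inv h \<otimes> k) x = act \<sigma> (inv h \<otimes> h) x"
      using mult[OF ih k(1) assms(5)] mult[OF ih assms(6) assms(5)] k(2) by simp
    also have "\<dots> = x" using one[OF assms(5)] assms(6) H by (simp add: subsetD)
    finally have "inv h \<otimes> k \<in> ?S" using subgroup.m_closed[OF assms(1) ih k(1)] by simp
    moreover have "k = h \<otimes> (inv h \<otimes> k)"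
      using H k(1) assms(6) by (simp add: m_assoc[symmetric] subsetD)
    ultimately show "k \<in> h <# ?S" unfolding l_coset_def by blast
  qed
  ultimately show ?thesis by simp
qed

lemma countable_orbit:
  assumes "subgroup H G" "openin T H" "representation G H \<sigma>" "smooth T H \<sigma>" "x \<in> rspace \<sigma>"
  shows "countable ((\<lambda>h. act \<sigma> h x) ` H)"
  using orbit_fibre_open[OF assms] by (intro countable_image_open_fibres) auto

lemma finite_orbit:
  assumes "subgroup H G" "openin T H" "representation G H \<sigma>" "smooth T H \<sigma>" "x \<in> rspace \<sigma>" "compactin T H"
  shows "finite ((\<lambda>h. act \<sigma> h x) ` H)"
  using orbit_fibre_open[OF assms(1-5)] by (intro finite_image_open_fibres[OF assms(6)]) auto

end

section \<open>Compact induction from open subgroups\<close>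

lemma sum_fun_apply: "(\<Sum>i\<in>I. f i) x = (\<Sum>i\<in>I. f i x)" for f :: "'i \<Rightarrow> 'a \<Rightarrow> 'b::comm_monoid_add"
  by (induction I rule: infinite_finite_induct) simp_all

lemma (in group) mult_inv_cancel:
  assumes "x \<in> carrier G" "y \<in> carrier G"
  shows "x \<otimes> (inv x \<otimes> y) = y" "inv x \<otimes> (x \<otimes> y) = y"
  using assms by (simp_all add: m_assoc[symmetric])

locale inducible = translation_group G T for G (structure) and T +
  fixes H :: "'a set" and \<sigma> :: "('a, 'v::complex_vector) rep"
  assumes subgroup: "subgroup H G" and open_H: "openin T H"
    and rep: "representation G H \<sigma>" and smooth: "smooth T H \<sigma>"
begin

abbreviation Ind :: "('a, 'a \<Rightarrow> 'v) rep"
  where "Ind \<equiv> compact_induction G T H \<sigma>"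

text \<open>The functions supported on \<open>H\<close>; their right translates span the induced representation.\<close>

definition bump :: "'v \<Rightarrow> 'a \<Rightarrow> 'v"
  where "bump w = (\<lambda>g. if g \<in> H then act \<sigma> g w else 0)"

lemma H_carrier: "h \<in> H \<Longrightarrow> h \<in> carrier G"
  using subgroup.subset[OF subgroup] by blast

lemma space: "csubspace (rspace \<sigma>)"
  using rep by (simp add: representation_def)

lemma lin: "h \<in> H \<Longrightarrow> linear_between (rspace \<sigma>) (rspace \<sigma>) (act \<sigma> h)"
  using rep by (simp add: representation_def)

lemma act_1: "x \<in> rspace \<sigma> \<Longrightarrow> act \<sigma> \<one> x = x"
  using rep by (simp add: representation_def)

lemma act_comp: "h \<in> H \<Longrightarrow> k \<in> H \<Longrightarrow> x \<in> rspace \<sigma> \<Longrightarrow> act \<sigma> (h \<otimes> k) x = act \<sigma> h (act \<sigma> k x)"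
  using rep by (simp add: representation_def)

lemma act_closed: "h \<in> H \<Longrightarrow> x \<in> rspace \<sigma> \<Longrightarrow> act \<sigma> h x \<in> rspace \<sigma>"
  using linear_betweenD(1)[OF lin] .

lemma act_zero: "h \<in> H \<Longrightarrow> act \<sigma> h 0 = 0"
  using linear_between_zero[OF lin space] .

lemma act_inverse:
  assumes "h \<in> H" "x \<in> rspace \<sigma>"
  shows "act \<sigma> (inv h) (act \<sigma> h x) = x" "act \<sigma> h (act \<sigma> (inv h) x) = x"
  using act_comp[OF subgroup.m_inv_closed[OF subgroup assms(1)] assms]
    act_comp[OF assms(1) subgroup.m_inv_closed[OF subgroup assms(1)] assms(2)]
    act_1[OF assms(2)] H_carrier[OF assms(1)] by simp_all

lemma act_eq_0: "h \<in> H \<Longrightarrow> x \<in> rspace \<sigma> \<Longrightarrow> act \<sigma> h x = 0 \<Longrightarrow> x = 0"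
  using act_inverse(1)[of h x] act_zero[OF subgroup.m_inv_closed[OF subgroup]] by simp

text \<open>As \<open>H\<close> is open, compact support modulo \<open>H\<close> means that the support consists of finitely many cosets.\<close>

lemma Ind_iff:
  "f \<in> rspace Ind \<longleftrightarrow> (\<forall>g\<in>carrier G. f g \<in> rspace \<sigma>) \<and> (\<forall>g. g \<notin> carrier G \<longrightarrow> f g = 0) \<and>
    (\<forall>h\<in>H. \<forall>g\<in>carrier G. f (h \<otimes> g) = act \<sigma> h (f g)) \<and>
    (\<exists>K. subgroup K G \<and> openin T K \<and> (\<forall>g\<in>carrier G. \<forall>k\<in>K. f (g \<otimes> k) = f g)) \<and>
    finite ((\<lambda>g. H #> g) ` {g \<in> carrier G. f g \<noteq> 0})"
  using compact_modulo_iff[OF subgroup open_H, of "{g \<in> carrier G. f g \<noteq> 0}"]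
  by (simp add: compact_induction_def)

lemma IndD:
  assumes "f \<in> rspace Ind"
  shows "g \<in> carrier G \<Longrightarrow> f g \<in> rspace \<sigma>" "g \<notin> carrier G \<Longrightarrow> f g = 0"
    "h \<in> H \<Longrightarrow> g \<in> carrier G \<Longrightarrow> f (h \<otimes> g) = act \<sigma> h (f g)"
    "\<exists>K. subgroup K G \<and> openin T K \<and> (\<forall>g\<in>carrier G. \<forall>k\<in>K. f (g \<otimes> k) = f g)"
    "finite ((\<lambda>g. H #> g) ` {g \<in> carrier G. f g \<noteq> 0})"
  using assms unfolding Ind_iff by simp_all

lemma act_Ind: "act Ind x f g = (if g \<in> carrier G then f (g \<otimes> x) else 0)"
  by (simp add: compact_induction_def)

lemma coset_eq_iff:
  assumes "g \<in> carrier G" "r \<in> carrier G"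
  shows "H #> g = H #> r \<longleftrightarrow> g \<otimes> inv r \<in> H"
proof
  assume "H #> g = H #> r"
  then have "g \<in> H #> r" using rcos_self[OF assms(1) subgroup] by simp
  then obtain h where "h \<in> H" "g = h \<otimes> r" unfolding r_coset_def by blast
  then show "g \<otimes> inv r \<in> H" using assms H_carrier by (simp add: m_assoc)
next
  assume *: "g \<otimes> inv r \<in> H"
  have "g = (g \<otimes> inv r) \<otimes> r" using assms by (simp add: m_assoc)
  then have "g \<in> H #> r" using * unfolding r_coset_def by blast
  then show "H #> g = H #> r" using repr_independence[OF _ assms(2) subgroup] by simp
qed

lemma subspace_Ind: "csubspace (rspace Ind)"
proof (rule complex_vector.subspaceI)
  show "0 \<in> rspace Ind"
    unfolding Ind_iff using act_zero complex_vector.subspace_0[OF space] subgroup open_H by auto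
next
  fix f f' assume f: "f \<in> rspace Ind" and f': "f' \<in> rspace Ind"
  obtain K K' where K: "subgroup K G" "openin T K" "\<And>g k. g \<in> carrier G \<Longrightarrow> k \<in> K \<Longrightarrow> f (g \<otimes> k) = f g"
    and K': "subgroup K' G" "openin T K'" "\<And>g k. g \<in> carrier G \<Longrightarrow> k \<in> K' \<Longrightarrow> f' (g \<otimes> k) = f' g"
    using IndD(4)[OF f] IndD(4)[OF f'] by auto
  have "subgroup (K \<inter> K') G" "openin T (K \<inter> K')"
    using K K' subgroups_Inter_pair by blast+
  then have "\<exists>K. subgroup K G \<and> openin T K \<and> (\<forall>g\<in>carrier G. \<forall>k\<in>K. (f + f') (g \<otimes> k) = (f + f') g)"
    using K(3) K'(3) by (intro exI[of _ "K \<inter> K'"]) simp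
  moreover have "(\<lambda>g. H #> g) ` {g \<in> carrier G. (f + f') g \<noteq> 0} \<subseteq>
      (\<lambda>g. H #> g) ` {g \<in> carrier G. f g \<noteq> 0} \<union> (\<lambda>g. H #> g) ` {g \<in> carrier G. f' g \<noteq> 0}"
    by auto
  then have "finite ((\<lambda>g. H #> g) ` {g \<in> carrier G. (f + f') g \<noteq> 0})"
    by (rule finite_subset) (simp add: IndD(5)[OF f] IndD(5)[OF f'])
  ultimately show "f + f' \<in> rspace Ind"
    unfolding Ind_iff using IndD(1-3)[OF f] IndD(1-3)[OF f'] space
    by (simp add: complex_vector.subspace_add linear_betweenD(2)[OF lin])
next
  fix c f assume f: "f \<in> rspace Ind"
  have "\<exists>K. subgroup K G \<and> openin T K \<and> (\<forall>g\<in>carrier G. \<forall>k\<in>K. (c *\<^sub>C f) (g \<otimes> k) = (c *\<^sub>C f) g)"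
    using IndD(4)[OF f] by (auto simp: scaleC_fun_def)
  moreover have "(\<lambda>g. H #> g) ` {g \<in> carrier G. (c *\<^sub>C f) g \<noteq> 0} \<subseteq> (\<lambda>g. H #> g) ` {g \<in> carrier G. f g \<noteq> 0}"
    by (auto simp: scaleC_fun_def)
  then have "finite ((\<lambda>g. H #> g) ` {g \<in> carrier G. (c *\<^sub>C f) g \<noteq> 0})"
    by (rule finite_subset) (rule IndD(5)[OF f])
  ultimately show "c *\<^sub>C f \<in> rspace Ind"
    unfolding Ind_iff using IndD(1-3)[OF f] space
    by (simp add: scaleC_fun_def complex_vector.subspace_scale linear_betweenD(3)[OF lin])
qed

lemma act_Ind_closed:
  assumes x: "x \<in> carrier G" and f: "f \<in> rspace Ind"
  shows "act Ind x f \<in> rspace Ind"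
proof -
  obtain K where K: "subgroup K G" "openin T K" "\<And>g k. g \<in> carrier G \<Longrightarrow> k \<in> K \<Longrightarrow> f (g \<otimes> k) = f g"
    using IndD(4)[OF f] by auto
  let ?K = "{y \<in> carrier G. inv x \<otimes> y \<otimes> x \<in> K}"
  have "subgroup ?K G"
  proof (rule subgroupI)
    show "?K \<noteq> {}" using subgroup.one_closed[OF K(1)] x by auto
    fix y assume y: "y \<in> ?K"
    have "inv x \<otimes> inv y \<otimes> x = inv (inv x \<otimes> y \<otimes> x)"
      using x y by (simp add: inv_mult_group m_assoc)
    then show "inv y \<in> ?K" using y subgroup.m_inv_closed[OF K(1)] by simp
    fix z assume z: "z \<in> ?K"
    have "inv x \<otimes> (y \<otimes> z) \<otimes> x = (inv x \<otimes> y \<otimes> x) \<otimes> (inv x \<otimes> z \<otimes> x)"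
      using x y z by (simp add: m_assoc mult_inv_cancel)
    then show "y \<otimes> z \<in> ?K" using y z subgroup.m_closed[OF K(1)] by simp
  qed auto
  moreover have "openin T ?K"
  proof -
    have "?K = {y \<in> carrier G. inv x \<otimes> y \<in> {z \<in> carrier G. z \<otimes> x \<in> K}}" using x by auto
    then show ?thesis
      using left_translation[OF right_translation[OF K(2) x], of "inv x"] x by simp
  qed
  moreover have "act Ind x f (g \<otimes> k) = act Ind x f g" if g: "g \<in> carrier G" and k: "k \<in> ?K" for g k
  proof -
    have "g \<otimes> k \<otimes> x = g \<otimes> x \<otimes> (inv x \<otimes> k \<otimes> x)"
      using g k x by (simp add: m_assoc mult_inv_cancel)
    then show ?thesis using K(3)[of "g \<otimes> x" "inv x \<otimes> k \<otimes> x"] g x k by (simp add: act_Ind)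
  qed
  ultimately have "\<exists>K. subgroup K G \<and> openin T K \<and>
      (\<forall>g\<in>carrier G. \<forall>k\<in>K. act Ind x f (g \<otimes> k) = act Ind x f g)" by blast
  moreover have "finite ((\<lambda>g. H #> g) ` {g \<in> carrier G. act Ind x f g \<noteq> 0})"
  proof -
    have "(\<lambda>g. H #> g) ` {g \<in> carrier G. act Ind x f g \<noteq> 0} \<subseteq>
        (\<lambda>C. C #> inv x) ` (\<lambda>g. H #> g) ` {g \<in> carrier G. f g \<noteq> 0}"
    proof
      fix C assume "C \<in> (\<lambda>g. H #> g) ` {g \<in> carrier G. act Ind x f g \<noteq> 0}"
      then obtain g where g: "g \<in> carrier G" "f (g \<otimes> x) \<noteq> 0" "C = H #> g" by (auto simp: act_Ind)
      have "C = (H #> (g \<otimes> x)) #> inv x"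
        using g(1,3) x subgroup.subset[OF subgroup] by (simp add: coset_mult_assoc m_assoc)
      then show "C \<in> (\<lambda>C. C #> inv x) ` (\<lambda>g. H #> g) ` {g \<in> carrier G. f g \<noteq> 0}"
        using g x by (intro image_eqI[of _ _ "H #> (g \<otimes> x)"]) auto
    qed
    then show ?thesis by (rule finite_subset) (simp add: IndD(5)[OF f])
  qed
  ultimately show ?thesis
    unfolding Ind_iff using IndD(1,3)[OF f] x H_carrier by (simp add: act_Ind m_assoc)
qed

lemma representation_Ind: "representation G (carrier G) Ind"
  unfolding representation_def
proof (intro conjI ballI)
  show "csubspace (rspace Ind)" by (rule subspace_Ind)
  show "linear_between (rspace Ind) (rspace Ind) (act Ind x)" if "x \<in> carrier G" for x
    by (intro linear_betweenI act_Ind_closed[OF that]) (simp_all add: act_Ind fun_eq_iff scaleC_fun_def)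
  show "act Ind \<one> f = f" if "f \<in> rspace Ind" for f
    using IndD(2)[OF that] by (auto simp: act_Ind fun_eq_iff)
  show "act Ind (x \<otimes> y) f = act Ind x (act Ind y f)" if "x \<in> carrier G" "y \<in> carrier G" for x y f
    using that by (auto simp: act_Ind fun_eq_iff m_assoc)
qed

lemma smooth_Ind:
  assumes "subgroup L G" "openin T L"
  shows "smooth T L Ind"
  unfolding smooth_def
proof
  fix f assume f: "f \<in> rspace Ind"
  obtain K where K: "subgroup K G" "openin T K" "\<And>g k. g \<in> carrier G \<Longrightarrow> k \<in> K \<Longrightarrow> f (g \<otimes> k) = f g"
    using IndD(4)[OF f] by auto
  note Lc = subgroup.subset[OF assms(1)]
  note rep_Ind = representation_Ind[unfolded representation_def]
  have one: "act Ind \<one> f = f" using rep_Ind f by blast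
  have comp: "act Ind (h \<otimes> k) f = act Ind h (act Ind k f)" if "h \<in> L" "k \<in> L" for h k
    using rep_Ind f Lc that by blast
  let ?S = "{h \<in> L. act Ind h f = f}"
  have "subgroup ?S G"
  proof (rule subgroupI)
    show "?S \<noteq> {}" using one subgroup.one_closed[OF assms(1)] by blast
    fix h assume h: "h \<in> ?S"
    then have "act Ind (inv h) (act Ind h f) = f"
      using comp[of "inv h" h] one Lc subgroup.m_inv_closed[OF assms(1)] by (simp add: subsetD)
    then show "inv h \<in> ?S" using h subgroup.m_inv_closed[OF assms(1)] by simp
    fix k assume "k \<in> ?S"
    then show "h \<otimes> k \<in> ?S" using h comp subgroup.m_closed[OF assms(1)] by simp
  qed (use Lc in auto)
  moreover have "K \<inter> L \<subseteq> ?S"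
  proof
    fix k assume k: "k \<in> K \<inter> L"
    have "act Ind k f g = f g" for g
      using K(3)[of g k] k IndD(2)[OF f, of g] by (simp add: act_Ind)
    then show "k \<in> ?S" using k by auto
  qed
  ultimately have "openin T ?S"
    using open_subgroup_superset[of ?S "K \<inter> L"] K(1,2) assms
    by (simp add: openin_Int subgroup.one_closed)
  then show "openin (subtopology T L) ?S"
    unfolding openin_subtopology by blast
qed

lemma bump_one: "w \<in> rspace \<sigma> \<Longrightarrow> bump w \<one> = w"
  using act_1 subgroup.one_closed[OF subgroup] by (simp add: bump_def)

lemma bump_in_Ind:
  assumes w: "w \<in> rspace \<sigma>"
  shows "bump w \<in> rspace Ind"
proof -
  let ?K = "{h \<in> H. act \<sigma> h w = w}"
  have "openin T ?K"
    using smooth w unfolding smooth_def by (intro openin_trans_full[OF _ open_H]) simp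
  moreover have "subgroup ?K G"
  proof (rule subgroupI)
    show "?K \<noteq> {}" using act_1[OF w] subgroup.one_closed[OF subgroup] by blast
    fix h assume h: "h \<in> ?K"
    then show "inv h \<in> ?K" using act_inverse(1)[OF _ w, of h] subgroup.m_inv_closed[OF subgroup] by simp
    fix k assume "k \<in> ?K"
    then show "h \<otimes> k \<in> ?K" using h act_comp[OF _ _ w] subgroup.m_closed[OF subgroup] by simp
  qed (use H_carrier in auto)
  moreover have "bump w (g \<otimes> k) = bump w g" if "g \<in> carrier G" "k \<in> ?K" for g k
  proof (cases "g \<in> H")
    case True
    then show ?thesis using that act_comp[OF True _ w] subgroup.m_closed[OF subgroup True] by (simp add: bump_def)
  next
    case False
    have "g \<otimes> k \<notin> H"
    proof
      assume "g \<otimes> k \<in> H"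
      then have "g \<otimes> k \<otimes> inv k \<in> H"
        using that(2) subgroup.m_closed[OF subgroup] subgroup.m_inv_closed[OF subgroup] by simp
      then show False using False that H_carrier by (simp add: m_assoc)
    qed
    then show ?thesis using False by (simp add: bump_def)
  qed
  ultimately have "\<exists>K. subgroup K G \<and> openin T K \<and> (\<forall>g\<in>carrier G. \<forall>k\<in>K. bump w (g \<otimes> k) = bump w g)"
    by blast
  moreover have "(\<lambda>g. H #> g) ` {g \<in> carrier G. bump w g \<noteq> 0} \<subseteq> {H #> \<one>}"
    using coset_eq_iff[of _ \<one>] by (auto simp: bump_def split: if_splits)
  then have "finite ((\<lambda>g. H #> g) ` {g \<in> carrier G. bump w g \<noteq> 0})"
    by (rule finite_subset) simp
  moreover have "bump w (h \<otimes> g) = act \<sigma> h (bump w g)" if h: "h \<in> H" and g: "g \<in> carrier G" for h g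
  proof (cases "g \<in> H")
    case True
    then show ?thesis using act_comp[OF h True w] subgroup.m_closed[OF subgroup h True] by (simp add: bump_def)
  next
    case False
    have "h \<otimes> g \<notin> H"
    proof
      assume "h \<otimes> g \<in> H"
      then have "inv h \<otimes> (h \<otimes> g) \<in> H"
        using h subgroup.m_closed[OF subgroup] subgroup.m_inv_closed[OF subgroup] by simp
      then show False using False h g H_carrier by (simp add: m_assoc[symmetric])
    qed
    then show ?thesis using False act_zero[OF h] by (simp add: bump_def)
  qed
  ultimately show ?thesis
    unfolding Ind_iff using act_closed[OF _ w] H_carrier complex_vector.subspace_0[OF space]
    by (auto simp: bump_def)
qed

lemma bump_add:
  "w \<in> rspace \<sigma> \<Longrightarrow> w' \<in> rspace \<sigma> \<Longrightarrow> bump (w + w') = bump w + bump w'"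
  by (auto simp: bump_def fun_eq_iff linear_betweenD(2)[OF lin])

lemma bump_scale: "w \<in> rspace \<sigma> \<Longrightarrow> bump (c *\<^sub>C w) = c *\<^sub>C bump w"
  by (auto simp: bump_def fun_eq_iff scaleC_fun_def linear_betweenD(3)[OF lin])

lemma act_Ind_bump:
  assumes "h \<in> H" "w \<in> rspace \<sigma>"
  shows "act Ind h (bump w) = bump (act \<sigma> h w)"
proof
  fix g
  show "act Ind h (bump w) g = bump (act \<sigma> h w) g"
  proof (cases "g \<in> H")
    case True
    then show ?thesis
      using act_comp[OF True assms] subgroup.m_closed[OF subgroup True assms(1)] H_carrier
      by (simp add: act_Ind bump_def)
  next
    case False
    have "g \<otimes> h \<notin> H" if "g \<in> carrier G"
    proof
      assume "g \<otimes> h \<in> H"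
      then have "g \<otimes> h \<otimes> inv h \<in> H"
        using assms(1) subgroup.m_closed[OF subgroup] subgroup.m_inv_closed[OF subgroup] by simp
      then show False using False that assms(1) H_carrier by (simp add: m_assoc)
    qed
    then show ?thesis using False by (simp add: act_Ind bump_def)
  qed
qed

lemma supported_on_subgroup:
  assumes "f \<in> rspace Ind" "\<And>g. g \<in> carrier G \<Longrightarrow> g \<notin> H \<Longrightarrow> f g = 0"
  shows "f = bump (f \<one>)"
proof
  fix g
  show "f g = bump (f \<one>) g"
  proof (cases "g \<in> H")
    case True
    then show ?thesis using IndD(3)[OF assms(1) True, of \<one>] H_carrier by (simp add: bump_def)
  next
    case False
    then show ?thesis using assms(2) IndD(2)[OF assms(1)] by (auto simp: bump_def)
  qed
qed

text \<open>The support of \<open>f\<close> consists of finitely many cosets \<open>H r\<close>, and the restriction of \<open>f\<close> to \<open>H r\<close> is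
  the translate of a function supported on \<open>H\<close>.\<close>

lemma Ind_decomposition:
  assumes f: "f \<in> rspace Ind"
  shows "\<exists>R. finite R \<and> R \<subseteq> carrier G \<and> (\<forall>r\<in>R. f r \<noteq> 0) \<and>
    f = (\<Sum>r\<in>R. act Ind (inv r) (bump (f r)))"
proof -
  let ?q = "\<lambda>g. H #> g" and ?S = "{g \<in> carrier G. f g \<noteq> 0}"
  obtain R where R: "R \<subseteq> ?S" "inj_on ?q R" "?q ` ?S = ?q ` R"
    using subset_image_inj[of "?q ` ?S" ?q ?S] by auto
  have fin: "finite R" using IndD(5)[OF f] R(2,3) by (metis finite_imageD)
  have "f g = (\<Sum>r\<in>R. act Ind (inv r) (bump (f r))) g" for g
  proof (cases "g \<in> carrier G")
    case g: True
    have summand: "act Ind (inv r) (bump (f r)) g = (if ?q g = ?q r then f g else 0)" if "r \<in> R" for r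
    proof -
      have r: "r \<in> carrier G" using that R(1) by blast
      have "f g = act \<sigma> (g \<otimes> inv r) (f r)" if "g \<otimes> inv r \<in> H"
        using IndD(3)[OF f that r] g r by (simp add: m_assoc)
      then show ?thesis using coset_eq_iff[OF g r] g by (simp add: act_Ind bump_def)
    qed
    have "(\<Sum>r\<in>R. act Ind (inv r) (bump (f r))) g = (\<Sum>r\<in>R. if ?q g = ?q r then f g else 0)"
      unfolding sum_fun_apply using summand by (intro sum.cong) auto
    also have "\<dots> = f g"
    proof (cases "f g = 0")
      case True
      then show ?thesis by (simp cong: if_cong)
    next
      case False
      then have "?q g \<in> ?q ` R" using R(3) g by blast
      then obtain r where r: "r \<in> R" "?q g = ?q r" by blast
      then have "(\<Sum>r\<in>R. if ?q g = ?q r then f g else 0) = (\<Sum>s\<in>R. if s = r then f g else 0)"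
        using inj_onD[OF R(2)] by (intro sum.cong) auto
      then show ?thesis using r(1) fin by simp
    qed
    finally show ?thesis by simp
  next
    case False
    then show ?thesis using IndD(2)[OF f] by (simp add: sum_fun_apply act_Ind)
  qed
  then have "f = (\<Sum>r\<in>R. act Ind (inv r) (bump (f r)))" by (rule ext)
  moreover have "R \<subseteq> carrier G" "\<forall>r\<in>R. f r \<noteq> 0" using R(1) by blast+
  ultimately show ?thesis using fin by blast
qed

end

section \<open>Sections of equivariant maps for compact groups\<close>

text \<open>If \<open>f\<close> factors through \<open>g\<close> on \<open>S\<close>, the image of \<open>f\<close> is not larger than that of \<open>g\<close>.\<close>

lemma finite_image_factor:
  assumes "finite (g ` S)" "\<And>x y. x \<in> S \<Longrightarrow> y \<in> S \<Longrightarrow> g x = g y \<Longrightarrow> f x = f y"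
  shows "finite (f ` S)"
proof -
  have "f ` S \<subseteq> (\<lambda>z. f (inv_into S g z)) ` g ` S"
  proof
    fix y assume "y \<in> f ` S"
    then obtain x where x: "x \<in> S" "y = f x" by blast
    have "inv_into S g (g x) \<in> S" "g (inv_into S g (g x)) = g x"
      using x(1) by (simp_all add: inv_into_into f_inv_into_f)
    from assms(2)[OF this(1) x(1) this(2)] have "y = f (inv_into S g (g x))" using x(2) by simp
    then show "y \<in> (\<lambda>z. f (inv_into S g z)) ` g ` S" using x(1) by blast
  qed
  then show ?thesis by (rule finite_subset[OF _ finite_imageI[OF assms(1)]])
qed

lemma linear_section:
  fixes e :: "'v::complex_vector \<Rightarrow> 'w::complex_vector"
  assumes Y: "csubspace Y" and e: "linear_between Y W e" and surj: "e ` Y = W"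
  shows "\<exists>s. linear_between W Y s \<and> (\<forall>w\<in>W. e (s w) = w)"
proof -
  interpret pair: vector_space_pair "scaleC :: complex \<Rightarrow> 'w \<Rightarrow> 'w" "scaleC :: complex \<Rightarrow> 'v \<Rightarrow> 'v" ..
  have W: "csubspace W" using subspace_image_linear_between[OF e Y] surj by simp
  obtain C where C: "C \<subseteq> W" "complex_vector.independent C" "W \<subseteq> cspan C"
    using complex_vector.maximal_independent_subset[of W] by blast
  have lift: "\<exists>y. y \<in> Y \<and> e y = c" if "c \<in> C" for c using that C(1) surj by blast
  define r where "r c = (SOME y. y \<in> Y \<and> e y = c)" for c
  have r: "r c \<in> Y" "e (r c) = c" if "c \<in> C" for c
    using someI_ex[OF lift[OF that]] by (simp_all add: r_def)
  obtain s where s: "Vector_Spaces.linear scaleC scaleC s" "\<And>c. c \<in> C \<Longrightarrow> s c = r c"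
    using pair.linear_independent_extend[OF C(2), of r] by blast
  interpret s: Vector_Spaces.linear scaleC scaleC s by (rule s(1))
  have lin_s: "linear_between UNIV UNIV s"
    by (intro linear_betweenI) (simp_all add: s.add s.scale)
  have sY: "s w \<in> Y" if "w \<in> W" for w
    by (rule linear_between_span_subset[OF lin_s _ _ _ Y subsetD[OF C(3) that]]) (simp_all add: s r)
  have "e (s w) - w \<in> {0}" if "w \<in> W" for w
  proof (rule linear_between_span_subset[where f = "\<lambda>w. e (s w) - w" and V = W and W = UNIV and S = C])
    show "linear_between W UNIV (\<lambda>w. e (s w) - w)"
      by (intro linear_betweenI) (simp_all add: s.add s.scale linear_betweenD[OF e] sY complex_vector.scale_right_diff_distrib)
  qed (use W C s(2) r that in auto)
  then have "\<forall>w\<in>W. e (s w) = w" by simp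
  moreover have "linear_between W Y s"
    using sY by (intro linear_betweenI) (simp_all add: s.add s.scale)
  ultimately show ?thesis by blast
qed

context translation_group
begin

text \<open>Averaging a linear section over the compact group \<open>J\<close> makes it equivariant. By smoothness \<open>J\<close> acts
  through a finite quotient on the span of the orbit of \<open>x\<close>, so that the conjugates of the linear
  section by the elements of \<open>J\<close> form a finite set, which takes the place of an integral.\<close>

lemma equivariant_section:
  fixes \<sigma> :: "('a, 'v::complex_vector) rep" and \<tau> :: "('a, 'w::complex_vector) rep"
  assumes J: "subgroup J G" "openin T J" "compactin T J"
    and \<sigma>: "representation G J \<sigma>" "smooth T J \<sigma>"
    and \<tau>: "representation G J \<tau>" "irreducible_rep J \<tau>"
    and e: "equivariant J \<sigma> \<tau> e" and x: "x \<in> rspace \<sigma>" "e x \<noteq> 0"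
  shows "\<exists>s. equivariant J \<tau> \<sigma> s \<and> (\<forall>w\<in>rspace \<tau>. e (s w) = w)"
proof -
  let ?V = "rspace \<sigma>" and ?W = "rspace \<tau>"
  note lin\<sigma> = representation_linear_action[OF \<sigma>(1)] and lin\<tau> = representation_linear_action[OF \<tau>(1)]
  note V = linear_actionD(1)[OF lin\<sigma>] and W = linear_actionD(1)[OF lin\<tau>]
  note actV = linear_actionD(2)[OF lin\<sigma>] and actW = linear_actionD(2)[OF lin\<tau>]
  have oneV: "act \<sigma> \<one> y = y" if "y \<in> ?V" for y using \<sigma>(1) that by (simp add: representation_def)
  have oneW: "act \<tau> \<one> y = y" if "y \<in> ?W" for y using \<tau>(1) that by (simp add: representation_def)
  have compV: "act \<sigma> (h \<otimes> k) y = act \<sigma> h (act \<sigma> k y)" if "h \<in> J" "k \<in> J" "y \<in> ?V" for h k y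
    using \<sigma>(1) that by (simp add: representation_def)
  have compW: "act \<tau> (h \<otimes> k) y = act \<tau> h (act \<tau> k y)" if "h \<in> J" "k \<in> J" "y \<in> ?W" for h k y
    using \<tau>(1) that by (simp add: representation_def)
  have Jc: "h \<in> carrier G" if "h \<in> J" for h using subgroup.subset[OF J(1)] that by blast
  have Ji: "inv h \<in> J" if "h \<in> J" for h using subgroup.m_inv_closed[OF J(1) that] .
  have Jm: "h \<otimes> k \<in> J" if "h \<in> J" "k \<in> J" for h k using subgroup.m_closed[OF J(1) that] .
  have actVc: "act \<sigma> h y \<in> ?V" if "h \<in> J" "y \<in> ?V" for h y using linear_betweenD(1)[OF actV] that .
  have actWc: "act \<tau> h y \<in> ?W" if "h \<in> J" "y \<in> ?W" for h y using linear_betweenD(1)[OF actW] that .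
  define Orb where "Orb = (\<lambda>h. act \<sigma> h x) ` J"
  have finO: "finite Orb"
    unfolding Orb_def using J(1,2) \<sigma> x(1) J(3) by (rule finite_orbit)
  have OV: "Orb \<subseteq> ?V" using actVc x(1) by (auto simp: Orb_def)
  have Oact: "act \<sigma> h y \<in> Orb" if "h \<in> J" "y \<in> Orb" for h y
    using that compV[OF that(1) _ x(1), symmetric] Jm by (auto simp: Orb_def)
  let ?Y = "cspan Orb"
  have YV: "?Y \<subseteq> ?V" using OV V by (rule complex_vector.span_minimal)
  have Yact: "act \<sigma> h y \<in> ?Y" if "h \<in> J" "y \<in> ?Y" for h y
    using linear_between_span_subset[OF actV[OF that(1)] V OV _ _ that(2), of ?Y] Oact[OF that(1)]
    by (simp add: complex_vector.span_base)
  have subY: "subrep J ?Y \<sigma>" using YV Yact by (auto simp: subrep_def)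
  have eY: "equivariant J (\<sigma>\<lparr>rspace := ?Y\<rparr>) \<tau> e" using e YV by (rule equivariant_subspace)
  have "subrep J (e ` ?Y) \<tau>"
    using subrep_image[OF linear_action_subrep[OF lin\<sigma> subY] eY] by simp
  moreover have "e ` ?Y \<noteq> {0}"
  proof -
    have "x \<in> Orb" using oneV[OF x(1)] subgroup.one_closed[OF J(1)] by (force simp: Orb_def)
    then have "e x \<in> e ` ?Y" by (simp add: complex_vector.span_base)
    then show ?thesis using x(2) by auto
  qed
  ultimately have surj: "e ` ?Y = ?W"
    using conjunct2[OF \<tau>(2)[unfolded irreducible_rep_def], rule_format, of "e ` ?Y"] by simp
  note elin = equivariantD(1)[OF eY, simplified]
  obtain s0 where s0: "linear_between ?W ?Y s0" "\<And>w. w \<in> ?W \<Longrightarrow> e (s0 w) = w"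
    using linear_section[OF _ elin surj] by auto
  define F where "F j = restrict (\<lambda>w. act \<sigma> j (s0 (act \<tau> (inv j) w))) ?W" for j
  define \<F> where "\<F> = F ` J"
  have F: "F j w = act \<sigma> j (s0 (act \<tau> (inv j) w))" if "w \<in> ?W" for j w using that by (simp add: F_def)
  \<comment> \<open>\<open>F j\<close> depends only on the permutations of the finite orbit induced by \<open>j\<close> and its inverse.\<close>
  have finF: "finite \<F>"
  proof -
    let ?g = "\<lambda>j. (restrict (act \<sigma> j) Orb, restrict (act \<sigma> (inv j)) Orb)"
    have "?g ` J \<subseteq> (Pi\<^sub>E Orb (\<lambda>_. Orb)) \<times> (Pi\<^sub>E Orb (\<lambda>_. Orb))"
      using Oact Ji by auto
    moreover have "finite ((Pi\<^sub>E Orb (\<lambda>_. Orb)) \<times> (Pi\<^sub>E Orb (\<lambda>_. Orb)))"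
      using finO by (intro finite_cartesian_product finite_PiE)
    ultimately have fin_g: "finite (?g ` J)" by (rule finite_subset)
    have same: "F j = F k" if jk: "j \<in> J" "k \<in> J" and eq: "?g j = ?g k" for j k
    proof -
      have agree: "act \<sigma> a y = act \<sigma> b y"
        if "a \<in> J" "b \<in> J" and ab: "restrict (act \<sigma> a) Orb = restrict (act \<sigma> b) Orb" and y: "y \<in> ?Y" for a b y
      proof -
        have "act \<sigma> a y - act \<sigma> b y \<in> {0}"
        proof (rule linear_between_span_subset[where f = "\<lambda>y. act \<sigma> a y - act \<sigma> b y" and V = ?V and W = UNIV and S = Orb])
          show "linear_between ?V UNIV (\<lambda>y. act \<sigma> a y - act \<sigma> b y)"
            using that(1,2) by (intro linear_betweenI) (simp_all add: linear_betweenD[OF actV] complex_vector.scale_right_diff_distrib)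
          show "act \<sigma> a y - act \<sigma> b y \<in> {0}" if "y \<in> Orb" for y
            using fun_cong[OF ab, of y] that by simp
        qed (use V OV y in auto)
        then show ?thesis by simp
      qed
      have eq1: "restrict (act \<sigma> j) Orb = restrict (act \<sigma> k) Orb"
        and eq2: "restrict (act \<sigma> (inv j)) Orb = restrict (act \<sigma> (inv k)) Orb"
        using eq by (simp_all only: prod.inject)
      show "F j = F k"
        unfolding F_def
      proof (rule restrict_ext)
        fix w assume w: "w \<in> ?W"
        have "w \<in> e ` ?Y" using w surj by simp
        then obtain y where y: "w = e y" "y \<in> ?Y" by (rule imageE)
        have push: "act \<tau> (inv i) w = e (act \<sigma> (inv i) y)" if "i \<in> J" for i
          using equivariantD(2)[OF e Ji[OF that] subsetD[OF YV y(2)]] y(1) by simp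
        have "act \<tau> (inv j) w = act \<tau> (inv k) w"
          unfolding push[OF jk(1)] push[OF jk(2)] agree[OF Ji[OF jk(1)] Ji[OF jk(2)] eq2 y(2)] ..
        moreover have "s0 (act \<tau> (inv k) w) \<in> ?Y"
          using linear_betweenD(1)[OF s0(1) actWc[OF Ji[OF jk(2)] w]] .
        ultimately show "act \<sigma> j (s0 (act \<tau> (inv j) w)) = act \<sigma> k (s0 (act \<tau> (inv k) w))"
          using agree[OF jk eq1] by simp
      qed
    qed
    show ?thesis unfolding \<F>_def by (rule finite_image_factor[OF fin_g same])
  qed
  have neF: "\<F> \<noteq> {}" using subgroup.one_closed[OF J(1)] by (auto simp: \<F>_def)
  have linF: "linear_between ?W ?V A" if A: "A \<in> \<F>" for A
  proof -
    obtain j where j: "j \<in> J" "A = F j" using A by (auto simp: \<F>_def)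
    have in_Y: "s0 (act \<tau> (inv j) w) \<in> ?V" if "w \<in> ?W" for w
      using linear_betweenD(1)[OF s0(1) actWc[OF Ji[OF j(1)] that]] YV by blast
    show ?thesis
      unfolding j(2)
      using W by (intro linear_betweenI)
        (simp_all add: F in_Y actVc j(1) Ji actWc linear_betweenD(2,3)[OF actW] linear_betweenD(2,3)[OF s0(1)]
          linear_betweenD(2,3)[OF actV] complex_vector.subspace_add complex_vector.subspace_scale)
  qed
  have eF: "e (A w) = w" if A: "A \<in> \<F>" and w: "w \<in> ?W" for A w
  proof -
    obtain j where j: "j \<in> J" "A = F j" using A by (auto simp: \<F>_def)
    have iw: "act \<tau> (inv j) w \<in> ?W" using actWc Ji j(1) w by blast
    have "s0 (act \<tau> (inv j) w) \<in> ?V" using linear_betweenD(1)[OF s0(1) iw] YV by blast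
    then have "e (A w) = act \<tau> j (act \<tau> (inv j) w)"
      using equivariantD(2)[OF e j(1)] s0(2)[OF iw] by (simp add: j(2) F w)
    also have "\<dots> = w"
      using compW[OF j(1) Ji[OF j(1)] w] oneW[OF w] Jc[OF j(1)] by simp
    finally show ?thesis .
  qed
  define \<Phi> where "\<Phi> i A = restrict (\<lambda>w. act \<sigma> i (A (act \<tau> (inv i) w))) ?W" for i A
  have \<Phi>F: "\<Phi> i (F j) = F (i \<otimes> j)" if "i \<in> J" "j \<in> J" for i j
    unfolding \<Phi>_def F_def
  proof (rule restrict_ext)
    fix w assume w: "w \<in> ?W"
    note c = Jc[OF that(1)] Jc[OF that(2)]
    have iw: "act \<tau> (inv i) w \<in> ?W" using actWc Ji that(1) w by blast
    have eq: "act \<tau> (inv j) (act \<tau> (inv i) w) = act \<tau> (inv (i \<otimes> j)) w"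
      using compW[OF Ji[OF that(2)] Ji[OF that(1)] w] c by (simp add: inv_mult_group)
    have "s0 (act \<tau> (inv (i \<otimes> j)) w) \<in> ?V"
      using linear_betweenD(1)[OF s0(1) actWc[OF Ji[OF Jm[OF that]] w]] YV by blast
    then show "act \<sigma> i (restrict (\<lambda>w. act \<sigma> j (s0 (act \<tau> (inv j) w))) ?W (act \<tau> (inv i) w)) =
        act \<sigma> (i \<otimes> j) (s0 (act \<tau> (inv (i \<otimes> j)) w))"
      using iw eq compV[OF that] by simp
  qed
  have bij: "bij_betw (\<Phi> i) \<F> \<F>" if i: "i \<in> J" for i
  proof (rule bij_betw_byWitness[where f' = "\<Phi> (inv i)"])
    show "\<forall>A\<in>\<F>. \<Phi> (inv i) (\<Phi> i A) = A" "\<forall>A\<in>\<F>. \<Phi> i (\<Phi> (inv i) A) = A"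
      using i by (auto simp: \<F>_def \<Phi>F Ji Jm Jc m_assoc[symmetric])
    show "\<Phi> i ` \<F> \<subseteq> \<F>" "\<Phi> (inv i) ` \<F> \<subseteq> \<F>"
      using i by (auto simp: \<F>_def \<Phi>F Ji Jm)
  qed
  define s where "s w = (1 / of_nat (card \<F>)) *\<^sub>C (\<Sum>A\<in>\<F>. A w)" for w
  have sumV: "(\<Sum>A\<in>\<F>. A w) \<in> ?V" if "w \<in> ?W" for w
    using linear_betweenD(1)[OF linF that] by (intro complex_vector.subspace_sum[OF V]) auto
  have "linear_between ?W ?V s"
  proof (rule linear_betweenI)
    show "s w \<in> ?V" if "w \<in> ?W" for w
      unfolding s_def using sumV[OF that] V by (simp add: complex_vector.subspace_scale)
    show "s (w + w') = s w + s w'" if "w \<in> ?W" "w' \<in> ?W" for w w'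
    proof -
      have "(\<Sum>A\<in>\<F>. A (w + w')) = (\<Sum>A\<in>\<F>. A w + A w')"
        by (rule sum.cong[OF refl]) (rule linear_betweenD(2)[OF linF that])
      then show ?thesis by (simp add: s_def sum.distrib scaleC_add_right)
    qed
    show "s (c *\<^sub>C w) = c *\<^sub>C s w" if "w \<in> ?W" for c w
    proof -
      have "(\<Sum>A\<in>\<F>. A (c *\<^sub>C w)) = (\<Sum>A\<in>\<F>. c *\<^sub>C A w)"
        by (rule sum.cong[OF refl]) (rule linear_betweenD(3)[OF linF that])
      also have "\<dots> = c *\<^sub>C (\<Sum>A\<in>\<F>. A w)" by (rule complex_vector.scale_sum_right[symmetric])
      finally show ?thesis by (simp add: s_def scaleC_scaleC mult.commute)
    qed
  qed
  moreover have "s (act \<tau> i w) = act \<sigma> i (s w)" if i: "i \<in> J" and w: "w \<in> ?W" for i w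
  proof -
    have "act \<sigma> i (s w) = (1 / of_nat (card \<F>)) *\<^sub>C (\<Sum>A\<in>\<F>. act \<sigma> i (A w))"
      unfolding s_def using linear_betweenD(3)[OF actV[OF i] sumV[OF w]]
        linear_between_sum[OF actV[OF i] V, of \<F> "\<lambda>A. A w"] linear_betweenD(1)[OF linF w] by simp
    also have "(\<Sum>A\<in>\<F>. act \<sigma> i (A w)) = (\<Sum>A\<in>\<F>. \<Phi> i A (act \<tau> i w))"
    proof (rule sum.cong[OF refl])
      fix A assume "A \<in> \<F>"
      have "act \<tau> (inv i) (act \<tau> i w) = w"
        using compW[OF Ji[OF i] i w] oneW[OF w] Jc[OF i] by simp
      then show "act \<sigma> i (A w) = \<Phi> i A (act \<tau> i w)" using actWc[OF i w] by (simp add: \<Phi>_def)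
    qed
    also have "\<dots> = (\<Sum>A\<in>\<F>. A (act \<tau> i w))"
      using sum.reindex_bij_betw[OF bij[OF i], of "\<lambda>A. A (act \<tau> i w)"] .
    finally show ?thesis by (simp add: s_def)
  qed
  moreover have "e (s w) = w" if w: "w \<in> ?W" for w
  proof -
    note el = equivariantD(1)[OF e]
    have "e (s w) = (1 / of_nat (card \<F>)) *\<^sub>C (\<Sum>A\<in>\<F>. e (A w))"
      unfolding s_def using linear_betweenD(3)[OF el sumV[OF w]]
        linear_between_sum[OF el V, of \<F> "\<lambda>A. A w"] linear_betweenD(1)[OF linF w] by simp
    also have "(\<Sum>A\<in>\<F>. e (A w)) = of_nat (card \<F>) *\<^sub>C w"
      using eF[OF _ w] by (simp add: complex_vector.sum_constant_scale)
    finally show ?thesis using finF neF by (simp add: scaleC_scaleC scaleC_one)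
  qed
  ultimately show ?thesis unfolding equivariant_def by blast
qed

end

section \<open>Cuspidal data\<close>

text \<open>The translates of \<open>W\<close> span a subrepresentation.\<close>

lemma (in clifford) span_translates:
  assumes "irreducible_rep P \<sigma>" "W \<subseteq> rspace \<sigma>" "\<not> W \<subseteq> {0}"
  shows "cspan (\<Union>p\<in>P. act \<sigma> p ` W) = rspace \<sigma>"
proof -
  let ?U = "\<Union>p\<in>P. act \<sigma> p ` W"
  note V = linear_actionD(1)[OF linear_action]
  have U: "?U \<subseteq> rspace \<sigma>"
    using linear_betweenD(1)[OF act_linear] assms(2) by blast
  have move: "act \<sigma> q u \<in> ?U" if q: "q \<in> P" and u: "u \<in> ?U" for q u
  proof -
    obtain p w where pw: "p \<in> P" "w \<in> W" "u = act \<sigma> p w" using u by blast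
    have "act \<sigma> q u = act \<sigma> (q \<otimes>\<^bsub>G\<^esub> p) w"
      using act_mult[OF q pw(1)] pw(2,3) assms(2) by auto
    then show ?thesis using subgroup.m_closed[OF subgroup q pw(1)] pw(2) by blast
  qed
  have "act \<sigma> q x \<in> cspan ?U" if "q \<in> P" "x \<in> cspan ?U" for q x
  proof (rule linear_between_span_subset[OF act_linear[OF that(1)] V U _ _ that(2)])
    show "act \<sigma> q u \<in> cspan ?U" if "u \<in> ?U" for u
      using move[OF \<open>q \<in> P\<close> that] by (rule complex_vector.span_base)
  qed (rule complex_vector.subspace_span)
  moreover have "cspan ?U \<subseteq> rspace \<sigma>" using U V by (rule complex_vector.span_minimal)
  ultimately have "subrep P (cspan ?U) \<sigma>" by (auto simp: subrep_def)
  moreover have "cspan ?U \<noteq> {0}"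
  proof -
    obtain w where w: "w \<in> W" "w \<noteq> 0" using assms(3) by blast
    have "act \<sigma> \<one>\<^bsub>G\<^esub> w \<in> ?U" using w(1) subgroup.one_closed[OF subgroup] by blast
    then have "w \<in> ?U" using act_one[OF subsetD[OF assms(2) w(1)]] by simp
    then have "w \<in> cspan ?U" by (rule complex_vector.span_base)
    then show ?thesis using w(2) by blast
  qed
  ultimately show ?thesis
    using conjunct2[OF assms(1)[unfolded irreducible_rep_def], rule_format, of "cspan ?U"] by blast
qed

text \<open>The map \<open>\<iota>\<close> realises \<open>\<rho>\<close> as a subrepresentation of the restriction of \<open>\<rho>t\<close> to \<open>J\<close>, and the condition on commutators
  says that \<open>G / B\<close> is abelian.\<close>

locale cuspidal_data = translation_group G T for G (structure) and T +
  fixes B J Jt :: "'a set" and \<rho> \<rho>t :: "('a, 'v::complex_vector) rep" and \<iota> :: "'v \<Rightarrow> 'v"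
  assumes B_normal: "B \<lhd> G"
    and commutators: "g \<in> carrier G \<Longrightarrow> h \<in> carrier G \<Longrightarrow> g \<otimes> h \<otimes> inv g \<otimes> inv h \<in> B"
    and Jt_subgroup: "subgroup Jt G" and Jt_open: "openin T Jt"
    and J_eq: "J = Jt \<inter> B" and J_open: "openin T J" and J_compact: "compactin T J"
    and \<rho>_Irr: "\<rho> \<in> Irr G T J" and \<rho>t_Irr: "\<rho>t \<in> Irr G T Jt"
    and \<iota>_equivariant: "equivariant J \<rho> \<rho>t \<iota>" and \<iota>_inj: "inj_on \<iota> (rspace \<rho>)"
    and intertwining_\<rho>: "intertwining G J \<rho> \<subseteq> Jt"
begin

lemma B_subgroup: "subgroup B G"
  using B_normal by (rule normal_imp_subgroup)

lemma J_subgroup: "subgroup J G"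
  unfolding J_eq using Jt_subgroup B_subgroup by (rule subgroups_Inter_pair)

lemma J_Jt: "j \<in> J \<Longrightarrow> j \<in> Jt" and J_B: "j \<in> J \<Longrightarrow> j \<in> B"
  by (simp_all add: J_eq)

lemma Jt_carrier: "g \<in> Jt \<Longrightarrow> g \<in> carrier G"
  using subgroup.subset[OF Jt_subgroup] by blast

lemma B_carrier: "b \<in> B \<Longrightarrow> b \<in> carrier G"
  using subgroup.subset[OF B_subgroup] by blast

lemma J_carrier: "j \<in> J \<Longrightarrow> j \<in> carrier G"
  using Jt_carrier J_Jt by blast

lemmas Jt_mult = subgroup.m_closed[OF Jt_subgroup] and Jt_inv = subgroup.m_inv_closed[OF Jt_subgroup]
  and B_mult = subgroup.m_closed[OF B_subgroup] and B_inv = subgroup.m_inv_closed[OF B_subgroup]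

lemma B_conj: "g \<in> carrier G \<Longrightarrow> b \<in> B \<Longrightarrow> g \<otimes> b \<otimes> inv g \<in> B"
  using normal.inv_op_closed2[OF B_normal] .

lemma B_conj': "g \<in> carrier G \<Longrightarrow> b \<in> B \<Longrightarrow> inv g \<otimes> b \<otimes> g \<in> B"
  using normal.inv_op_closed1[OF B_normal] .

lemma J_conj: "g \<in> Jt \<Longrightarrow> j \<in> J \<Longrightarrow> g \<otimes> j \<otimes> inv g \<in> J"
  using B_conj[of g j] by (simp add: J_eq Jt_carrier Jt_mult Jt_inv)

lemma J_conj': "g \<in> Jt \<Longrightarrow> j \<in> J \<Longrightarrow> inv g \<otimes> j \<otimes> g \<in> J"
  using B_conj'[of g j] by (simp add: J_eq Jt_carrier Jt_mult Jt_inv)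

lemma J_commutator: "g \<in> Jt \<Longrightarrow> h \<in> Jt \<Longrightarrow> g \<otimes> h \<otimes> inv g \<otimes> inv h \<in> J"
  using commutators[of g h] by (simp add: J_eq Jt_carrier Jt_mult Jt_inv)

lemma \<rho>_rep: "representation G J \<rho>" "smooth T J \<rho>" "irreducible_rep J \<rho>"
  using \<rho>_Irr by (simp_all add: Irr_def)

lemma \<rho>t_rep: "representation G Jt \<rho>t" "smooth T Jt \<rho>t" "irreducible_rep Jt \<rho>t"
  using \<rho>t_Irr by (simp_all add: Irr_def)

sublocale small: inducible G T J \<rho>
  by (rule inducible.intro[OF translation_group_axioms inducible_axioms.intro])
    (rule J_subgroup J_open \<rho>_rep)+

sublocale big: inducible G T Jt \<rho>t
  by (rule inducible.intro[OF translation_group_axioms inducible_axioms.intro])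
    (rule Jt_subgroup Jt_open \<rho>t_rep)+

sublocale restriction: clifford G Jt J \<rho>t
  by (rule clifford.intro[OF group_axioms Jt_subgroup _ _ \<rho>t_rep(1)]) (simp_all add: J_Jt J_conj' subsetI)

abbreviation \<pi> :: "('a, 'a \<Rightarrow> 'v) rep"
  where "\<pi> \<equiv> compact_induction G T Jt \<rho>t"

definition W0 :: "'v set"
  where "W0 = \<iota> ` rspace \<rho>"

lemma \<rho>_linear_action: "linear_action J \<rho>"
  using \<rho>_rep(1) by (rule representation_linear_action)

lemma W0_irreducible: "irreducible_subrep J \<rho>t W0"
  unfolding W0_def
  using irreducible_subrep_image[OF \<rho>_linear_action \<rho>_rep(3) restriction.linear_action \<iota>_equivariant \<iota>_inj] .

lemma W0_sub: "W0 \<subseteq> rspace \<rho>t" and W0_subspace: "csubspace W0"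
  and W0_act: "j \<in> J \<Longrightarrow> w \<in> W0 \<Longrightarrow> act \<rho>t j w \<in> W0"
  using subrepD[OF irreducible_subrepD(1)[OF W0_irreducible]] by auto

lemma span_translates_W0: "cspan (\<Union>p\<in>Jt. act \<rho>t p ` W0) = rspace \<rho>t"
  using restriction.span_translates[OF \<rho>t_rep(3) W0_sub irreducible_subrep_nonzero[OF W0_irreducible]] .

definition \<iota>_inv :: "'v \<Rightarrow> 'v"
  where "\<iota>_inv = inv_into (rspace \<rho>) \<iota>"

lemma \<iota>_inv_equivariant: "equivariant J (\<rho>t\<lparr>rspace := W0\<rparr>) \<rho> \<iota>_inv"
  unfolding \<iota>_inv_def W0_def using \<rho>_linear_action \<iota>_equivariant \<iota>_inj by (rule equivariant_inv_into)

lemma \<iota>_inv_\<iota>: "w \<in> rspace \<rho> \<Longrightarrow> \<iota>_inv (\<iota> w) = w" and \<iota>_\<iota>_inv: "w \<in> W0 \<Longrightarrow> \<iota> (\<iota>_inv w) = w"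
  using \<iota>_inj by (simp_all add: \<iota>_inv_def W0_def f_inv_into_f)

lemma \<iota>_in_W0: "w \<in> rspace \<rho> \<Longrightarrow> \<iota> w \<in> W0"
  by (simp add: W0_def)

text \<open>If \<open>a\<close> is nonzero, composing it with the projection of \<open>\<rho>t\<close> to a suitable translate of \<open>W0\<close>
  by an element \<open>k\<close> of \<open>Jt\<close> gives an element of the intertwining set of \<open>\<rho>\<close>, namely \<open>g\<^sup>-\<^sup>1 k\<close>. This is where the
  hypothesis on the intertwining of \<open>\<rho>\<close> enters.\<close>

lemma intertwiner_support:
  assumes a: "linear_between (rspace \<rho>) (rspace \<rho>t) a" and g: "g \<in> carrier G"
    and tw: "\<And>j w. j \<in> J \<Longrightarrow> g \<otimes> j \<otimes> inv g \<in> J \<Longrightarrow> w \<in> rspace \<rho> \<Longrightarrow>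
      a (act \<rho> j w) = act \<rho>t (g \<otimes> j \<otimes> inv g) (a w)"
    and w: "w \<in> rspace \<rho>" "a w \<noteq> 0"
  shows "g \<in> Jt"
proof -
  note act\<rho>t = restriction.act_linear
  let ?\<W> = "(\<lambda>p. act \<rho>t p ` W0) ` Jt"
  have "subrep J {0} \<rho>t" using subrep_span[OF restriction.linear_action, of "{}"] by simp
  moreover have "rspace \<rho>t \<subseteq> cspan ({0} \<union> \<Union>?\<W>)"
    using span_translates_W0 complex_vector.span_mono[of "\<Union>?\<W>" "{0} \<union> \<Union>?\<W>"] by auto
  moreover have "irreducible_subrep J \<rho>t W" if "W \<in> ?\<W>" for W
    using that restriction.translate_irreducible[OF _ W0_irreducible] by auto
  moreover have aw: "a w \<in> rspace \<rho>t" "a w \<notin> {0}" using linear_betweenD(1)[OF a w(1)] w(2) by auto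
  ultimately have "\<exists>W\<in>?\<W>. \<exists>p. equivariant J \<rho>t (\<rho>t\<lparr>rspace := W\<rparr>) p \<and> (\<forall>a\<in>{0}. p a = 0) \<and> p (a w) \<noteq> 0"
    by (intro semisimple_separation[OF restriction.linear_action])
  then obtain k p where k: "k \<in> Jt" and p: "equivariant J \<rho>t (\<rho>t\<lparr>rspace := act \<rho>t k ` W0\<rparr>) p"
    and pw: "p (a w) \<noteq> 0" by auto
  note plin = linear_betweenD[OF equivariantD(1)[OF p, simplified]]
  define c where "c u = act \<rho>t (inv k) (p (a u))" for u
  note ki = Jt_inv[OF k]
  have pV: "p (a u) \<in> rspace \<rho>t" if u: "u \<in> rspace \<rho>" for u
  proof -
    obtain v where "v \<in> W0" "p (a u) = act \<rho>t k v"
      using plin(1)[OF linear_betweenD(1)[OF a u]] by blast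
    then show ?thesis using big.act_closed[OF k] W0_sub by auto
  qed
  have c_W0: "c u \<in> W0" if u: "u \<in> rspace \<rho>" for u
  proof -
    obtain v where "v \<in> W0" "p (a u) = act \<rho>t k v"
      using plin(1)[OF linear_betweenD(1)[OF a u]] by blast
    then show ?thesis using restriction.act_inv(1)[OF k, of v] W0_sub by (auto simp: c_def)
  qed
  have c_lin: "linear_between (rspace \<rho>) W0 c"
    using c_W0 by (intro linear_betweenI)
      (simp_all add: c_def linear_betweenD[OF a] plin(2,3) linear_betweenD(2,3)[OF act\<rho>t[OF ki]] pV)
  have cw: "c w \<noteq> 0"
    using big.act_eq_0[OF ki pV[OF w(1)]] pw by (auto simp: c_def)
  let ?y = "inv g \<otimes> k"
  have kc: "k \<in> carrier G" using k Jt_carrier by blast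
  have iy: "inv ?y = inv k \<otimes> g" using g kc by (simp add: inv_mult_group)
  have c_tw: "c (act \<rho> h u) = act \<rho>t (inv ?y \<otimes> h \<otimes> ?y) (c u)"
    if h: "h \<in> J \<inter> conj_set G J ?y" and u: "u \<in> rspace \<rho>" for h u
  proof -
    obtain j where j: "j \<in> J" "h = ?y \<otimes> j \<otimes> inv ?y" using h by (auto simp: conj_set_def)
    have hJ: "h \<in> J" using h by blast
    note car = g kc J_carrier[OF j(1)] J_carrier[OF hJ]
    have j_eq: "inv ?y \<otimes> h \<otimes> ?y = j"
      using car unfolding j(2) by (simp add: m_assoc inv_mult_group mult_inv_cancel)
    have ghg: "g \<otimes> h \<otimes> inv g = k \<otimes> j \<otimes> inv k"
      using car unfolding j(2) by (simp add: m_assoc inv_mult_group mult_inv_cancel)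
    have kjk: "k \<otimes> j \<otimes> inv k \<in> J" using J_conj[OF k j(1)] .
    have au: "a u \<in> rspace \<rho>t" using linear_betweenD(1)[OF a u] .
    have "p (a (act \<rho> h u)) = act \<rho>t (k \<otimes> j \<otimes> inv k) (p (a u))"
      using tw[OF hJ _ u] kjk equivariantD(2)[OF p kjk au] unfolding ghg by simp
    then have "c (act \<rho> h u) = act \<rho>t (inv k) (act \<rho>t (k \<otimes> j \<otimes> inv k) (p (a u)))"
      by (simp add: c_def)
    also have "\<dots> = act \<rho>t (inv k \<otimes> (k \<otimes> j \<otimes> inv k)) (p (a u))"
      using big.act_comp[OF ki J_Jt[OF kjk] pV[OF u]] by simp
    also have "inv k \<otimes> (k \<otimes> j \<otimes> inv k) = j \<otimes> inv k"
      using car by (simp add: m_assoc mult_inv_cancel)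
    also have "act \<rho>t (j \<otimes> inv k) (p (a u)) = act \<rho>t j (c u)"
      using big.act_comp[OF J_Jt[OF j(1)] ki pV[OF u]] by (simp add: c_def)
    finally show ?thesis by (simp add: j_eq)
  qed
  let ?f = "restrict (\<lambda>u. \<iota>_inv (c u)) (rspace \<rho>)"
  note il = equivariantD(1)[OF \<iota>_inv_equivariant, simplified]
  have f_lin: "linear_between (rspace \<rho>) (rspace \<rho>) ?f"
    using small.space by (intro linear_betweenI)
      (simp_all add: complex_vector.subspace_add complex_vector.subspace_scale
        linear_betweenD[OF c_lin] linear_betweenD[OF il])
  have "?f (act \<rho> h u) = act \<rho> (inv ?y \<otimes> h \<otimes> ?y) (?f u)"
    if h: "h \<in> J \<inter> conj_set G J ?y" and u: "u \<in> rspace \<rho>" for h u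
  proof -
    obtain j where j: "j \<in> J" "h = ?y \<otimes> j \<otimes> inv ?y" using h by (auto simp: conj_set_def)
    have j_eq: "inv ?y \<otimes> h \<otimes> ?y = j"
      using g kc J_carrier[OF j(1)] unfolding j(2) by (simp add: m_assoc inv_mult_group mult_inv_cancel)
    have "act \<rho> h u \<in> rspace \<rho>" using small.act_closed h u by blast
    then show ?thesis
      using c_tw[OF h u] equivariantD(2)[OF \<iota>_inv_equivariant j(1), simplified, OF c_W0[OF u]] u
      by (simp add: j_eq)
  qed
  then have "?f \<in> Hom (J \<inter> conj_set G J ?y) \<rho> (conj_rep G \<rho> ?y)"
    using f_lin by (simp add: Hom_def conj_rep_def)
  moreover have "?f w \<noteq> 0"
  proof
    assume "?f w = 0"
    then have "\<iota> (\<iota>_inv (c w)) = \<iota> 0" using w(1) by simp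
    then show False
      using \<iota>_\<iota>_inv[OF c_W0[OF w(1)]] cw linear_between_zero[OF equivariantD(1)[OF \<iota>_equivariant] small.space] by simp
  qed
  ultimately have "?y \<in> intertwining G J \<rho>"
    using w(1) g kc unfolding intertwining_def by blast
  then have "?y \<in> Jt" using intertwining_\<rho> by blast
  then have "k \<otimes> inv ?y \<in> Jt" using Jt_mult[OF k Jt_inv] by blast
  moreover have "g = k \<otimes> inv ?y" using g kc by (simp add: iy mult_inv_cancel)
  ultimately show "g \<in> Jt" by simp
qed

section \<open>The restriction of the induced representation\<close>

text \<open>For \<open>g\<close> in \<open>G\<close> the value of \<open>\<psi> w\<close> at \<open>g\<close> depends on \<open>w\<close> through a map as in \<open>intertwiner_support\<close>, so that it
  vanishes unless \<open>g\<close> lies in \<open>Jt\<close>.\<close>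

lemma W0_into_\<pi>:
  assumes \<psi>: "equivariant J (\<rho>t\<lparr>rspace := W0\<rparr>) \<pi> \<psi>" and w: "w \<in> W0"
  shows "\<psi> w = big.bump (\<psi> w \<one>)"
proof (rule big.supported_on_subgroup)
  note \<psi>lin = equivariantD(1)[OF \<psi>, simplified] and \<iota>lin = equivariantD(1)[OF \<iota>_equivariant]
  show "\<psi> w \<in> rspace \<pi>" using linear_betweenD(1)[OF \<psi>lin w] .
  fix g assume g: "g \<in> carrier G" "g \<notin> Jt"
  show "\<psi> w g = 0"
  proof (rule ccontr)
    assume nz: "\<psi> w g \<noteq> 0"
    have "g \<in> Jt"
    proof (rule intertwiner_support[where a = "\<lambda>u. \<psi> (\<iota> u) g" and w = "\<iota>_inv w"])
      show "linear_between (rspace \<rho>) (rspace \<rho>t) (\<lambda>u. \<psi> (\<iota> u) g)"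
        by (intro linear_betweenI)
          (simp_all add: big.IndD(1)[OF linear_betweenD(1)[OF \<psi>lin \<iota>_in_W0] g(1)]
            linear_betweenD(2,3)[OF \<iota>lin] linear_betweenD(2,3)[OF \<psi>lin] \<iota>_in_W0 scaleC_fun_def)
      show "\<psi> (\<iota> (act \<rho> j u)) g = act \<rho>t (g \<otimes> j \<otimes> inv g) (\<psi> (\<iota> u) g)"
        if j: "j \<in> J" "g \<otimes> j \<otimes> inv g \<in> J" and u: "u \<in> rspace \<rho>" for j u
      proof -
        note F = linear_betweenD(1)[OF \<psi>lin \<iota>_in_W0[OF u]]
        have "\<psi> (\<iota> (act \<rho> j u)) = act \<pi> j (\<psi> (\<iota> u))"
          using equivariantD(2)[OF \<iota>_equivariant j(1) u] equivariantD(2)[OF \<psi> j(1), simplified, OF \<iota>_in_W0[OF u]]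
          by simp
        then have "\<psi> (\<iota> (act \<rho> j u)) g = \<psi> (\<iota> u) (g \<otimes> j)" using g(1) by (simp add: big.act_Ind)
        also have "g \<otimes> j = (g \<otimes> j \<otimes> inv g) \<otimes> g"
          using g(1) J_carrier[OF j(1)] by (simp add: m_assoc)
        also have "\<psi> (\<iota> u) \<dots> = act \<rho>t (g \<otimes> j \<otimes> inv g) (\<psi> (\<iota> u) g)"
          using big.IndD(3)[OF F J_Jt[OF j(2)] g(1)] .
        finally show ?thesis .
      qed
      show "\<iota>_inv w \<in> rspace \<rho>"
        using linear_betweenD(1)[OF equivariantD(1)[OF \<iota>_inv_equivariant, simplified] w] .
      show "\<psi> (\<iota> (\<iota>_inv w)) g \<noteq> 0" using nz \<iota>_\<iota>_inv[OF w] by simp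
    qed (rule g(1))
    then show False using g(2) by simp
  qed
qed

text \<open>Restriction of functions to \<open>B\<close> identifies \<open>X0\<close> with the representation of \<open>B\<close> induced from the representation of
  \<open>J\<close> on \<open>W0\<close>.\<close>

definition X0 :: "('a \<Rightarrow> 'v) set"
  where "X0 = {f \<in> rspace \<pi>. (\<forall>g\<in>carrier G. (\<forall>h\<in>Jt. \<forall>b\<in>B. g \<noteq> h \<otimes> b) \<longrightarrow> f g = 0) \<and> (\<forall>b\<in>B. f b \<in> W0)}"

lemma X0D:
  assumes "f \<in> X0"
  shows "f \<in> rspace \<pi>" "g \<in> carrier G \<Longrightarrow> f g \<noteq> 0 \<Longrightarrow> \<exists>h\<in>Jt. \<exists>b\<in>B. g = h \<otimes> b" "b \<in> B \<Longrightarrow> f b \<in> W0"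
  using assms unfolding X0_def by blast+

lemma bump_X0:
  assumes "w \<in> W0"
  shows "big.bump w \<in> X0"
proof -
  have "big.bump w \<in> rspace \<pi>" using assms W0_sub big.bump_in_Ind by blast
  moreover have "big.bump w g = 0" if "\<forall>h\<in>Jt. \<forall>b\<in>B. g \<noteq> h \<otimes> b" for g
  proof -
    have "g \<notin> Jt"
    proof
      assume g: "g \<in> Jt"
      then have "g \<noteq> g \<otimes> \<one>" using that subgroup.one_closed[OF B_subgroup] by blast
      then show False using Jt_carrier[OF g] by simp
    qed
    then show ?thesis by (simp add: big.bump_def)
  qed
  moreover have "big.bump w b \<in> W0" if "b \<in> B" for b
    using that assms W0_act[of b w] complex_vector.subspace_0[OF W0_subspace] by (auto simp: big.bump_def J_eq)
  ultimately show ?thesis by (auto simp: X0_def)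
qed

lemma X0_subspace: "csubspace X0"
proof (rule complex_vector.subspaceI)
  show "0 \<in> X0"
    using complex_vector.subspace_0[OF big.subspace_Ind] complex_vector.subspace_0[OF W0_subspace]
    by (simp add: X0_def)
  show "f + f' \<in> X0" if "f \<in> X0" "f' \<in> X0" for f f'
    using that complex_vector.subspace_add[OF big.subspace_Ind] complex_vector.subspace_add[OF W0_subspace]
    by (simp add: X0_def)
  show "c *\<^sub>C f \<in> X0" if "f \<in> X0" for c f
    using that complex_vector.subspace_scale[OF big.subspace_Ind] complex_vector.subspace_scale[OF W0_subspace]
    by (simp add: X0_def scaleC_fun_def)
qed

lemma X0_subrep: "subrep B X0 \<pi>"
proof -
  have "act \<pi> b f \<in> X0" if b: "b \<in> B" and f: "f \<in> X0" for b f
  proof -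
    note bc = B_carrier[OF b]
    have "act \<pi> b f \<in> rspace \<pi>" using big.act_Ind_closed[OF bc X0D(1)[OF f]] .
    moreover have "act \<pi> b f g = 0" if g: "g \<in> carrier G" "\<forall>h\<in>Jt. \<forall>b\<in>B. g \<noteq> h \<otimes> b" for g
    proof (rule ccontr)
      assume "act \<pi> b f g \<noteq> 0"
      then obtain h b' where hb: "h \<in> Jt" "b' \<in> B" "g \<otimes> b = h \<otimes> b'"
        using X0D(2)[OF f, of "g \<otimes> b"] g(1) bc by (auto simp: big.act_Ind)
      have "g = g \<otimes> b \<otimes> inv b" using g(1) bc by (simp add: m_assoc)
      also have "\<dots> = h \<otimes> (b' \<otimes> inv b)"
        unfolding hb(3) using Jt_carrier[OF hb(1)] B_carrier[OF hb(2)] bc by (simp add: m_assoc)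
      finally show False using g(2) hb(1) B_mult[OF hb(2) B_inv[OF b]] by blast
    qed
    moreover have "act \<pi> b f b' \<in> W0" if "b' \<in> B" for b'
      using X0D(3)[OF f B_mult[OF that b]] B_carrier[OF that] by (simp add: big.act_Ind)
    ultimately show ?thesis by (auto simp: X0_def)
  qed
  then show ?thesis using X0_subspace X0D(1) by (auto simp: subrep_def)
qed

text \<open>\<open>X0\<close> is generated over \<open>B\<close> by the functions supported on \<open>Jt\<close>: a summand of \<open>f\<close> that lives on the coset of
  \<open>h b\<close> is the translate by \<open>b\<^sup>-\<^sup>1\<close> of such a function.\<close>

lemma X0_induct:
  assumes f: "f \<in> X0" and S: "csubspace S" "\<And>b w. b \<in> B \<Longrightarrow> w \<in> W0 \<Longrightarrow> act \<pi> b (big.bump w) \<in> S"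
  shows "f \<in> S"
proof -
  note f\<pi> = X0D(1)[OF f]
  obtain R where R: "finite R" "R \<subseteq> carrier G" "\<forall>r\<in>R. f r \<noteq> 0"
    "f = (\<Sum>r\<in>R. act \<pi> (inv r) (big.bump (f r)))"
    using big.Ind_decomposition[OF f\<pi>] by auto
  have "act \<pi> (inv r) (big.bump (f r)) \<in> S" if r: "r \<in> R" for r
  proof -
    have rc: "r \<in> carrier G" using R(2) r by blast
    obtain h b where hb: "h \<in> Jt" "b \<in> B" "r = h \<otimes> b" using X0D(2)[OF f rc] R(3) r by blast
    note hc = Jt_carrier[OF hb(1)] and bc = B_carrier[OF hb(2)]
    have fb: "f b \<in> rspace \<rho>t" using X0D(3)[OF f hb(2)] W0_sub by blast
    have "f r = act \<rho>t h (f b)" using big.IndD(3)[OF f\<pi> hb(1) bc] hb(3) by simp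
    then have "act \<pi> (inv r) (big.bump (f r)) = act \<pi> (inv r) (act \<pi> h (big.bump (f b)))"
      using big.act_Ind_bump[OF hb(1) fb] by simp
    also have "\<dots> = act \<pi> (inv r \<otimes> h) (big.bump (f b))"
      using big.representation_Ind big.bump_in_Ind[OF fb] rc hc unfolding representation_def by simp
    also have "inv r \<otimes> h = inv b"
      unfolding hb(3) using hc bc by (simp add: inv_mult_group m_assoc)
    finally show ?thesis using S(2)[OF B_inv[OF hb(2)] X0D(3)[OF f hb(2)]] by simp
  qed
  then show ?thesis by (subst R(4)) (rule complex_vector.subspace_sum[OF S(1)])
qed

lemma J_equivariant_bump: "equivariant J (\<rho>t\<lparr>rspace := W0\<rparr>) \<pi> big.bump"
  unfolding equivariant_def
proof (intro conjI ballI)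
  have W0: "w \<in> rspace \<rho>t" if "w \<in> W0" for w using that W0_sub by blast
  show "linear_between (rspace (\<rho>t\<lparr>rspace := W0\<rparr>)) (rspace \<pi>) big.bump"
    by (intro linear_betweenI) (simp_all add: big.bump_in_Ind big.bump_add big.bump_scale W0)
  show "big.bump (act (\<rho>t\<lparr>rspace := W0\<rparr>) j w) = act \<pi> j (big.bump w)"
    if "j \<in> J" "w \<in> rspace (\<rho>t\<lparr>rspace := W0\<rparr>)" for j w
    using big.act_Ind_bump[OF J_Jt[OF that(1)]] that(2) W0 by simp
qed

lemma representation_restrict:
  assumes "representation G P \<sigma>" "L \<subseteq> P" "subrep L W \<sigma>"
  shows "representation G L (\<sigma>\<lparr>rspace := W\<rparr>)"
proof -
  note \<sigma> = assms(1)[unfolded representation_def] and W = subrepD[OF assms(3)]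
  have "linear_between W W (act \<sigma> h)" if h: "h \<in> L" for h
  proof (rule linear_between_mono[OF _ W(2) W(3)[OF h]])
    show "linear_between (rspace \<sigma>) (rspace \<sigma>) (act \<sigma> h)" using \<sigma> h assms(2) by blast
  qed
  moreover have "act \<sigma> \<one> x = x" if "x \<in> W" for x
    using \<sigma> that W(2) by blast
  moreover have "act \<sigma> (h \<otimes> k) x = act \<sigma> h (act \<sigma> k x)" if "h \<in> L" "k \<in> L" "x \<in> W" for h k x
    using \<sigma> that W(2) assms(2) by blast
  ultimately show ?thesis using W(1) by (simp add: representation_def)
qed

text \<open>A nonzero \<open>B\<close>-stable subspace \<open>U\<close> contains a function that does not vanish at \<open>1\<close>. Evaluation at \<open>1\<close>
  maps \<open>U\<close> to the irreducible \<open>W0\<close> and has a \<open>J\<close>-equivariant section; the values of the section are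
  supported on \<open>Jt\<close>, so that \<open>U\<close> contains the generators of \<open>X0\<close>.\<close>

lemma X0_irreducible: "irreducible_subrep B \<pi> X0"
proof (rule irreducible_subrepI[OF X0_subrep])
  obtain w where w: "w \<in> W0" "w \<noteq> 0" using irreducible_subrep_nonzero[OF W0_irreducible] by blast
  have "big.bump w \<one> \<noteq> 0" using big.bump_one[OF subsetD[OF W0_sub w(1)]] w(2) by simp
  then have "big.bump w \<noteq> 0" by (metis zero_fun_apply)
  then show "X0 \<noteq> {0}" using bump_X0[OF w(1)] by blast
next
  fix U assume U: "subrep B U \<pi>" "U \<subseteq> X0"
  note Us = subrepD[OF U(1)]
  show "U = {0} \<or> U = X0"
  proof (cases "U \<subseteq> {0}")
    case True
    then show ?thesis using complex_vector.subspace_0[OF Us(1)] by blast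
  next
    case False
    then obtain f where f: "f \<in> U" "f \<noteq> 0" by blast
    then obtain g where g: "f g \<noteq> 0" by (auto simp: fun_eq_iff)
    note fX = subsetD[OF U(2) f(1)]
    have gc: "g \<in> carrier G" using g big.IndD(2)[OF X0D(1)[OF fX]] by blast
    obtain h b where hb: "h \<in> Jt" "b \<in> B" "g = h \<otimes> b" using X0D(2)[OF fX gc g] by blast
    have "f b \<noteq> 0"
      using g big.IndD(3)[OF X0D(1)[OF fX] hb(1) B_carrier[OF hb(2)]] big.act_zero[OF hb(1)] hb(3) by auto
    then have f1: "act \<pi> b f \<one> \<noteq> 0" using B_carrier[OF hb(2)] by (simp add: big.act_Ind)
    have bf: "act \<pi> b f \<in> U" using Us(3)[OF hb(2) f(1)] .
    have J_U: "subrep J U \<pi>" using U(1) J_B by (auto simp: subrep_def)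
    have Jsub: "J \<subseteq> carrier G" using J_carrier by blast
    note rep_U = representation_restrict[OF big.representation_Ind Jsub J_U]
    have smooth_U: "smooth T J (\<pi>\<lparr>rspace := U\<rparr>)"
      using big.smooth_Ind[OF J_subgroup J_open] Us(2) by (auto simp: smooth_def)
    have Jsub': "J \<subseteq> Jt" using J_Jt by blast
    note rep_W0 = representation_restrict[OF \<rho>t_rep(1) Jsub' irreducible_subrepD(1)[OF W0_irreducible]]
    have irr_W0: "irreducible_rep J (\<rho>t\<lparr>rspace := W0\<rparr>)"
      using W0_irreducible by (simp add: irreducible_subrep_def)
    have ev: "equivariant J (\<pi>\<lparr>rspace := U\<rparr>) (\<rho>t\<lparr>rspace := W0\<rparr>) (\<lambda>f. f \<one>)"
      unfolding equivariant_def
    proof (intro conjI ballI)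
      have "f \<one> \<in> W0" if "f \<in> U" for f
        using X0D(3)[OF subsetD[OF U(2) that] subgroup.one_closed[OF B_subgroup]] .
      then show "linear_between (rspace (\<pi>\<lparr>rspace := U\<rparr>)) (rspace (\<rho>t\<lparr>rspace := W0\<rparr>)) (\<lambda>f. f \<one>)"
        by (intro linear_betweenI) (simp_all add: scaleC_fun_def)
      fix j f' assume j: "j \<in> J" and f': "f' \<in> rspace (\<pi>\<lparr>rspace := U\<rparr>)"
      then have "f' \<in> rspace \<pi>" using Us(2) by auto
      then show "act (\<pi>\<lparr>rspace := U\<rparr>) j f' \<one> = act (\<rho>t\<lparr>rspace := W0\<rparr>) j (f' \<one>)"
        using big.IndD(3)[of f' j \<one>] J_Jt[OF j] J_carrier[OF j] by (simp add: big.act_Ind)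
    qed
    obtain s where s: "equivariant J (\<rho>t\<lparr>rspace := W0\<rparr>) (\<pi>\<lparr>rspace := U\<rparr>) s" "\<And>w. w \<in> W0 \<Longrightarrow> s w \<one> = w"
      using equivariant_section[OF J_subgroup J_open J_compact rep_U smooth_U rep_W0 irr_W0 ev, of "act \<pi> b f"]
        bf f1 by auto
    note s\<pi> = equivariant_codomain_superspace[OF s(1) Us(2)]
    have bumps: "big.bump w \<in> U" if "w \<in> W0" for w
      using W0_into_\<pi>[OF s\<pi> that] s(2)[OF that] linear_betweenD(1)[OF equivariantD(1)[OF s(1)], of w] that by simp
    have "X0 \<subseteq> U"
      by (rule subsetI, rule X0_induct[OF _ Us(1)], assumption, rule Us(3)[OF _ bumps])
    then show ?thesis using U(2) by blast
  qed
qed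

lemma span_translates_X0: "cspan (\<Union>g\<in>carrier G. act \<pi> g ` X0) = rspace \<pi>"
proof
  let ?S = "cspan (\<Union>g\<in>carrier G. act \<pi> g ` X0)"
  have "(\<Union>g\<in>carrier G. act \<pi> g ` X0) \<subseteq> rspace \<pi>"
    using big.act_Ind_closed X0D(1) by blast
  then show "?S \<subseteq> rspace \<pi>" using big.subspace_Ind by (rule complex_vector.span_minimal)
  note rep\<pi> = big.representation_Ind[unfolded representation_def]
  have gen: "act \<pi> g (big.bump v) \<in> ?S" if g: "g \<in> carrier G" and v: "v \<in> rspace \<rho>t" for g v
  proof -
    have lin: "linear_between (rspace \<rho>t) UNIV (\<lambda>v. act \<pi> g (big.bump v))"
      using g by (intro linear_betweenI)
        (simp_all add: big.bump_add big.bump_scale linear_betweenD(2,3)[OF linear_actionD(2)[OF representation_linear_action[OF big.representation_Ind]]] big.bump_in_Ind)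
    have sub: "(\<Union>p\<in>Jt. act \<rho>t p ` W0) \<subseteq> rspace \<rho>t"
      using big.act_closed W0_sub by blast
    have "act \<pi> g (big.bump u) \<in> ?S" if u: "u \<in> (\<Union>p\<in>Jt. act \<rho>t p ` W0)" for u
    proof -
      obtain p w where pw: "p \<in> Jt" "w \<in> W0" "u = act \<rho>t p w" using u by blast
      have wV: "w \<in> rspace \<rho>t" using pw(2) W0_sub by blast
      have "act \<pi> g (big.bump u) = act \<pi> (g \<otimes> p) (big.bump w)"
        using big.act_Ind_bump[OF pw(1) wV] rep\<pi> g Jt_carrier[OF pw(1)] big.bump_in_Ind[OF wV] pw(3) by simp
      moreover have "act \<pi> (g \<otimes> p) (big.bump w) \<in> (\<Union>g\<in>carrier G. act \<pi> g ` X0)"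
        using bump_X0[OF pw(2)] g Jt_carrier[OF pw(1)] by blast
      ultimately show ?thesis by (simp add: complex_vector.span_base)
    qed
    from linear_between_span_subset[OF lin big.space sub this complex_vector.subspace_span, of v]
    show ?thesis using v span_translates_W0 by simp
  qed
  show "rspace \<pi> \<subseteq> ?S"
  proof
    fix f assume f: "f \<in> rspace \<pi>"
    obtain R where R: "finite R" "R \<subseteq> carrier G" "f = (\<Sum>r\<in>R. act \<pi> (inv r) (big.bump (f r)))"
      using big.Ind_decomposition[OF f] by auto
    have "act \<pi> (inv r) (big.bump (f r)) \<in> ?S" if "r \<in> R" for r
    proof -
      have rc: "r \<in> carrier G" using R(2) that by blast
      show ?thesis by (rule gen[OF inv_closed[OF rc] big.IndD(1)[OF f rc]])
    qed
    then show "f \<in> ?S" by (subst R(3)) (rule complex_vector.span_sum)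
  qed
qed

sublocale induced: clifford G "carrier G" B \<pi>
  by (rule clifford.intro[OF group_axioms subgroup_self _ _ big.representation_Ind])
    (simp_all add: B_conj' B_carrier subsetI)

lemma equivariant_at_one:
  assumes "equivariant J (\<rho>t\<lparr>rspace := W0\<rparr>) \<pi> \<psi>"
  shows "equivariant J (\<rho>t\<lparr>rspace := W0\<rparr>) \<rho>t (\<lambda>w. \<psi> w \<one>)"
  unfolding equivariant_def
proof (intro conjI ballI)
  note \<psi>lin = equivariantD(1)[OF assms, simplified]
  show "linear_between (rspace (\<rho>t\<lparr>rspace := W0\<rparr>)) (rspace \<rho>t) (\<lambda>w. \<psi> w \<one>)"
    by (intro linear_betweenI) (simp_all add: big.IndD(1)[OF linear_betweenD(1)[OF \<psi>lin]] linear_betweenD(2,3)[OF \<psi>lin] scaleC_fun_def)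
  fix j w assume j: "j \<in> J" and w: "w \<in> rspace (\<rho>t\<lparr>rspace := W0\<rparr>)"
  have "\<psi> (act \<rho>t j w) \<one> = \<psi> w j"
    using equivariantD(2)[OF assms j w] J_carrier[OF j] by (simp add: big.act_Ind)
  also have "\<dots> = act \<rho>t j (\<psi> w \<one>)"
    using big.IndD(3)[OF linear_betweenD(1)[OF \<psi>lin], of w j \<one>] w J_Jt[OF j] J_carrier[OF j] by simp
  finally show "\<psi> (act (\<rho>t\<lparr>rspace := W0\<rparr>) j w) \<one> = act \<rho>t j (\<psi> w \<one>)" by simp
qed

text \<open>The extension \<open>\<Phi>\<close> applies \<open>\<phi>\<close> to the values at elements of \<open>B\<close> and continues the result from \<open>B\<close> to \<open>Jt B\<close> by
  the transformation rule under \<open>Jt\<close>. This is well defined because two decompositions of an element of \<open>Jt B\<close>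
  differ by an element of the intersection \<open>J\<close> of \<open>Jt\<close> and \<open>B\<close>, under which \<open>\<phi>\<close> is equivariant.\<close>

lemma extend_to_X0:
  assumes \<phi>: "equivariant J (\<rho>t\<lparr>rspace := W0\<rparr>) \<rho>t \<phi>"
  shows "\<exists>\<Phi>. equivariant B (\<pi>\<lparr>rspace := X0\<rparr>) \<pi> \<Phi> \<and> (\<forall>w\<in>W0. \<Phi> (big.bump w) \<one> = \<phi> w)"
proof -
  note \<phi>lin = equivariantD(1)[OF \<phi>, simplified]
  define \<Phi> where "\<Phi> f g = (if \<exists>h\<in>Jt. \<exists>b\<in>B. g = h \<otimes> b
    then THE y. \<exists>h\<in>Jt. \<exists>b\<in>B. g = h \<otimes> b \<and> y = act \<rho>t h (\<phi> (f b)) else 0)" for f :: "'a \<Rightarrow> 'v" and g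
  have \<Phi>_eq: "\<Phi> f (h \<otimes> b) = act \<rho>t h (\<phi> (f b))" if f: "f \<in> X0" and h: "h \<in> Jt" and b: "b \<in> B" for f h b
  proof -
    have "act \<rho>t h' (\<phi> (f b')) = act \<rho>t h (\<phi> (f b))"
      if h': "h' \<in> Jt" and b': "b' \<in> B" and eq: "h \<otimes> b = h' \<otimes> b'" for h' b'
    proof -
      note car = Jt_carrier[OF h] Jt_carrier[OF h'] B_carrier[OF b] B_carrier[OF b']
      let ?j = "inv h' \<otimes> h"
      have j_eq: "?j = b' \<otimes> inv b"
      proof -
        have "b' \<otimes> inv b = inv h' \<otimes> (h' \<otimes> b') \<otimes> inv b" using car by (simp add: mult_inv_cancel)
        also have "\<dots> = ?j" unfolding eq[symmetric] using car by (simp add: m_assoc)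
        finally show ?thesis by simp
      qed
      have j: "?j \<in> J" using Jt_mult[OF Jt_inv[OF h'] h] B_mult[OF b' B_inv[OF b]] j_eq by (simp add: J_eq)
      note fb = X0D(3)[OF f b]
      have "b' = ?j \<otimes> b" using car by (simp add: j_eq m_assoc)
      then have "f b' = act \<rho>t ?j (f b)"
        using big.IndD(3)[OF X0D(1)[OF f] J_Jt[OF j] car(3)] by simp
      then have "\<phi> (f b') = act \<rho>t ?j (\<phi> (f b))"
        using equivariantD(2)[OF \<phi> j, simplified, OF fb] by simp
      then show ?thesis
        using big.act_comp[OF h' J_Jt[OF j] linear_betweenD(1)[OF \<phi>lin fb]] car by (simp add: mult_inv_cancel)
    qed
    then have "(THE y. \<exists>h'\<in>Jt. \<exists>b'\<in>B. h \<otimes> b = h' \<otimes> b' \<and> y = act \<rho>t h' (\<phi> (f b'))) = act \<rho>t h (\<phi> (f b))"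
      using h b by (intro the_equality) blast+
    moreover have "\<exists>h'\<in>Jt. \<exists>b'\<in>B. h \<otimes> b = h' \<otimes> b'" using h b by blast
    ultimately show ?thesis by (simp add: \<Phi>_def)
  qed
  have \<Phi>_out: "\<Phi> f g = 0" if "\<not> (\<exists>h\<in>Jt. \<exists>b\<in>B. g = h \<otimes> b)" for f g
    using that by (simp add: \<Phi>_def)
  have ext: "f = f'" if "\<And>h b. h \<in> Jt \<Longrightarrow> b \<in> B \<Longrightarrow> f (h \<otimes> b) = f' (h \<otimes> b)"
    "\<And>g. \<not> (\<exists>h\<in>Jt. \<exists>b\<in>B. g = h \<otimes> b) \<Longrightarrow> f g = f' g" for f f' :: "'a \<Rightarrow> 'v"
  proof
    fix g
    show "f g = f' g"
    proof (cases "\<exists>h\<in>Jt. \<exists>b\<in>B. g = h \<otimes> b")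
      case True
      then obtain h b where "h \<in> Jt" "b \<in> B" "g = h \<otimes> b" by blast
      then show ?thesis using that(1) by simp
    next
      case False
      then show ?thesis by (rule that(2))
    qed
  qed
  have \<phi>V: "\<phi> (f b) \<in> rspace \<rho>t" if "f \<in> X0" "b \<in> B" for f b
    using linear_betweenD(1)[OF \<phi>lin X0D(3)[OF that]] .
  have shift: "(\<exists>h\<in>Jt. \<exists>b\<in>B. h' \<otimes> g \<otimes> b' = h \<otimes> b) \<longleftrightarrow> (\<exists>h\<in>Jt. \<exists>b\<in>B. g = h \<otimes> b)"
    if h': "h' \<in> Jt" and g: "g \<in> carrier G" and b': "b' \<in> B" for h' g b'
  proof
    assume "\<exists>h\<in>Jt. \<exists>b\<in>B. h' \<otimes> g \<otimes> b' = h \<otimes> b"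
    then obtain h b where hb: "h \<in> Jt" "b \<in> B" "h' \<otimes> g \<otimes> b' = h \<otimes> b" by blast
    note car = Jt_carrier[OF h'] g B_carrier[OF b'] Jt_carrier[OF hb(1)] B_carrier[OF hb(2)]
    have "g = inv h' \<otimes> (h' \<otimes> g \<otimes> b') \<otimes> inv b'" using car by (simp add: m_assoc mult_inv_cancel)
    also have "\<dots> = (inv h' \<otimes> h) \<otimes> (b \<otimes> inv b')" unfolding hb(3) using car by (simp add: m_assoc)
    finally show "\<exists>h\<in>Jt. \<exists>b\<in>B. g = h \<otimes> b"
      using Jt_mult[OF Jt_inv[OF h'] hb(1)] B_mult[OF hb(2) B_inv[OF b']] by blast
  next
    assume "\<exists>h\<in>Jt. \<exists>b\<in>B. g = h \<otimes> b"
    then obtain h b where hb: "h \<in> Jt" "b \<in> B" "g = h \<otimes> b" by blast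
    have "h' \<otimes> g \<otimes> b' = (h' \<otimes> h) \<otimes> (b \<otimes> b')"
      using Jt_carrier[OF h'] B_carrier[OF b'] Jt_carrier[OF hb(1)] B_carrier[OF hb(2)] hb(3) by (simp add: m_assoc)
    then show "\<exists>h\<in>Jt. \<exists>b\<in>B. h' \<otimes> g \<otimes> b' = h \<otimes> b" using Jt_mult[OF h' hb(1)] B_mult[OF hb(2) b'] by blast
  qed
  note one_B = subgroup.one_closed[OF B_subgroup] and one_Jt = subgroup.one_closed[OF Jt_subgroup]
  have \<Phi>_Ind: "\<Phi> f \<in> rspace \<pi>" if f: "f \<in> X0" for f
    unfolding big.Ind_iff
  proof (intro conjI ballI allI impI)
    show "\<Phi> f g \<in> rspace \<rho>t" if "g \<in> carrier G" for g
    proof (cases "\<exists>h\<in>Jt. \<exists>b\<in>B. g = h \<otimes> b")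
      case True
      then show ?thesis using \<Phi>_eq[OF f] big.act_closed \<phi>V[OF f] by auto
    next
      case False
      then show ?thesis using \<Phi>_out complex_vector.subspace_0[OF big.space] by simp
    qed
    show "\<Phi> f g = 0" if "g \<notin> carrier G" for g
      using that Jt_carrier B_carrier by (intro \<Phi>_out) auto
    show "\<Phi> f (h' \<otimes> g) = act \<rho>t h' (\<Phi> f g)" if h': "h' \<in> Jt" and g: "g \<in> carrier G" for h' g
    proof (cases "\<exists>h\<in>Jt. \<exists>b\<in>B. g = h \<otimes> b")
      case True
      then obtain h b where hb: "h \<in> Jt" "b \<in> B" "g = h \<otimes> b" by blast
      have "h' \<otimes> g = (h' \<otimes> h) \<otimes> b"
        using Jt_carrier[OF h'] Jt_carrier[OF hb(1)] B_carrier[OF hb(2)] hb(3) by (simp add: m_assoc)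
      then show ?thesis
        using \<Phi>_eq[OF f Jt_mult[OF h' hb(1)] hb(2)] \<Phi>_eq[OF f hb(1,2)] hb(3)
          big.act_comp[OF h' hb(1) \<phi>V[OF f hb(2)]] by simp
    next
      case False
      then have "\<not> (\<exists>h\<in>Jt. \<exists>b\<in>B. h' \<otimes> g = h \<otimes> b)"
        using shift[OF h' g one_B] Jt_carrier[OF h'] g by simp
      then show ?thesis using \<Phi>_out False big.act_zero[OF h'] by simp
    qed
    obtain K where K: "subgroup K G" "openin T K" "\<And>g k. g \<in> carrier G \<Longrightarrow> k \<in> K \<Longrightarrow> f (g \<otimes> k) = f g"
      using big.IndD(4)[OF X0D(1)[OF f]] by auto
    have "\<Phi> f (g \<otimes> k) = \<Phi> f g" if g: "g \<in> carrier G" and k: "k \<in> K \<inter> J" for g k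
    proof (cases "\<exists>h\<in>Jt. \<exists>b\<in>B. g = h \<otimes> b")
      case True
      then obtain h b where hb: "h \<in> Jt" "b \<in> B" "g = h \<otimes> b" by blast
      have kB: "k \<in> B" using k J_B by blast
      have "g \<otimes> k = h \<otimes> (b \<otimes> k)"
        using Jt_carrier[OF hb(1)] B_carrier[OF hb(2)] B_carrier[OF kB] hb(3) by (simp add: m_assoc)
      then show ?thesis
        using \<Phi>_eq[OF f hb(1) B_mult[OF hb(2) kB]] \<Phi>_eq[OF f hb(1,2)] hb(3) K(3)[of b k] B_carrier[OF hb(2)] k by simp
    next
      case False
      then have "\<not> (\<exists>h\<in>Jt. \<exists>b\<in>B. g \<otimes> k = h \<otimes> b)"
        using shift[OF one_Jt g, of k] J_B k g by simp
      then show ?thesis using \<Phi>_out False by simp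
    qed
    moreover have "subgroup (K \<inter> J) G" using K(1) J_subgroup by (rule subgroups_Inter_pair)
    moreover have "openin T (K \<inter> J)" using K(2) J_open by (rule openin_Int)
    ultimately show "\<exists>K. subgroup K G \<and> openin T K \<and> (\<forall>g\<in>carrier G. \<forall>k\<in>K. \<Phi> f (g \<otimes> k) = \<Phi> f g)"
      by blast
    have "{g \<in> carrier G. \<Phi> f g \<noteq> 0} \<subseteq> {g \<in> carrier G. f g \<noteq> 0}"
    proof
      fix g assume g: "g \<in> {g \<in> carrier G. \<Phi> f g \<noteq> 0}"
      then obtain h b where hb: "h \<in> Jt" "b \<in> B" "g = h \<otimes> b" using \<Phi>_out by blast
      have "f b \<noteq> 0"
      proof
        assume "f b = 0"
        then have "\<Phi> f g = 0"
          using \<Phi>_eq[OF f hb(1,2)] hb(3) linear_between_zero[OF \<phi>lin W0_subspace] big.act_zero[OF hb(1)] by simp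
        then show False using g by simp
      qed
      then have "f g \<noteq> 0"
        using big.IndD(3)[OF X0D(1)[OF f] hb(1) B_carrier[OF hb(2)]] big.act_eq_0[OF hb(1)] X0D(3)[OF f hb(2)] W0_sub hb(3)
        by auto
      then show "g \<in> {g \<in> carrier G. f g \<noteq> 0}" using g by simp
    qed
    then show "finite ((\<lambda>g. Jt #> g) ` {g \<in> carrier G. \<Phi> f g \<noteq> 0})"
      by (rule finite_subset[OF image_mono big.IndD(5)[OF X0D(1)[OF f]]])
  qed
  have add: "\<Phi> (f + f') = \<Phi> f + \<Phi> f'" if f: "f \<in> X0" "f' \<in> X0" for f f'
  proof (rule ext)
    show "\<Phi> (f + f') (h \<otimes> b) = (\<Phi> f + \<Phi> f') (h \<otimes> b)" if "h \<in> Jt" "b \<in> B" for h b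
      using that f complex_vector.subspace_add[OF X0_subspace f]
      by (simp add: \<Phi>_eq linear_betweenD(2)[OF \<phi>lin] X0D(3) linear_betweenD(2)[OF big.lin] \<phi>V)
  qed (simp add: \<Phi>_out)
  have scale: "\<Phi> (c *\<^sub>C f) = c *\<^sub>C \<Phi> f" if f: "f \<in> X0" for c f
  proof (rule ext)
    show "\<Phi> (c *\<^sub>C f) (h \<otimes> b) = (c *\<^sub>C \<Phi> f) (h \<otimes> b)" if "h \<in> Jt" "b \<in> B" for h b
      using that f complex_vector.subspace_scale[OF X0_subspace f]
      by (simp add: \<Phi>_eq linear_betweenD(3)[OF \<phi>lin] X0D(3) linear_betweenD(3)[OF big.lin] \<phi>V scaleC_fun_def)
  qed (simp add: \<Phi>_out scaleC_fun_def)
  have "linear_between X0 (rspace \<pi>) \<Phi>"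
    by (rule linear_betweenI) (rule \<Phi>_Ind add scale, assumption+)+
  moreover have "\<Phi> (act \<pi> b' f) = act \<pi> b' (\<Phi> f)" if b': "b' \<in> B" and f: "f \<in> X0" for b' f
  proof (rule ext)
    note b'c = B_carrier[OF b'] and f' = subrepD(3)[OF X0_subrep b' f]
    show "\<Phi> (act \<pi> b' f) (h \<otimes> b) = act \<pi> b' (\<Phi> f) (h \<otimes> b)" if hb: "h \<in> Jt" "b \<in> B" for h b
      using \<Phi>_eq[OF f' hb] \<Phi>_eq[OF f hb(1) B_mult[OF hb(2) b']] Jt_carrier[OF hb(1)] B_carrier[OF hb(2)] b'c
      by (simp add: big.act_Ind m_assoc)
    show "\<Phi> (act \<pi> b' f) g = act \<pi> b' (\<Phi> f) g" if "\<not> (\<exists>h\<in>Jt. \<exists>b\<in>B. g = h \<otimes> b)" for g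
      using \<Phi>_out[OF that] \<Phi>_out[of "g \<otimes> b'" f] shift[OF one_Jt _ b', of g] that by (simp add: big.act_Ind)
  qed
  ultimately have "equivariant B (\<pi>\<lparr>rspace := X0\<rparr>) \<pi> \<Phi>" by (simp add: equivariant_def)
  moreover have "\<Phi> (big.bump w) \<one> = \<phi> w" if w: "w \<in> W0" for w
    using \<Phi>_eq[OF bump_X0[OF w] one_Jt one_B] w W0_sub big.act_1[OF linear_betweenD(1)[OF \<phi>lin w]]
    by (simp add: big.bump_one subset_iff)
  ultimately show ?thesis by blast
qed

text \<open>By Clifford theory each side says that the relevant equivariant maps preserve \<open>X0\<close> or \<open>W0\<close>. An equivariant map on \<open>X0\<close>
  sends a function supported on \<open>Jt\<close> to such a function by \<open>W0_into_\<pi>\<close>, and evaluation at \<open>1\<close> turns it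
  into a map on \<open>W0\<close>; \<open>extend_to_X0\<close> goes in the opposite direction.\<close>

theorem multiplicity_free_\<pi>_iff: "multiplicity_free B \<pi> \<longleftrightarrow> multiplicity_free J \<rho>t"
proof -
  have "(\<forall>\<Phi>. equivariant B (\<pi>\<lparr>rspace := X0\<rparr>) \<pi> \<Phi> \<longrightarrow> \<Phi> ` X0 \<subseteq> X0) \<longleftrightarrow>
    (\<forall>\<phi>. equivariant J (\<rho>t\<lparr>rspace := W0\<rparr>) \<rho>t \<phi> \<longrightarrow> \<phi> ` W0 \<subseteq> W0)"
  proof (intro iffI allI impI)
    fix \<phi> assume *: "\<forall>\<Phi>. equivariant B (\<pi>\<lparr>rspace := X0\<rparr>) \<pi> \<Phi> \<longrightarrow> \<Phi> ` X0 \<subseteq> X0"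
      and \<phi>: "equivariant J (\<rho>t\<lparr>rspace := W0\<rparr>) \<rho>t \<phi>"
    obtain \<Phi> where \<Phi>: "equivariant B (\<pi>\<lparr>rspace := X0\<rparr>) \<pi> \<Phi>" "\<And>w. w \<in> W0 \<Longrightarrow> \<Phi> (big.bump w) \<one> = \<phi> w"
      using extend_to_X0[OF \<phi>] by blast
    have sub: "\<Phi> ` X0 \<subseteq> X0" using * \<Phi>(1) by blast
    show "\<phi> ` W0 \<subseteq> W0"
    proof
      fix y assume "y \<in> \<phi> ` W0"
      then obtain w where w: "w \<in> W0" "y = \<phi> w" by blast
      have "\<Phi> (big.bump w) \<in> X0" using sub bump_X0[OF w(1)] by blast
      then show "y \<in> W0"
        using X0D(3)[OF _ subgroup.one_closed[OF B_subgroup], of "\<Phi> (big.bump w)"] \<Phi>(2)[OF w(1)] w(2) by simp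
    qed
  next
    fix \<Phi> assume *: "\<forall>\<phi>. equivariant J (\<rho>t\<lparr>rspace := W0\<rparr>) \<rho>t \<phi> \<longrightarrow> \<phi> ` W0 \<subseteq> W0"
      and \<Phi>: "equivariant B (\<pi>\<lparr>rspace := X0\<rparr>) \<pi> \<Phi>"
    note \<Phi>lin = equivariantD(1)[OF \<Phi>, simplified]
    have b: "equivariant J (\<rho>t\<lparr>rspace := W0\<rparr>) (\<pi>\<lparr>rspace := X0\<rparr>) big.bump"
      using bump_X0 by (intro equivariant_codomain[OF J_equivariant_bump]) simp
    have "equivariant J (\<pi>\<lparr>rspace := X0\<rparr>) \<pi> \<Phi>"
      using \<Phi> J_B by (simp add: equivariant_def)
    note \<psi> = equivariant_compose[OF b this]
    have bump: "\<Phi> (big.bump w) \<in> X0" if w: "w \<in> W0" for w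
    proof -
      have "(\<lambda>w. \<Phi> (big.bump w) \<one>) ` W0 \<subseteq> W0" using * equivariant_at_one[OF \<psi>] by blast
      then have "\<Phi> (big.bump w) \<one> \<in> W0" using w by blast
      then show ?thesis using W0_into_\<pi>[OF \<psi> w] bump_X0[of "\<Phi> (big.bump w) \<one>"] by simp
    qed
    have "f \<in> {f \<in> X0. \<Phi> f \<in> X0}" if f: "f \<in> X0" for f
    proof (rule X0_induct[OF f])
      show "csubspace {f \<in> X0. \<Phi> f \<in> X0}"
        using \<Phi>lin X0_subspace X0_subspace by (rule subspace_preimage_linear_between)
      fix b w assume b: "b \<in> B" and w: "w \<in> W0"
      have "\<Phi> (act \<pi> b (big.bump w)) = act \<pi> b (\<Phi> (big.bump w))"
        using equivariantD(2)[OF \<Phi> b, simplified, OF bump_X0[OF w]] .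
      then show "act \<pi> b (big.bump w) \<in> {f \<in> X0. \<Phi> f \<in> X0}"
        using subrepD(3)[OF X0_subrep b bump_X0[OF w]] subrepD(3)[OF X0_subrep b bump[OF w]] by simp
    qed
    then show "\<Phi> ` X0 \<subseteq> X0" by blast
  qed
  then show ?thesis
    using induced.multiplicity_free_iff[OF X0_irreducible span_translates_X0]
      restriction.multiplicity_free_iff[OF W0_irreducible span_translates_W0] by simp
qed

end

section \<open>The Hecke algebra\<close>

text \<open>An irreducible representation is spanned by the orbit of a vector, which is countable because stabilisers are open.\<close>

lemma (in inducible) countable_dimension:
  assumes "irreducible_rep H \<sigma>" "S \<subseteq> rspace \<sigma>" "complex_vector.independent S"
  shows "countable S"
proof -
  interpret self: clifford G H H \<sigma>
    by (rule clifford.intro[OF group_axioms subgroup _ _ rep])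
      (simp_all add: subgroup.m_closed[OF subgroup] subgroup.m_inv_closed[OF subgroup])
  obtain x where x: "x \<in> rspace \<sigma>" "x \<noteq> 0"
    using assms(1) complex_vector.subspace_0[OF space] unfolding irreducible_rep_def by blast
  have "cspan (\<Union>p\<in>H. act \<sigma> p ` {x}) = rspace \<sigma>"
    using x by (intro self.span_translates[OF assms(1)]) auto
  moreover have "(\<Union>p\<in>H. act \<sigma> p ` {x}) = (\<lambda>p. act \<sigma> p x) ` H" by auto
  ultimately have "S \<subseteq> cspan ((\<lambda>p. act \<sigma> p x) ` H)" using assms(2) by simp
  then show ?thesis
    by (rule countable_independent_in_span[OF countable_orbit[OF subgroup open_H rep smooth x(1)] _ assms(3)])
qed

context cuspidal_data
begin

abbreviation I :: "('a, 'a \<Rightarrow> 'v) rep"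
  where "I \<equiv> compact_induction G T J \<rho>"

abbreviation hecke :: "(complex, ('a \<Rightarrow> 'v) \<Rightarrow> 'a \<Rightarrow> 'v) module"
  where "hecke \<equiv> hecke_algebra G T J \<rho>"

lemma schur_\<rho>:
  assumes "equivariant J \<rho> \<rho> f"
  shows "\<exists>c. \<forall>w\<in>rspace \<rho>. f w = c *\<^sub>C w"
  using schur_countable_dimension[OF \<rho>_linear_action \<rho>_rep(3) small.countable_dimension[OF \<rho>_rep(3)] assms] .

lemma carrier_hecke:
  "a \<in> carrier hecke \<longleftrightarrow> a \<in> extensional (rspace I) \<and> equivariant (carrier G) I I a"
  by (simp add: hecke_algebra_def End_algebra_def Hom_def equivariant_def)

lemma mult_hecke: "a \<otimes>\<^bsub>hecke\<^esub> b = compose (rspace I) a b"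
  by (simp add: hecke_algebra_def End_algebra_def)

lemma exists_nonzero_\<rho>: "\<exists>w. w \<in> rspace \<rho> \<and> w \<noteq> 0"
  using \<rho>_rep(3) complex_vector.subspace_0[OF small.space] unfolding irreducible_rep_def by blast

lemma \<iota>_linear: "linear_between (rspace \<rho>) (rspace \<rho>t) \<iota>"
  using \<iota>_equivariant by (rule equivariantD(1))

lemma \<iota>_eq_0: "w \<in> rspace \<rho> \<Longrightarrow> \<iota> w = 0 \<Longrightarrow> w = 0"
  using \<iota>_inj linear_between_inj_on_iff[OF \<iota>_linear small.space] by blast

subsection \<open>Multiplicity freeness makes the Hecke algebra commutative\<close>

lemma multiplicity_free_imp_scalar:
  assumes "multiplicity_free J \<rho>t" "equivariant J \<rho> \<rho>t \<phi>"
  shows "\<exists>c. \<forall>w\<in>rspace \<rho>. \<phi> w = c *\<^sub>C \<iota> w"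
proof -
  have "equivariant J (\<rho>t\<lparr>rspace := W0\<rparr>) \<rho>t (\<lambda>u. \<phi> (\<iota>_inv u))"
    using \<iota>_inv_equivariant assms(2) by (rule equivariant_compose)
  then have "(\<lambda>u. \<phi> (\<iota>_inv u)) ` W0 \<subseteq> W0"
    using assms(1) restriction.multiplicity_free_iff[OF W0_irreducible span_translates_W0] by blast
  then have "\<phi> (\<iota>_inv (\<iota> w)) \<in> W0" if "w \<in> rspace \<rho>" for w
    using \<iota>_in_W0[OF that] by blast
  then have \<phi>W0: "\<phi> w \<in> W0" if "w \<in> rspace \<rho>" for w
    using that \<iota>_inv_\<iota>[OF that] by fastforce
  have "equivariant J \<rho> \<rho> (\<lambda>w. \<iota>_inv (\<phi> w))"
    using equivariant_codomain[OF assms(2) \<phi>W0] \<iota>_inv_equivariant by (rule equivariant_compose)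
  then obtain c where c: "\<And>w. w \<in> rspace \<rho> \<Longrightarrow> \<iota>_inv (\<phi> w) = c *\<^sub>C w" using schur_\<rho> by blast
  have "\<phi> w = c *\<^sub>C \<iota> w" if "w \<in> rspace \<rho>" for w
    using \<iota>_\<iota>_inv[OF \<phi>W0[OF that]] c[OF that] linear_betweenD(3)[OF \<iota>_linear that] by simp
  then show ?thesis by blast
qed

text \<open>An element \<open>a\<close> of the Hecke algebra is determined by the functions \<open>a (bump w)\<close>, which are
  supported on \<open>Jt\<close>. For \<open>g\<close> in \<open>Jt\<close> the map that sends \<open>w\<close> to the translate by \<open>g\<^sup>-\<^sup>1\<close> of the value of
  \<open>a (bump w)\<close> at \<open>g\<close> is \<open>J\<close>-equivariant, hence a multiple \<open>s g\<close> of \<open>\<iota>\<close>.\<close>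

lemma hecke_bump:
  assumes mf: "multiplicity_free J \<rho>t" and a: "a \<in> carrier hecke"
  obtains s where "\<And>g w. g \<in> Jt \<Longrightarrow> w \<in> rspace \<rho> \<Longrightarrow> \<iota> (a (small.bump w) g) = s g *\<^sub>C act \<rho>t g (\<iota> w)"
    and "\<And>g w. g \<in> carrier G \<Longrightarrow> g \<notin> Jt \<Longrightarrow> w \<in> rspace \<rho> \<Longrightarrow> a (small.bump w) g = 0"
proof -
  have a_eq: "equivariant (carrier G) I I a" using a by (simp add: carrier_hecke)
  note alin = equivariantD(1)[OF a_eq]
  have aI: "a (small.bump w) \<in> rspace I" if "w \<in> rspace \<rho>" for w
    using linear_betweenD(1)[OF alin small.bump_in_Ind[OF that]] .
  have val: "a (small.bump w) g \<in> rspace \<rho>" if "w \<in> rspace \<rho>" "g \<in> carrier G" for w g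
    using small.IndD(1)[OF aI] that by blast
  have lin: "linear_between (rspace \<rho>) (rspace \<rho>t) (\<lambda>u. \<iota> (a (small.bump u) g))" if g: "g \<in> carrier G" for g
  proof (rule linear_betweenI)
    fix u assume u: "u \<in> rspace \<rho>"
    note bu = small.bump_in_Ind[OF u]
    show "\<iota> (a (small.bump u) g) \<in> rspace \<rho>t" using linear_betweenD(1)[OF \<iota>_linear val[OF u g]] .
    show "\<iota> (a (small.bump (c *\<^sub>C u)) g) = c *\<^sub>C \<iota> (a (small.bump u) g)" for c
    proof -
      have "a (small.bump (c *\<^sub>C u)) = c *\<^sub>C a (small.bump u)"
        using small.bump_scale[OF u] linear_betweenD(3)[OF alin bu] by simp
      then show ?thesis using linear_betweenD(3)[OF \<iota>_linear val[OF u g]] by (simp add: scaleC_fun_def)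
    qed
    fix u' assume u': "u' \<in> rspace \<rho>"
    have "a (small.bump (u + u')) = a (small.bump u) + a (small.bump u')"
      using small.bump_add[OF u u'] linear_betweenD(2)[OF alin bu small.bump_in_Ind[OF u']] by simp
    then show "\<iota> (a (small.bump (u + u')) g) = \<iota> (a (small.bump u) g) + \<iota> (a (small.bump u') g)"
      using linear_betweenD(2)[OF \<iota>_linear val[OF u g] val[OF u' g]] by simp
  qed
  have tw: "\<iota> (a (small.bump (act \<rho> j u)) g) = act \<rho>t (g \<otimes> j \<otimes> inv g) (\<iota> (a (small.bump u) g))"
    if g: "g \<in> carrier G" and j: "j \<in> J" "g \<otimes> j \<otimes> inv g \<in> J" and u: "u \<in> rspace \<rho>" for g j u
  proof -
    have "a (small.bump (act \<rho> j u)) = act I j (a (small.bump u))"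
      using equivariantD(2)[OF a_eq J_carrier[OF j(1)] small.bump_in_Ind[OF u]] small.act_Ind_bump[OF j(1) u] by simp
    then have "a (small.bump (act \<rho> j u)) g = a (small.bump u) (g \<otimes> j)"
      using g by (simp add: small.act_Ind)
    also have "g \<otimes> j = (g \<otimes> j \<otimes> inv g) \<otimes> g" using g J_carrier[OF j(1)] by (simp add: m_assoc)
    also have "a (small.bump u) \<dots> = act \<rho> (g \<otimes> j \<otimes> inv g) (a (small.bump u) g)"
      using small.IndD(3)[OF aI[OF u] j(2) g] .
    finally show ?thesis
      using equivariantD(2)[OF \<iota>_equivariant j(2) val[OF u g]] by simp
  qed
  have outside: "a (small.bump w) g = 0" if "g \<in> carrier G" "g \<notin> Jt" "w \<in> rspace \<rho>" for g w
  proof (rule ccontr)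
    assume "a (small.bump w) g \<noteq> 0"
    then have nz: "\<iota> (a (small.bump w) g) \<noteq> 0" using \<iota>_eq_0[OF val[OF that(3,1)]] by blast
    have "g \<in> Jt"
      by (rule intertwiner_support[OF lin[OF that(1)] that(1) _ that(3) nz]) (rule tw[OF that(1)])
    then show False using that(2) by simp
  qed
  have "\<exists>c. \<forall>w\<in>rspace \<rho>. \<iota> (a (small.bump w) g) = c *\<^sub>C act \<rho>t g (\<iota> w)" if g: "g \<in> Jt" for g
  proof -
    note gc = Jt_carrier[OF g] and gi = Jt_inv[OF g]
    note glin = restriction.act_linear[OF g] and gilin = restriction.act_linear[OF gi]
    let ?\<phi> = "\<lambda>w. act \<rho>t (inv g) (\<iota> (a (small.bump w) g))"
    have "linear_between (rspace \<rho>) (rspace \<rho>t) ?\<phi>"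
      by (intro linear_betweenI) (simp_all add: linear_betweenD[OF gilin] linear_betweenD[OF lin[OF gc]])
    moreover have "?\<phi> (act \<rho> j w) = act \<rho>t j (?\<phi> w)" if j: "j \<in> J" and w: "w \<in> rspace \<rho>" for j w
    proof -
      have V: "\<iota> (a (small.bump w) g) \<in> rspace \<rho>t" using linear_betweenD(1)[OF lin[OF gc] w] .
      note gj = J_conj[OF g j]
      have "?\<phi> (act \<rho> j w) = act \<rho>t (inv g \<otimes> (g \<otimes> j \<otimes> inv g)) (\<iota> (a (small.bump w) g))"
        using tw[OF gc j gj w] big.act_comp[OF gi J_Jt[OF gj] V] by simp
      also have "inv g \<otimes> (g \<otimes> j \<otimes> inv g) = j \<otimes> inv g"
        using gc J_carrier[OF j] by (simp add: m_assoc mult_inv_cancel)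
      finally show ?thesis using big.act_comp[OF J_Jt[OF j] gi V] by simp
    qed
    ultimately have "equivariant J \<rho> \<rho>t ?\<phi>" by (simp add: equivariant_def)
    then obtain c where c: "\<And>w. w \<in> rspace \<rho> \<Longrightarrow> ?\<phi> w = c *\<^sub>C \<iota> w"
      using multiplicity_free_imp_scalar[OF mf] by blast
    have "\<iota> (a (small.bump w) g) = c *\<^sub>C act \<rho>t g (\<iota> w)" if w: "w \<in> rspace \<rho>" for w
      using big.act_inverse(2)[OF g linear_betweenD(1)[OF lin[OF gc] w]] c[OF w]
        linear_betweenD(3)[OF glin linear_betweenD(1)[OF \<iota>_linear w]] by simp
    then show ?thesis by blast
  qed
  then have "\<forall>g\<in>Jt. \<exists>c. \<forall>w\<in>rspace \<rho>. \<iota> (a (small.bump w) g) = c *\<^sub>C act \<rho>t g (\<iota> w)" by (rule ballI)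
  from bchoice[OF this] obtain s where
    s: "\<forall>g\<in>Jt. \<forall>w\<in>rspace \<rho>. \<iota> (a (small.bump w) g) = s g *\<^sub>C act \<rho>t g (\<iota> w)" by (rule exE)
  show thesis using that[OF _ outside, of s] s by simp
qed

text \<open>Under \<open>\<iota>\<close> every element of the Hecke algebra becomes a linear combination of the operators
  \<open>F \<mapsto> (\<lambda>x. g F(g\<^sup>-\<^sup>1 x))\<close> with \<open>g\<close> in \<open>Jt\<close>.\<close>

lemma hecke_formula:
  assumes mf: "multiplicity_free J \<rho>t" and a: "a \<in> carrier hecke"
  shows "\<exists>R s. finite R \<and> R \<subseteq> Jt \<and> (\<forall>f\<in>rspace I. \<forall>x\<in>carrier G.
    \<iota> (a f x) = (\<Sum>g\<in>R. s g *\<^sub>C act \<rho>t g (\<iota> (f (inv g \<otimes> x)))))"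
proof -
  have a_eq: "equivariant (carrier G) I I a" using a by (simp add: carrier_hecke)
  note alin = equivariantD(1)[OF a_eq]
  obtain s where s: "\<And>g w. g \<in> Jt \<Longrightarrow> w \<in> rspace \<rho> \<Longrightarrow> \<iota> (a (small.bump w) g) = s g *\<^sub>C act \<rho>t g (\<iota> w)"
    and outside: "\<And>g w. g \<in> carrier G \<Longrightarrow> g \<notin> Jt \<Longrightarrow> w \<in> rspace \<rho> \<Longrightarrow> a (small.bump w) g = 0"
    by (rule hecke_bump[OF mf a]) (rule that)
  have aI: "a (small.bump w) \<in> rspace I" if "w \<in> rspace \<rho>" for w
    using linear_betweenD(1)[OF alin small.bump_in_Ind[OF that]] .
  have \<iota>V: "\<iota> w \<in> rspace \<rho>t" if "w \<in> rspace \<rho>" for w using linear_betweenD(1)[OF \<iota>_linear that] .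
  obtain w0 where w0: "w0 \<in> rspace \<rho>" "w0 \<noteq> 0" using exists_nonzero_\<rho> by blast
  have nz: "act \<rho>t g (\<iota> w0) \<noteq> 0" if "g \<in> Jt" for g
    using big.act_eq_0[OF that \<iota>V[OF w0(1)]] \<iota>_eq_0[OF w0(1)] w0(2) by blast
  \<comment> \<open>\<open>s\<close> is constant on \<open>J\<close>-cosets; the finite sum runs over a set \<open>R\<close> of representatives of the cosets in its support.\<close>
  have s_coset: "s (j \<otimes> g) = s g" if j: "j \<in> J" and g: "g \<in> Jt" for j g
  proof -
    note jg = Jt_mult[OF J_Jt[OF j] g]
    have "s (j \<otimes> g) *\<^sub>C act \<rho>t (j \<otimes> g) (\<iota> w0) = \<iota> (a (small.bump w0) (j \<otimes> g))"
      using s[OF jg w0(1)] by simp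
    also have "\<dots> = \<iota> (act \<rho> j (a (small.bump w0) g))"
      using small.IndD(3)[OF aI[OF w0(1)] j Jt_carrier[OF g]] by simp
    also have "\<dots> = act \<rho>t j (\<iota> (a (small.bump w0) g))"
      using equivariantD(2)[OF \<iota>_equivariant j small.IndD(1)[OF aI[OF w0(1)] Jt_carrier[OF g]]] .
    also have "\<dots> = s g *\<^sub>C act \<rho>t j (act \<rho>t g (\<iota> w0))"
      using s[OF g w0(1)] linear_betweenD(3)[OF restriction.act_linear[OF J_Jt[OF j]] big.act_closed[OF g \<iota>V[OF w0(1)]]]
      by simp
    also have "\<dots> = s g *\<^sub>C act \<rho>t (j \<otimes> g) (\<iota> w0)"
      using big.act_comp[OF J_Jt[OF j] g \<iota>V[OF w0(1)]] by simp
    finally show ?thesis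
      using nz[OF jg] complex_vector.scale_right_imp_eq by blast
  qed
  let ?q = "\<lambda>g. J #> g" and ?S = "{g \<in> Jt. s g \<noteq> 0}"
  have supp: "?S \<subseteq> {g \<in> carrier G. a (small.bump w0) g \<noteq> 0}"
  proof
    fix g assume g: "g \<in> ?S"
    then have "\<iota> (a (small.bump w0) g) \<noteq> 0" using s[OF _ w0(1), of g] nz[of g] by simp
    then have "a (small.bump w0) g \<noteq> 0" using linear_between_zero[OF \<iota>_linear small.space] by auto
    then show "g \<in> {g \<in> carrier G. a (small.bump w0) g \<noteq> 0}" using g Jt_carrier by simp
  qed
  have finS: "finite (?q ` ?S)"
    using finite_subset[OF image_mono[OF supp] small.IndD(5)[OF aI[OF w0(1)]]] .
  obtain R where R: "R \<subseteq> ?S" "inj_on ?q R" "?q ` ?S = ?q ` R"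
    using subset_image_inj[of "?q ` ?S" ?q ?S] by auto
  have finR: "finite R" using finS unfolding R(3) by (rule finite_imageD[OF _ R(2)])
  have RJt: "g \<in> Jt" if "g \<in> R" for g using R(1) that by blast
  let ?L = "\<lambda>f x. \<Sum>g\<in>R. s g *\<^sub>C act \<rho>t g (\<iota> (f (inv g \<otimes> x)))"
  have base: "\<iota> (a (small.bump w) x) = ?L (small.bump w) x" if w: "w \<in> rspace \<rho>" and x: "x \<in> carrier G" for w x
  proof -
    have summand: "s g *\<^sub>C act \<rho>t g (\<iota> (small.bump w (inv g \<otimes> x))) =
        (if ?q g = ?q x then s x *\<^sub>C act \<rho>t x (\<iota> w) else 0)" if g: "g \<in> R" for g
    proof -
      note gJt = RJt[OF g] and gc = Jt_carrier[OF RJt[OF g]]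
      show ?thesis
      proof (cases "?q g = ?q x")
        case True
        then have xg: "x \<otimes> inv g \<in> J" using small.coset_eq_iff[OF x gc] by simp
        have gx: "inv g \<otimes> x \<in> J"
        proof -
          have "inv g \<otimes> (x \<otimes> inv g) \<otimes> g = inv g \<otimes> x" using gc x by (simp add: m_assoc)
          then show ?thesis using J_conj'[OF gJt xg] by simp
        qed
        have x_eq: "x = (x \<otimes> inv g) \<otimes> g" using gc x by (simp add: m_assoc)
        have sx: "s x = s g" using s_coset[OF xg gJt] x_eq by simp
        have "act \<rho>t g (\<iota> (small.bump w (inv g \<otimes> x))) = act \<rho>t g (act \<rho>t (inv g \<otimes> x) (\<iota> w))"
          using gx equivariantD(2)[OF \<iota>_equivariant gx w] by (simp add: small.bump_def)
        also have "\<dots> = act \<rho>t x (\<iota> w)"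
          using big.act_comp[OF gJt J_Jt[OF gx] \<iota>V[OF w]] gc x by (simp add: mult_inv_cancel)
        finally show ?thesis using True sx by simp
      next
        case False
        have "inv g \<otimes> x \<notin> J"
        proof
          assume "inv g \<otimes> x \<in> J"
          then have "g \<otimes> (inv g \<otimes> x) \<otimes> inv g \<in> J" by (rule J_conj[OF gJt])
          then have "x \<otimes> inv g \<in> J" using gc x by (simp add: mult_inv_cancel)
          then show False using False small.coset_eq_iff[OF x gc] by simp
        qed
        then show ?thesis
          using False linear_between_zero[OF \<iota>_linear small.space] big.act_zero[OF gJt]
          by (simp add: small.bump_def)
      qed
    qed
    have L: "?L (small.bump w) x = (\<Sum>g\<in>R. if ?q g = ?q x then s x *\<^sub>C act \<rho>t x (\<iota> w) else 0)"
      using summand by (intro sum.cong) auto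
    show ?thesis
    proof (cases "x \<in> ?S")
      case True
      then have "?q x \<in> ?q ` R" unfolding R(3)[symmetric] by (rule imageI)
      then obtain r where r: "?q x = ?q r" "r \<in> R" by (rule imageE)
      have "?L (small.bump w) x = (\<Sum>g\<in>R. if g = r then s x *\<^sub>C act \<rho>t x (\<iota> w) else 0)"
        unfolding L using r inj_onD[OF R(2)] by (intro sum.cong) auto
      then show ?thesis using r(2) finR s[of x w] True w by simp
    next
      case False
      have "?L (small.bump w) x = 0"
        unfolding L
      proof (rule sum.neutral, rule ballI)
        fix g assume g: "g \<in> R"
        have "s x = 0" if "?q g = ?q x"
        proof -
          have "x \<otimes> inv g \<in> J" using small.coset_eq_iff[OF x Jt_carrier[OF RJt[OF g]]] that by simp
          then have "x \<otimes> inv g \<otimes> g \<in> Jt" using Jt_mult[OF J_Jt RJt[OF g]] by simp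
          then have "x \<in> Jt" using x Jt_carrier[OF RJt[OF g]] by (simp add: m_assoc)
          then show ?thesis using False by simp
        qed
        then show "(if ?q g = ?q x then s x *\<^sub>C act \<rho>t x (\<iota> w) else 0) = 0" by simp
      qed
      moreover have "\<iota> (a (small.bump w) x) = 0"
      proof (cases "x \<in> Jt")
        case True
        then show ?thesis using s[OF True w] False by simp
      next
        case False
        then show ?thesis using outside[OF x False w] linear_between_zero[OF \<iota>_linear small.space] by simp
      qed
      ultimately show ?thesis by simp
    qed
  qed
  let ?P = "{f \<in> rspace I. \<forall>x\<in>carrier G. \<iota> (a f x) = ?L f x}"
  have ginv: "inv g \<otimes> x \<in> carrier G" if "g \<in> R" "x \<in> carrier G" for g x
    using Jt_carrier[OF RJt[OF that(1)]] that(2) by simp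
  have P: "csubspace ?P"
  proof (rule complex_vector.subspaceI)
    have "\<iota> (0 :: 'v) = 0" using linear_between_zero[OF \<iota>_linear small.space] .
    then show "0 \<in> ?P"
      using complex_vector.subspace_0[OF small.subspace_Ind] linear_between_zero[OF alin small.subspace_Ind]
        big.act_zero[OF RJt] by simp
  next
    fix f f' assume "f \<in> ?P" "f' \<in> ?P"
    then have f: "f \<in> rspace I" "\<And>x. x \<in> carrier G \<Longrightarrow> \<iota> (a f x) = ?L f x"
      and f': "f' \<in> rspace I" "\<And>x. x \<in> carrier G \<Longrightarrow> \<iota> (a f' x) = ?L f' x" by simp_all
    have "\<iota> (a (f + f') x) = ?L (f + f') x" if x: "x \<in> carrier G" for x
    proof -
      have "\<iota> (a (f + f') x) = \<iota> (a f x) + \<iota> (a f' x)"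
        using linear_betweenD(2)[OF alin f(1) f'(1)]
          linear_betweenD(2)[OF \<iota>_linear small.IndD(1)[OF linear_betweenD(1)[OF alin f(1)] x] small.IndD(1)[OF linear_betweenD(1)[OF alin f'(1)] x]]
        by simp
      also have "\<dots> = ?L f x + ?L f' x" using f(2)[OF x] f'(2)[OF x] by simp
      also have "\<dots> = ?L (f + f') x"
        unfolding sum.distrib[symmetric]
      proof (rule sum.cong[OF refl])
        fix g assume g: "g \<in> R"
        note v = small.IndD(1)[OF f(1) ginv[OF g x]] small.IndD(1)[OF f'(1) ginv[OF g x]]
        show "s g *\<^sub>C act \<rho>t g (\<iota> (f (inv g \<otimes> x))) + s g *\<^sub>C act \<rho>t g (\<iota> (f' (inv g \<otimes> x))) =
            s g *\<^sub>C act \<rho>t g (\<iota> ((f + f') (inv g \<otimes> x)))"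
          using linear_betweenD(2)[OF \<iota>_linear v] linear_betweenD(2)[OF restriction.act_linear[OF RJt[OF g]] \<iota>V[OF v(1)] \<iota>V[OF v(2)]]
          by (simp add: scaleC_add_right)
      qed
      finally show ?thesis .
    qed
    then show "f + f' \<in> ?P" using complex_vector.subspace_add[OF small.subspace_Ind f(1) f'(1)] by simp
  next
    fix c f assume "f \<in> ?P"
    then have f: "f \<in> rspace I" "\<And>x. x \<in> carrier G \<Longrightarrow> \<iota> (a f x) = ?L f x" by simp_all
    have "\<iota> (a (c *\<^sub>C f) x) = ?L (c *\<^sub>C f) x" if x: "x \<in> carrier G" for x
    proof -
      have "\<iota> (a (c *\<^sub>C f) x) = c *\<^sub>C \<iota> (a f x)"
        using linear_betweenD(3)[OF alin f(1)]
          linear_betweenD(3)[OF \<iota>_linear small.IndD(1)[OF linear_betweenD(1)[OF alin f(1)] x]]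
        by (simp add: scaleC_fun_def)
      also have "\<dots> = c *\<^sub>C ?L f x" using f(2)[OF x] by simp
      also have "\<dots> = ?L (c *\<^sub>C f) x"
        unfolding complex_vector.scale_sum_right
      proof (rule sum.cong[OF refl])
        fix g assume g: "g \<in> R"
        note v = small.IndD(1)[OF f(1) ginv[OF g x]]
        show "c *\<^sub>C s g *\<^sub>C act \<rho>t g (\<iota> (f (inv g \<otimes> x))) = s g *\<^sub>C act \<rho>t g (\<iota> ((c *\<^sub>C f) (inv g \<otimes> x)))"
          using linear_betweenD(3)[OF \<iota>_linear v] linear_betweenD(3)[OF restriction.act_linear[OF RJt[OF g]] \<iota>V[OF v]]
          by (simp add: scaleC_fun_def scaleC_scaleC mult.commute)
      qed
      finally show ?thesis .
    qed
    then show "c *\<^sub>C f \<in> ?P" using complex_vector.subspace_scale[OF small.subspace_Ind f(1)] by simp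
  qed
  have gen: "act I y (small.bump w) \<in> ?P" if y: "y \<in> carrier G" and w: "w \<in> rspace \<rho>" for y w
  proof -
    note bI = small.bump_in_Ind[OF w]
    have "\<iota> (a (act I y (small.bump w)) x) = ?L (act I y (small.bump w)) x" if x: "x \<in> carrier G" for x
    proof -
      have "\<iota> (a (act I y (small.bump w)) x) = \<iota> (a (small.bump w) (x \<otimes> y))"
        using equivariantD(2)[OF a_eq y bI] x by (simp add: small.act_Ind)
      also have "\<dots> = ?L (small.bump w) (x \<otimes> y)" using base[OF w] x y by simp
      also have "\<dots> = ?L (act I y (small.bump w)) x"
      proof (rule sum.cong[OF refl])
        fix g assume g: "g \<in> R"
        show "s g *\<^sub>C act \<rho>t g (\<iota> (small.bump w (inv g \<otimes> (x \<otimes> y)))) =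
            s g *\<^sub>C act \<rho>t g (\<iota> (act I y (small.bump w) (inv g \<otimes> x)))"
          using ginv[OF g x] Jt_carrier[OF RJt[OF g]] x y by (simp add: small.act_Ind m_assoc)
      qed
      finally show ?thesis .
    qed
    then show ?thesis using small.act_Ind_closed[OF y bI] by simp
  qed
  have "f \<in> ?P" if f: "f \<in> rspace I" for f
  proof -
    obtain R' where R': "R' \<subseteq> carrier G" "f = (\<Sum>r\<in>R'. act I (inv r) (small.bump (f r)))"
      using small.Ind_decomposition[OF f] by auto
    have "act I (inv r) (small.bump (f r)) \<in> ?P" if "r \<in> R'" for r
    proof -
      have rc: "r \<in> carrier G" using R'(1) that by blast
      show ?thesis by (rule gen[OF inv_closed[OF rc] small.IndD(1)[OF f rc]])
    qed
    then show ?thesis by (subst R'(2)) (rule complex_vector.subspace_sum[OF P])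
  qed
  then have "\<forall>f\<in>rspace I. \<forall>x\<in>carrier G. \<iota> (a f x) = ?L f x" by blast
  moreover have "R \<subseteq> Jt" using RJt by (rule subsetI)
  ultimately show ?thesis using finR by (intro exI[of _ R] exI[of _ s] conjI)
qed

text \<open>In the expansion of both products by \<open>hecke_formula\<close> the operators of \<open>g\<close> and \<open>h\<close> commute, since the commutator
  of \<open>g\<close> and \<open>h\<close> lies in \<open>J\<close>, under which the functions are equivariant.\<close>

lemma multiplicity_free_imp_commutative:
  assumes mf: "multiplicity_free J \<rho>t" and a: "a \<in> carrier hecke" and b: "b \<in> carrier hecke"
  shows "a \<otimes>\<^bsub>hecke\<^esub> b = b \<otimes>\<^bsub>hecke\<^esub> a"
proof -
  obtain R s where R: "finite R" "R \<subseteq> Jt" and a_formula: "\<And>f x. f \<in> rspace I \<Longrightarrow> x \<in> carrier G \<Longrightarrow>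
      \<iota> (a f x) = (\<Sum>g\<in>R. s g *\<^sub>C act \<rho>t g (\<iota> (f (inv g \<otimes> x))))"
    using hecke_formula[OF mf a] by blast
  obtain R' s' where R': "finite R'" "R' \<subseteq> Jt" and b_formula: "\<And>f x. f \<in> rspace I \<Longrightarrow> x \<in> carrier G \<Longrightarrow>
      \<iota> (b f x) = (\<Sum>g\<in>R'. s' g *\<^sub>C act \<rho>t g (\<iota> (f (inv g \<otimes> x))))"
    using hecke_formula[OF mf b] by blast
  have alin: "linear_between (rspace I) (rspace I) a" and blin: "linear_between (rspace I) (rspace I) b"
    using a b equivariantD(1)[of "carrier G" I I] by (simp_all add: carrier_hecke)
  have \<iota>V: "\<iota> w \<in> rspace \<rho>t" if "w \<in> rspace \<rho>" for w using linear_betweenD(1)[OF \<iota>_linear that] .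
  define K where "K f x g h = act \<rho>t g (act \<rho>t h (\<iota> (f (inv h \<otimes> (inv g \<otimes> x)))))" for f x g h
  have K_commute: "K f x g h = K f x h g"
    if f: "f \<in> rspace I" and x: "x \<in> carrier G" and g: "g \<in> Jt" and h: "h \<in> Jt" for f x g h
  proof -
    note car = x Jt_carrier[OF g] Jt_carrier[OF h]
    let ?c = "inv g \<otimes> inv h \<otimes> inv (inv g) \<otimes> inv (inv h)" and ?y = "inv h \<otimes> (inv g \<otimes> x)"
    have c: "?c \<in> J" using J_commutator[OF Jt_inv[OF g] Jt_inv[OF h]] .
    have y: "?y \<in> carrier G" using car by simp
    note fy = \<iota>V[OF small.IndD(1)[OF f y]]
    have "inv g \<otimes> (inv h \<otimes> x) = ?c \<otimes> ?y" using car by (simp add: m_assoc mult_inv_cancel)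
    then have "\<iota> (f (inv g \<otimes> (inv h \<otimes> x))) = act \<rho>t ?c (\<iota> (f ?y))"
      using small.IndD(3)[OF f c y] equivariantD(2)[OF \<iota>_equivariant c small.IndD(1)[OF f y]] by simp
    then have "K f x h g = act \<rho>t h (act \<rho>t g (act \<rho>t ?c (\<iota> (f ?y))))" by (simp add: K_def)
    also have "\<dots> = act \<rho>t (h \<otimes> (g \<otimes> ?c)) (\<iota> (f ?y))"
      using big.act_comp[OF g J_Jt[OF c] fy] big.act_comp[OF h Jt_mult[OF g J_Jt[OF c]] fy] by simp
    also have "h \<otimes> (g \<otimes> ?c) = g \<otimes> h" using car by (simp add: m_assoc mult_inv_cancel)
    also have "act \<rho>t (g \<otimes> h) (\<iota> (f ?y)) = K f x g h"
      using big.act_comp[OF g h fy] by (simp add: K_def)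
    finally show ?thesis by simp
  qed
  have expand: "\<iota> (p (q f) x) = (\<Sum>g\<in>S. \<Sum>h\<in>S'. (t g * t' h) *\<^sub>C K f x g h)"
    if S: "S \<subseteq> Jt" "S' \<subseteq> Jt" and q: "linear_between (rspace I) (rspace I) q"
      and pf: "\<And>f x. f \<in> rspace I \<Longrightarrow> x \<in> carrier G \<Longrightarrow>
        \<iota> (p f x) = (\<Sum>g\<in>S. t g *\<^sub>C act \<rho>t g (\<iota> (f (inv g \<otimes> x))))"
      and qf: "\<And>f x. f \<in> rspace I \<Longrightarrow> x \<in> carrier G \<Longrightarrow>
        \<iota> (q f x) = (\<Sum>g\<in>S'. t' g *\<^sub>C act \<rho>t g (\<iota> (f (inv g \<otimes> x))))"
      and f: "f \<in> rspace I" and x: "x \<in> carrier G" for p q S S' t t' f x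
  proof -
    have "\<iota> (p (q f) x) = (\<Sum>g\<in>S. t g *\<^sub>C act \<rho>t g (\<iota> (q f (inv g \<otimes> x))))"
      using pf[OF linear_betweenD(1)[OF q f] x] .
    also have "\<dots> = (\<Sum>g\<in>S. \<Sum>h\<in>S'. (t g * t' h) *\<^sub>C K f x g h)"
    proof (rule sum.cong[OF refl])
      fix g assume "g \<in> S"
      then have g: "g \<in> Jt" using S(1) by blast
      have gx: "inv g \<otimes> x \<in> carrier G" using Jt_carrier[OF g] x by simp
      have hV: "act \<rho>t h (\<iota> (f (inv h \<otimes> (inv g \<otimes> x)))) \<in> rspace \<rho>t" if "h \<in> S'" for h
      proof -
        have h: "h \<in> Jt" using S(2) that by blast
        then have "inv h \<otimes> (inv g \<otimes> x) \<in> carrier G" using Jt_carrier gx by simp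
        then show ?thesis using big.act_closed[OF h \<iota>V[OF small.IndD(1)[OF f]]] by blast
      qed
      note glin = restriction.act_linear[OF g]
      have "act \<rho>t g (\<iota> (q f (inv g \<otimes> x))) = (\<Sum>h\<in>S'. t' h *\<^sub>C K f x g h)"
        unfolding qf[OF f gx] K_def
        using linear_between_sum[OF glin big.space, of S' "\<lambda>h. t' h *\<^sub>C act \<rho>t h (\<iota> (f (inv h \<otimes> (inv g \<otimes> x))))"]
          hV big.space by (simp add: complex_vector.subspace_scale linear_betweenD(3)[OF glin])
      then show "t g *\<^sub>C act \<rho>t g (\<iota> (q f (inv g \<otimes> x))) = (\<Sum>h\<in>S'. (t g * t' h) *\<^sub>C K f x g h)"
        by (simp add: complex_vector.scale_sum_right scaleC_scaleC)
    qed
    finally show ?thesis .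
  qed
  have "a (b f) x = b (a f) x" if f: "f \<in> rspace I" for f x
  proof (cases "x \<in> carrier G")
    case x: True
    have "\<iota> (a (b f) x) = (\<Sum>g\<in>R. \<Sum>h\<in>R'. (s g * s' h) *\<^sub>C K f x g h)"
      by (rule expand[OF R(2) R'(2) blin a_formula b_formula f x])
    also have "\<dots> = (\<Sum>h\<in>R'. \<Sum>g\<in>R. (s g * s' h) *\<^sub>C K f x g h)" by (rule sum.swap)
    also have "\<dots> = (\<Sum>h\<in>R'. \<Sum>g\<in>R. (s' h * s g) *\<^sub>C K f x h g)"
    proof (intro sum.cong refl)
      fix h g assume "h \<in> R'" "g \<in> R"
      then have "K f x g h = K f x h g" using K_commute[OF f x] R(2) R'(2) by blast
      then show "(s g * s' h) *\<^sub>C K f x g h = (s' h * s g) *\<^sub>C K f x h g" by (simp add: mult.commute)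
    qed
    also have "\<dots> = \<iota> (b (a f) x)"
      by (rule expand[OF R'(2) R(2) alin b_formula a_formula f x, symmetric])
    finally have "\<iota> (a (b f) x) = \<iota> (b (a f) x)" .
    moreover have "a (b f) x \<in> rspace \<rho>" "b (a f) x \<in> rspace \<rho>"
      by (rule small.IndD(1)[OF linear_betweenD(1)[OF alin linear_betweenD(1)[OF blin f]] x]
        small.IndD(1)[OF linear_betweenD(1)[OF blin linear_betweenD(1)[OF alin f]] x])+
    ultimately show ?thesis using \<iota>_inj by (rule inj_onD[rotated])
  next
    case False
    then show ?thesis
      using small.IndD(2)[OF linear_betweenD(1)[OF alin linear_betweenD(1)[OF blin f]] False]
        small.IndD(2)[OF linear_betweenD(1)[OF blin linear_betweenD(1)[OF alin f]] False] by simp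
  qed
  then show ?thesis unfolding mult_hecke by (auto simp: compose_def fun_eq_iff)
qed

end

context cuspidal_data
begin

subsection \<open>Twisted intertwiners\<close>

text \<open>A homomorphism from \<open>\<rho>\<close> to its conjugate by \<open>g\<^sup>-\<^sup>1\<close>. The zero map is allowed.\<close>

definition twisted :: "'a \<Rightarrow> ('v \<Rightarrow> 'v) \<Rightarrow> bool"
  where "twisted g a \<longleftrightarrow> g \<in> Jt \<and> linear_between (rspace \<rho>) (rspace \<rho>) a \<and>
    (\<forall>j\<in>J. \<forall>w\<in>rspace \<rho>. a (act \<rho> j w) = act \<rho> (g \<otimes> j \<otimes> inv g) (a w))"

lemma twistedD:
  assumes "twisted g a"
  shows "g \<in> Jt" "linear_between (rspace \<rho>) (rspace \<rho>) a"
    "j \<in> J \<Longrightarrow> w \<in> rspace \<rho> \<Longrightarrow> a (act \<rho> j w) = act \<rho> (g \<otimes> j \<otimes> inv g) (a w)"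
  using assms by (simp_all add: twisted_def)

text \<open>If \<open>\<beta>\<close> has values in the translate by \<open>k\<close> of the image of \<open>\<alpha>\<close>, then \<open>\<beta>\<close> is a twist of \<open>\<alpha>\<close>: undo the
  translation and the embedding.\<close>

lemma twisted_transport:
  assumes k: "k \<in> Jt" and \<alpha>: "equivariant J \<rho> \<rho>t \<alpha>" "inj_on \<alpha> (rspace \<rho>)" and \<beta>: "equivariant J \<rho> \<rho>t \<beta>"
    and sub: "\<beta> ` rspace \<rho> \<subseteq> act \<rho>t k ` \<alpha> ` rspace \<rho>"
  obtains a where "twisted (inv k) a" "\<And>w. w \<in> rspace \<rho> \<Longrightarrow> act \<rho>t k (\<alpha> (a w)) = \<beta> w"
proof -
  let ?V = "rspace \<rho>"
  note ki = Jt_inv[OF k] and kc = Jt_carrier[OF k]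
  note \<alpha>lin = equivariantD(1)[OF \<alpha>(1)] and \<beta>lin = equivariantD(1)[OF \<beta>]
  have inv\<alpha>: "equivariant J (\<rho>t\<lparr>rspace := \<alpha> ` ?V\<rparr>) \<rho> (inv_into ?V \<alpha>)"
    using \<rho>_linear_action \<alpha> by (rule equivariant_inv_into)
  note inv\<alpha>lin = equivariantD(1)[OF inv\<alpha>, simplified]
  have \<beta>V: "\<beta> w \<in> rspace \<rho>t" if "w \<in> ?V" for w using linear_betweenD(1)[OF \<beta>lin that] .
  define c where "c w = act \<rho>t (inv k) (\<beta> w)" for w
  have c\<alpha>: "c w \<in> \<alpha> ` ?V" if w: "w \<in> ?V" for w
  proof -
    have "\<beta> w \<in> act \<rho>t k ` \<alpha> ` ?V" using sub w by blast
    then obtain u where "u \<in> ?V" "\<beta> w = act \<rho>t k (\<alpha> u)" by blast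
    then show ?thesis
      using restriction.act_inv(1)[OF k linear_betweenD(1)[OF \<alpha>lin]] by (simp add: c_def)
  qed
  have clin: "linear_between ?V (\<alpha> ` ?V) c"
    using c\<alpha> by (intro linear_betweenI)
      (simp_all add: c_def linear_betweenD[OF \<beta>lin] linear_betweenD(2,3)[OF restriction.act_linear[OF ki]])
  define a where "a w = inv_into ?V \<alpha> (c w)" for w
  have "linear_between ?V ?V a"
    by (intro linear_betweenI) (simp_all add: a_def linear_betweenD[OF clin] linear_betweenD[OF inv\<alpha>lin])
  moreover have "a (act \<rho> j w) = act \<rho> (inv k \<otimes> j \<otimes> inv (inv k)) (a w)" if j: "j \<in> J" and w: "w \<in> ?V" for j w
  proof -
    have i: "inv k \<otimes> j \<otimes> inv (inv k) \<in> J" using J_conj[OF ki j] .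
    have "c (act \<rho> j w) = act \<rho>t (inv k \<otimes> j) (\<beta> w)"
      using equivariantD(2)[OF \<beta> j w] big.act_comp[OF ki J_Jt[OF j] \<beta>V[OF w]] by (simp add: c_def)
    also have "inv k \<otimes> j = (inv k \<otimes> j \<otimes> inv (inv k)) \<otimes> inv k"
      using kc J_carrier[OF j] by (simp add: m_assoc)
    also have "act \<rho>t \<dots> (\<beta> w) = act \<rho>t (inv k \<otimes> j \<otimes> inv (inv k)) (c w)"
      using big.act_comp[OF J_Jt[OF i] ki \<beta>V[OF w]] by (simp add: c_def)
    finally show ?thesis
      using equivariantD(2)[OF inv\<alpha> i, simplified, OF c\<alpha>[OF w]] by (simp add: a_def)
  qed
  ultimately have "twisted (inv k) a" using ki by (simp add: twisted_def)
  moreover have "act \<rho>t k (\<alpha> (a w)) = \<beta> w" if "w \<in> ?V" for w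
    using f_inv_into_f[OF c\<alpha>[OF that]] restriction.act_inv(2)[OF k \<beta>V[OF that]] by (simp add: a_def c_def)
  ultimately show thesis by (rule that)
qed

text \<open>The element of the Hecke algebra supported on the coset \<open>g J\<close> with value \<open>a\<close> at \<open>g\<close>.\<close>

definition hecke_operator :: "'a \<Rightarrow> ('v \<Rightarrow> 'v) \<Rightarrow> ('a \<Rightarrow> 'v) \<Rightarrow> 'a \<Rightarrow> 'v"
  where "hecke_operator g a = (\<lambda>f\<in>rspace I. \<lambda>x. if x \<in> carrier G then a (f (inv g \<otimes> x)) else 0)"

lemma hecke_operator_apply:
  "f \<in> rspace I \<Longrightarrow> x \<in> carrier G \<Longrightarrow> hecke_operator g a f x = a (f (inv g \<otimes> x))"
  by (simp add: hecke_operator_def)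

lemma hecke_operator_closed:
  assumes tw: "twisted g a"
  shows "hecke_operator g a \<in> carrier hecke"
proof -
  note g = twistedD(1)[OF tw] and alin = twistedD(2)[OF tw]
  note gc = Jt_carrier[OF g]
  let ?\<theta> = "hecke_operator g a"
  have a0: "a 0 = 0" using linear_between_zero[OF alin small.space] .
  have out: "?\<theta> f x = 0" if "f \<in> rspace I" "x \<notin> carrier G" for f x
    using that by (simp add: hecke_operator_def)
  have \<theta>I: "?\<theta> f \<in> rspace I" if f: "f \<in> rspace I" for f
    unfolding small.Ind_iff
  proof (intro conjI ballI allI impI)
    have gx: "inv g \<otimes> x \<in> carrier G" if "x \<in> carrier G" for x using gc that by simp
    show "?\<theta> f x \<in> rspace \<rho>" if x: "x \<in> carrier G" for x
      using linear_betweenD(1)[OF alin small.IndD(1)[OF f gx[OF x]]] hecke_operator_apply[OF f x] by simp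
    show "?\<theta> f x = 0" if "x \<notin> carrier G" for x using out[OF f that] .
    show "?\<theta> f (j \<otimes> x) = act \<rho> j (?\<theta> f x)" if j: "j \<in> J" and x: "x \<in> carrier G" for j x
    proof -
      note jc = J_carrier[OF j] and i = J_conj'[OF g j]
      have "inv g \<otimes> (j \<otimes> x) = (inv g \<otimes> j \<otimes> g) \<otimes> (inv g \<otimes> x)"
        using gc jc x by (simp add: m_assoc mult_inv_cancel)
      then have "?\<theta> f (j \<otimes> x) = a (act \<rho> (inv g \<otimes> j \<otimes> g) (f (inv g \<otimes> x)))"
        using hecke_operator_apply[OF f, of "j \<otimes> x"] small.IndD(3)[OF f i gx[OF x]] jc x by simp
      also have "\<dots> = act \<rho> (g \<otimes> (inv g \<otimes> j \<otimes> g) \<otimes> inv g) (a (f (inv g \<otimes> x)))"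
        using twistedD(3)[OF tw i small.IndD(1)[OF f gx[OF x]]] .
      also have "g \<otimes> (inv g \<otimes> j \<otimes> g) \<otimes> inv g = j" using gc jc by (simp add: m_assoc mult_inv_cancel)
      finally show ?thesis using hecke_operator_apply[OF f x] by simp
    qed
    obtain K where K: "subgroup K G" "openin T K" "\<And>x k. x \<in> carrier G \<Longrightarrow> k \<in> K \<Longrightarrow> f (x \<otimes> k) = f x"
      using small.IndD(4)[OF f] by auto
    have "?\<theta> f (x \<otimes> k) = ?\<theta> f x" if x: "x \<in> carrier G" and k: "k \<in> K" for x k
    proof -
      have kc: "k \<in> carrier G" using subgroup.subset[OF K(1)] k by blast
      show ?thesis
        using hecke_operator_apply[OF f x, of g a] hecke_operator_apply[OF f, of "x \<otimes> k" g a]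
          K(3)[OF gx[OF x] k] gc x kc by (simp add: m_assoc)
    qed
    then show "\<exists>K. subgroup K G \<and> openin T K \<and> (\<forall>x\<in>carrier G. \<forall>k\<in>K. ?\<theta> f (x \<otimes> k) = ?\<theta> f x)"
      using K(1,2) by blast
    let ?S = "{x \<in> carrier G. ?\<theta> f x \<noteq> 0}"
    have "(\<lambda>x. J #> (inv g \<otimes> x)) ` ?S \<subseteq> (\<lambda>x. J #> x) ` {x \<in> carrier G. f x \<noteq> 0}"
    proof
      fix C assume "C \<in> (\<lambda>x. J #> (inv g \<otimes> x)) ` ?S"
      then obtain x where x: "x \<in> carrier G" "?\<theta> f x \<noteq> 0" "C = J #> (inv g \<otimes> x)" by blast
      have "f (inv g \<otimes> x) \<noteq> 0" using x(2) hecke_operator_apply[OF f x(1), of g a] a0 by auto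
      then show "C \<in> (\<lambda>x. J #> x) ` {x \<in> carrier G. f x \<noteq> 0}" using x(3) gx[OF x(1)] by blast
    qed
    then have "finite ((\<lambda>x. J #> (inv g \<otimes> x)) ` ?S)"
      using small.IndD(5)[OF f] by (rule finite_subset)
    then show "finite ((\<lambda>x. J #> x) ` ?S)"
    proof (rule finite_image_factor)
      fix x y assume "x \<in> ?S" "y \<in> ?S" and eq: "J #> (inv g \<otimes> x) = J #> (inv g \<otimes> y)"
      then have c: "x \<in> carrier G" "y \<in> carrier G" by simp_all
      have "(inv g \<otimes> x) \<otimes> inv (inv g \<otimes> y) \<in> J"
        using eq small.coset_eq_iff[OF gx[OF c(1)] gx[OF c(2)]] by simp
      then have "g \<otimes> ((inv g \<otimes> x) \<otimes> inv (inv g \<otimes> y)) \<otimes> inv g \<in> J" by (rule J_conj[OF g])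
      also have "g \<otimes> ((inv g \<otimes> x) \<otimes> inv (inv g \<otimes> y)) \<otimes> inv g = x \<otimes> inv y"
        using gc c by (simp add: m_assoc inv_mult_group mult_inv_cancel)
      finally show "J #> x = J #> y" using small.coset_eq_iff[OF c] by simp
    qed
  qed
  have "linear_between (rspace I) (rspace I) ?\<theta>"
  proof (rule linear_betweenI)
    show "?\<theta> f \<in> rspace I" if "f \<in> rspace I" for f using that by (rule \<theta>I)
    show "?\<theta> (f + f') = ?\<theta> f + ?\<theta> f'" if f: "f \<in> rspace I" "f' \<in> rspace I" for f f'
    proof
      show "?\<theta> (f + f') x = (?\<theta> f + ?\<theta> f') x" for x
        using f complex_vector.subspace_add[OF small.subspace_Ind f] gc
        by (cases "x \<in> carrier G")
          (simp_all add: hecke_operator_apply linear_betweenD(2)[OF alin] small.IndD(1) out)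
    qed
    show "?\<theta> (c *\<^sub>C f) = c *\<^sub>C ?\<theta> f" if f: "f \<in> rspace I" for c f
    proof
      show "?\<theta> (c *\<^sub>C f) x = (c *\<^sub>C ?\<theta> f) x" for x
        using f complex_vector.subspace_scale[OF small.subspace_Ind f] gc
        by (cases "x \<in> carrier G")
          (simp_all add: hecke_operator_apply linear_betweenD(3)[OF alin] small.IndD(1) out scaleC_fun_def)
    qed
  qed
  moreover have "?\<theta> (act I y f) = act I y (?\<theta> f)" if y: "y \<in> carrier G" and f: "f \<in> rspace I" for y f
  proof
    show "?\<theta> (act I y f) x = act I y (?\<theta> f) x" for x
      using hecke_operator_apply[OF small.act_Ind_closed[OF y f], of x g a] hecke_operator_apply[OF f, of "x \<otimes> y" g a]
        out[OF small.act_Ind_closed[OF y f], of x] y gc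
      by (cases "x \<in> carrier G") (simp_all add: small.act_Ind m_assoc)
  qed
  ultimately show ?thesis
    by (simp add: carrier_hecke equivariant_def hecke_operator_def)
qed

text \<open>Apply the two products of the Hecke operators to the function supported on \<open>J\<close> with value \<open>w\<close> at \<open>1\<close>, and evaluate at
  \<open>h g\<close>.\<close>

lemma commutative_imp_twisted_commute:
  assumes comm: "\<forall>a\<in>carrier hecke. \<forall>b\<in>carrier hecke. a \<otimes>\<^bsub>hecke\<^esub> b = b \<otimes>\<^bsub>hecke\<^esub> a"
    and a: "twisted g a" and b: "twisted h b" and w: "w \<in> rspace \<rho>"
  shows "b (a w) = a (b (act \<rho> (inv h \<otimes> inv g \<otimes> h \<otimes> g) w))"
proof -
  note g = twistedD(1)[OF a] and h = twistedD(1)[OF b]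
  note car = Jt_carrier[OF g] Jt_carrier[OF h]
  let ?\<theta> = "hecke_operator g a" and ?\<eta> = "hecke_operator h b" and ?f = "small.bump w"
  note \<theta> = hecke_operator_closed[OF a] and \<eta> = hecke_operator_closed[OF b]
  note f = small.bump_in_Ind[OF w]
  have \<theta>f: "?\<theta> ?f \<in> rspace I" and \<eta>f: "?\<eta> ?f \<in> rspace I"
    using \<theta> \<eta> linear_betweenD(1)[OF equivariantD(1)[of "carrier G" I I] f] by (simp_all add: carrier_hecke)
  let ?x = "h \<otimes> g" and ?c = "inv h \<otimes> inv g \<otimes> h \<otimes> g"
  have c: "?c \<in> J" using J_commutator[OF Jt_inv[OF h] Jt_inv[OF g]] car by simp
  have "?\<theta> \<otimes>\<^bsub>hecke\<^esub> ?\<eta> = ?\<eta> \<otimes>\<^bsub>hecke\<^esub> ?\<theta>" using comm \<theta> \<eta> by blast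
  from fun_cong[OF this, of ?f] have "?\<theta> (?\<eta> ?f) = ?\<eta> (?\<theta> ?f)"
    unfolding mult_hecke compose_eq[OF f] .
  then have "?\<theta> (?\<eta> ?f) ?x = ?\<eta> (?\<theta> ?f) ?x" by (rule fun_cong)
  moreover have "?\<theta> (?\<eta> ?f) ?x = a (b (?f ?c))"
    using car by (simp add: hecke_operator_apply[OF \<eta>f] hecke_operator_apply[OF f] m_assoc)
  moreover have "?\<eta> (?\<theta> ?f) ?x = b (a w)"
    using car by (simp add: hecke_operator_apply[OF \<theta>f] hecke_operator_apply[OF f] mult_inv_cancel small.bump_one[OF w])
  ultimately show ?thesis using c by (simp add: small.bump_def)
qed

subsection \<open>The multiplicity space\<close>

text \<open>The homomorphisms from \<open>\<rho>\<close> to \<open>\<rho>t\<close> over \<open>J\<close>, extended by zero so that they form a vector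
  space of functions.\<close>

definition M :: "('v \<Rightarrow> 'v) set"
  where "M = {\<phi>. equivariant J \<rho> \<rho>t \<phi> \<and> (\<forall>x. x \<notin> rspace \<rho> \<longrightarrow> \<phi> x = 0)}"

text \<open>Translating and precomposing with a twisted intertwiner gives another homomorphism: the two conjugations by \<open>g\<close> cancel.\<close>

definition twist :: "'a \<times> ('v \<Rightarrow> 'v) \<Rightarrow> ('v \<Rightarrow> 'v) \<Rightarrow> 'v \<Rightarrow> 'v"
  where "twist q \<phi> = (\<lambda>w. if w \<in> rspace \<rho> then act \<rho>t (inv (fst q)) (\<phi> (snd q w)) else 0)"

definition Q :: "('a \<times> ('v \<Rightarrow> 'v)) set"
  where "Q = {(g, a). twisted g a}"

text \<open>Recording the twists as the action of a representation, although the pairs \<open>(g, a)\<close> do not form a group, makes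
  irreducibility and Schur's lemma available for \<open>M\<close>.\<close>

definition multiplicity_rep :: "('a \<times> ('v \<Rightarrow> 'v), 'v \<Rightarrow> 'v) rep"
  where "multiplicity_rep = \<lparr>rspace = M, act = twist\<rparr>"

lemma multiplicity_rep_simps: "rspace multiplicity_rep = M" "act multiplicity_rep = twist"
  by (simp_all add: multiplicity_rep_def)

lemma M_D:
  assumes "\<phi> \<in> M"
  shows "equivariant J \<rho> \<rho>t \<phi>" "linear_between (rspace \<rho>) (rspace \<rho>t) \<phi>" "x \<notin> rspace \<rho> \<Longrightarrow> \<phi> x = 0"
    "w \<in> rspace \<rho> \<Longrightarrow> \<phi> w \<in> rspace \<rho>t"
  using assms equivariantD(1)[of J \<rho> \<rho>t \<phi>] linear_betweenD(1)[of "rspace \<rho>" "rspace \<rho>t" \<phi>] by (auto simp: M_def)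

lemma M_eqI: "\<phi> \<in> M \<Longrightarrow> \<psi> \<in> M \<Longrightarrow> (\<And>w. w \<in> rspace \<rho> \<Longrightarrow> \<phi> w = \<psi> w) \<Longrightarrow> \<phi> = \<psi>"
proof
  fix x assume "\<phi> \<in> M" "\<psi> \<in> M" "\<And>w. w \<in> rspace \<rho> \<Longrightarrow> \<phi> w = \<psi> w"
  then show "\<phi> x = \<psi> x" using M_D(3)[of \<phi> x] M_D(3)[of \<psi> x] by (cases "x \<in> rspace \<rho>") auto
qed

lemma M_subspace: "csubspace M"
proof (rule complex_vector.subspaceI)
  note Vt = big.space
  have act0: "act \<rho>t j 0 = 0" if "j \<in> J" for j using big.act_zero[OF J_Jt[OF that]] .
  show "0 \<in> M"
    using complex_vector.subspace_0[OF Vt] act0 by (auto simp: M_def equivariant_def linear_between_def)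
  fix \<phi> \<psi> assume \<phi>: "\<phi> \<in> M" and \<psi>: "\<psi> \<in> M"
  have "linear_between (rspace \<rho>) (rspace \<rho>t) (\<phi> + \<psi>)"
    using Vt by (intro linear_betweenI)
      (simp_all add: linear_betweenD[OF M_D(2)[OF \<phi>]] linear_betweenD[OF M_D(2)[OF \<psi>]]
        complex_vector.subspace_add scaleC_add_right)
  moreover have "(\<phi> + \<psi>) (act \<rho> j w) = act \<rho>t j ((\<phi> + \<psi>) w)" if "j \<in> J" "w \<in> rspace \<rho>" for j w
    using equivariantD(2)[OF M_D(1)[OF \<phi>] that] equivariantD(2)[OF M_D(1)[OF \<psi>] that]
      linear_betweenD(2)[OF restriction.act_linear[OF J_Jt[OF that(1)]] M_D(4)[OF \<phi> that(2)] M_D(4)[OF \<psi> that(2)]]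
    by simp
  ultimately show "\<phi> + \<psi> \<in> M" using M_D(3)[OF \<phi>] M_D(3)[OF \<psi>] by (simp add: M_def equivariant_def)
next
  fix c \<phi> assume \<phi>: "\<phi> \<in> M"
  have "linear_between (rspace \<rho>) (rspace \<rho>t) (c *\<^sub>C \<phi>)"
    using big.space by (intro linear_betweenI)
      (simp_all add: linear_betweenD[OF M_D(2)[OF \<phi>]] complex_vector.subspace_scale scaleC_fun_def
        scaleC_add_right scaleC_scaleC mult.commute)
  moreover have "(c *\<^sub>C \<phi>) (act \<rho> j w) = act \<rho>t j ((c *\<^sub>C \<phi>) w)" if "j \<in> J" "w \<in> rspace \<rho>" for j w
    using equivariantD(2)[OF M_D(1)[OF \<phi>] that]
      linear_betweenD(3)[OF restriction.act_linear[OF J_Jt[OF that(1)]] M_D(4)[OF \<phi> that(2)]]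
    by (simp add: scaleC_fun_def)
  ultimately show "c *\<^sub>C \<phi> \<in> M" using M_D(3)[OF \<phi>] by (simp add: M_def equivariant_def scaleC_fun_def)
qed

lemma M_inj:
  assumes "\<phi> \<in> M" "\<phi> \<noteq> 0"
  shows "inj_on \<phi> (rspace \<rho>)"
proof -
  obtain w where w: "\<phi> w \<noteq> 0" using assms(2) by (auto simp: fun_eq_iff)
  then have "w \<in> rspace \<rho>" using M_D(3)[OF assms(1)] by blast
  then show ?thesis
    using equivariant_inj_on[OF \<rho>_linear_action \<rho>_rep(3) restriction.linear_action M_D(1)[OF assms(1)]] w by blast
qed

lemma M_image_irreducible:
  assumes "\<phi> \<in> M" "\<phi> \<noteq> 0"
  shows "irreducible_subrep J \<rho>t (\<phi> ` rspace \<rho>)"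
  using irreducible_subrep_image[OF \<rho>_linear_action \<rho>_rep(3) restriction.linear_action M_D(1)[OF assms(1)] M_inj[OF assms]] .

lemma M_image_subrep: "\<phi> \<in> M \<Longrightarrow> subrep J (\<phi> ` rspace \<rho>) \<rho>t"
  using subrep_image[OF \<rho>_linear_action M_D(1)] .

lemma twist_apply: "w \<in> rspace \<rho> \<Longrightarrow> twist (g, a) \<phi> w = act \<rho>t (inv g) (\<phi> (a w))"
  by (simp add: twist_def)

lemma twist_M:
  assumes tw: "twisted g a" and \<phi>: "\<phi> \<in> M"
  shows "twist (g, a) \<phi> \<in> M"
proof -
  note g = twistedD(1)[OF tw] and alin = twistedD(2)[OF tw]
  note gi = Jt_inv[OF g] and gc = Jt_carrier[OF g]
  note gilin = restriction.act_linear[OF gi] and \<phi>lin = M_D(2)[OF \<phi>]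
  note V = small.space
  have "linear_between (rspace \<rho>) (rspace \<rho>t) (twist (g, a) \<phi>)"
    using V by (intro linear_betweenI)
      (simp_all add: twist_apply complex_vector.subspace_add complex_vector.subspace_scale
        linear_betweenD[OF alin] linear_betweenD[OF \<phi>lin] linear_betweenD[OF gilin])
  moreover have "twist (g, a) \<phi> (act \<rho> j w) = act \<rho>t j (twist (g, a) \<phi> w)" if j: "j \<in> J" and w: "w \<in> rspace \<rho>" for j w
  proof -
    note gj = J_conj[OF g j] and aw = linear_betweenD(1)[OF alin w]
    have "twist (g, a) \<phi> (act \<rho> j w) = act \<rho>t (inv g) (act \<rho>t (g \<otimes> j \<otimes> inv g) (\<phi> (a w)))"
      using twist_apply[OF small.act_closed[OF j w]] twistedD(3)[OF tw j w] equivariantD(2)[OF M_D(1)[OF \<phi>] gj aw] by simp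
    also have "\<dots> = act \<rho>t (inv g \<otimes> (g \<otimes> j \<otimes> inv g)) (\<phi> (a w))"
      using big.act_comp[OF gi J_Jt[OF gj] M_D(4)[OF \<phi> aw]] by simp
    also have "inv g \<otimes> (g \<otimes> j \<otimes> inv g) = j \<otimes> inv g"
      using gc J_carrier[OF j] by (simp add: m_assoc mult_inv_cancel)
    also have "act \<rho>t (j \<otimes> inv g) (\<phi> (a w)) = act \<rho>t j (twist (g, a) \<phi> w)"
      using big.act_comp[OF J_Jt[OF j] gi M_D(4)[OF \<phi> aw]] twist_apply[OF w] by simp
    finally show ?thesis .
  qed
  ultimately show ?thesis by (simp add: M_def equivariant_def twist_def)
qed

lemma multiplicity_rep_linear: "linear_action Q multiplicity_rep"
proof -
  have "linear_between M M (twist (g, a))" if tw: "twisted g a" for g a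
  proof (rule linear_betweenI)
    note gilin = restriction.act_linear[OF Jt_inv[OF twistedD(1)[OF tw]]]
    note aV = linear_betweenD(1)[OF twistedD(2)[OF tw]]
    show "twist (g, a) \<phi> \<in> M" if "\<phi> \<in> M" for \<phi> using twist_M[OF tw that] .
    show "twist (g, a) (\<phi> + \<psi>) = twist (g, a) \<phi> + twist (g, a) \<psi>" if "\<phi> \<in> M" "\<psi> \<in> M" for \<phi> \<psi>
      using that by (auto simp: twist_def fun_eq_iff linear_betweenD(2)[OF gilin] M_D(4) aV)
    show "twist (g, a) (c *\<^sub>C \<phi>) = c *\<^sub>C twist (g, a) \<phi>" if "\<phi> \<in> M" for c \<phi>
      using that by (auto simp: twist_def fun_eq_iff linear_betweenD(3)[OF gilin] M_D(4) aV scaleC_fun_def)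
  qed
  then show ?thesis using M_subspace by (auto simp: linear_action_def multiplicity_rep_simps Q_def)
qed

text \<open>Schur's lemma for \<open>\<rho>\<close> shows that a homomorphism with values in the sum of the images of
  finitely many others is a linear combination of them. In the induction step the summand
  \<open>\<phi>1\<close> is independent of the sum \<open>C\<close> of the others, and a projection that kills \<open>C\<close> compares \<open>\<phi>\<close> with a multiple
  of \<open>\<phi>1\<close>.\<close>

lemma M_finite_span:
  assumes "finite F" "F \<subseteq> M" "w0 \<in> rspace \<rho>" "w0 \<noteq> 0"
  shows "\<phi> \<in> M \<Longrightarrow> \<phi> w0 \<in> cspan (\<Union>\<psi>\<in>F. \<psi> ` rspace \<rho>) \<Longrightarrow> \<phi> \<in> cspan F"
  using assms(1,2)
proof (induction F arbitrary: \<phi> rule: finite_induct)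
  case empty
  then have "\<phi> w0 = 0" by simp
  have "\<phi> = 0"
  proof (rule ccontr)
    assume "\<phi> \<noteq> 0"
    then have "inj_on \<phi> (rspace \<rho>)" using M_inj empty.prems(1) by blast
    then have "w0 = 0"
      using linear_between_inj_on_iff[OF M_D(2)[OF empty.prems(1)] small.space] \<open>\<phi> w0 = 0\<close> assms(3) by blast
    then show False using assms(4) by simp
  qed
  show ?case unfolding \<open>\<phi> = 0\<close> by (rule complex_vector.span_zero)
next
  case (insert \<phi>1 F)
  let ?V = "rspace \<rho>" and ?C = "cspan (\<Union>\<psi>\<in>F. \<psi> ` rspace \<rho>)"
  have FM: "F \<subseteq> M" and \<phi>1: "\<phi>1 \<in> M" using insert.prems(3) by auto
  have C: "subrep J ?C \<rho>t"
    using M_image_subrep FM by (intro subrep_span[OF restriction.linear_action]) auto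
  have sub: "cspan F \<subseteq> cspan (insert \<phi>1 F)" by (rule complex_vector.span_mono) auto
  have split: "(\<Union>\<psi>\<in>insert \<phi>1 F. \<psi> ` ?V) = \<phi>1 ` ?V \<union> (\<Union>\<psi>\<in>F. \<psi> ` ?V)" by simp
  note \<phi>1sub = subrepD(1)[OF M_image_subrep[OF \<phi>1]]
  have span_eq: "cspan (\<Union>\<psi>\<in>insert \<phi>1 F. \<psi> ` ?V) = cspan (\<phi>1 ` ?V \<union> ?C)"
    unfolding split complex_vector.span_Un complex_vector.span_span ..
  obtain u c where uc: "u \<in> ?V" "c \<in> ?C" "\<phi> w0 = \<phi>1 u + c"
    using insert.prems(2) unfolding span_eq span_union_subspaces[OF \<phi>1sub subrepD(1)[OF C]] by blast
  show ?case
  proof (cases "\<phi>1 w0 \<in> ?C")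
    case True
    have "\<phi>1 ` ?V \<subseteq> ?C"
    proof (cases "\<phi>1 = 0")
      case True
      then show ?thesis using complex_vector.span_zero[of "\<Union>\<psi>\<in>F. \<psi> ` ?V"] by auto
    next
      case False
      note inj = M_inj[OF \<phi>1 False]
      have nz: "\<phi>1 w0 \<noteq> 0"
        using linear_between_inj_on_iff[OF M_D(2)[OF \<phi>1] small.space] inj assms(3,4) by blast
      show ?thesis
      proof (rule ccontr)
        assume "\<not> \<phi>1 ` ?V \<subseteq> ?C"
        then have "?C \<inter> \<phi>1 ` ?V = {0}"
          using irreducible_not_subset_Int[OF M_image_irreducible[OF \<phi>1 False] C] by blast
        then show False using nz \<open>\<phi>1 w0 \<in> ?C\<close> assms(3) by blast
      qed
    qed
    then have "\<phi>1 u \<in> ?C" using uc(1) by blast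
    then have "\<phi> w0 \<in> ?C" unfolding uc(3) using uc(2) by (rule complex_vector.span_add)
    then show ?thesis using insert.IH[OF insert.prems(1) _ FM] sub by blast
  next
    case False
    have "rspace \<rho>t \<subseteq> cspan (?C \<union> \<Union>((\<lambda>p. act \<rho>t p ` W0) ` Jt))"
      using span_translates_W0 complex_vector.span_mono[of "\<Union>((\<lambda>p. act \<rho>t p ` W0) ` Jt)" "?C \<union> \<Union>((\<lambda>p. act \<rho>t p ` W0) ` Jt)"]
      by simp
    moreover have "irreducible_subrep J \<rho>t W" if "W \<in> (\<lambda>p. act \<rho>t p ` W0) ` Jt" for W
      using that restriction.translate_irreducible[OF _ W0_irreducible] by auto
    ultimately have "\<exists>W\<in>(\<lambda>p. act \<rho>t p ` W0) ` Jt. \<exists>p. equivariant J \<rho>t (\<rho>t\<lparr>rspace := W\<rparr>) p \<and>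
        (\<forall>a\<in>?C. p a = 0) \<and> p (\<phi>1 w0) \<noteq> 0"
      using M_D(4)[OF \<phi>1 assms(3)] C False
      by (intro semisimple_separation[OF restriction.linear_action])
    then obtain W p where W: "irreducible_subrep J \<rho>t W" and p: "equivariant J \<rho>t (\<rho>t\<lparr>rspace := W\<rparr>) p"
      and pC: "\<And>a. a \<in> ?C \<Longrightarrow> p a = 0" and pw: "p (\<phi>1 w0) \<noteq> 0"
      using restriction.translate_irreducible[OF _ W0_irreducible] by auto
    note plin = equivariantD(1)[OF p, simplified]
    note linW = linear_action_subrep[OF restriction.linear_action irreducible_subrepD(1)[OF W]]
    let ?q = "\<lambda>w. p (\<phi>1 w)"
    have q: "equivariant J \<rho> (\<rho>t\<lparr>rspace := W\<rparr>) ?q"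
      using M_D(1)[OF \<phi>1] p by (rule equivariant_compose)
    have q_inj: "inj_on ?q ?V"
      using equivariant_inj_on[OF \<rho>_linear_action \<rho>_rep(3) linW q assms(3)] pw by blast
    have q_surj: "?q ` ?V = W"
    proof -
      have irr: "irreducible_subrep J (\<rho>t\<lparr>rspace := W\<rparr>) (?q ` ?V)"
        using irreducible_subrep_image[OF \<rho>_linear_action \<rho>_rep(3) linW q q_inj] .
      have "subrep J (?q ` ?V) \<rho>t" "?q ` ?V \<subseteq> W"
        using irreducible_subrepD(1)[OF irr] unfolding subrep_rspace_update[OF irreducible_subrepD(1)[OF W]] by simp_all
      then show ?thesis using irreducible_subrepD(3)[OF W] irreducible_subrepD(2)[OF irr] by blast
    qed
    have q_inv: "equivariant J (\<rho>t\<lparr>rspace := W\<rparr>) \<rho> (inv_into ?V ?q)"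
      using equivariant_inv_into[OF \<rho>_linear_action q q_inj] q_surj by simp
    have "equivariant J \<rho> (\<rho>t\<lparr>rspace := W\<rparr>) (\<lambda>w. p (\<phi> w))"
      using M_D(1)[OF insert.prems(1)] p by (rule equivariant_compose)
    then have "equivariant J \<rho> \<rho> (\<lambda>w. inv_into ?V ?q (p (\<phi> w)))" using q_inv by (rule equivariant_compose)
    then obtain t where t: "\<And>w. w \<in> ?V \<Longrightarrow> inv_into ?V ?q (p (\<phi> w)) = t *\<^sub>C w" using schur_\<rho> by blast
    have p\<phi>: "p (\<phi> w0) = t *\<^sub>C p (\<phi>1 w0)"
    proof -
      have "p (\<phi> w0) \<in> ?q ` ?V"
        unfolding q_surj using linear_betweenD(1)[OF plin M_D(4)[OF insert.prems(1) assms(3)]] .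
      from f_inv_into_f[OF this] have "p (\<phi> w0) = ?q (inv_into ?V ?q (p (\<phi> w0)))" by (rule sym)
      also have "\<dots> = ?q (t *\<^sub>C w0)" using t[OF assms(3)] by simp
      also have "\<dots> = t *\<^sub>C ?q w0" using linear_betweenD(3)[OF equivariantD(1)[OF q] assms(3)] .
      finally show ?thesis .
    qed
    let ?\<psi> = "\<phi> - t *\<^sub>C \<phi>1"
    have \<psi>: "?\<psi> \<in> M"
      using M_subspace insert.prems(1) \<phi>1 by (simp add: complex_vector.subspace_diff complex_vector.subspace_scale)
    have cV: "c \<in> rspace \<rho>t" using uc(2) subrepD(2)[OF C] by blast
    have u: "u = t *\<^sub>C w0"
    proof -
      have "p (\<phi> w0) = p (\<phi>1 u)"
        unfolding uc(3) using linear_betweenD(2)[OF plin M_D(4)[OF \<phi>1 uc(1)] cV] pC[OF uc(2)] by simp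
      then have "?q u = ?q (t *\<^sub>C w0)"
        using p\<phi> linear_betweenD(3)[OF equivariantD(1)[OF q] assms(3), of t] by simp
      then show ?thesis
        using inj_onD[OF q_inj _ uc(1) complex_vector.subspace_scale[OF small.space assms(3)]] by simp
    qed
    have "?\<psi> w0 = c"
      using uc(3) linear_betweenD(3)[OF M_D(2)[OF \<phi>1] assms(3), of t] by (simp add: u scaleC_fun_def)
    then have "?\<psi> w0 \<in> ?C" using uc(2) by (simp only:)
    then have "?\<psi> \<in> cspan F" by (rule insert.IH[OF \<psi> _ FM])
    then have "?\<psi> \<in> cspan (insert \<phi>1 F)" using sub by blast
    moreover have "t *\<^sub>C \<phi>1 \<in> cspan (insert \<phi>1 F)"
      by (simp add: complex_vector.span_scale complex_vector.span_base)
    ultimately have "?\<psi> + t *\<^sub>C \<phi>1 \<in> cspan (insert \<phi>1 F)" by (rule complex_vector.span_add)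
    then show ?thesis by (simp only: diff_add_cancel)
  qed
qed

lemma \<iota>_M: "(\<lambda>w. if w \<in> rspace \<rho> then \<iota> w else 0) \<in> M"
proof -
  note V = small.space
  have "linear_between (rspace \<rho>) (rspace \<rho>t) (\<lambda>w. if w \<in> rspace \<rho> then \<iota> w else 0)"
    using V by (intro linear_betweenI)
      (simp_all add: linear_betweenD[OF \<iota>_linear] complex_vector.subspace_add complex_vector.subspace_scale)
  then show ?thesis
    using equivariantD(2)[OF \<iota>_equivariant] small.act_closed by (simp add: M_def equivariant_def)
qed

text \<open>Let \<open>M'\<close> be a nonzero subspace stable under the twists. The translates of the images of its members
  span \<open>\<rho>t\<close>, because \<open>\<rho>t\<close> is irreducible. For \<open>\<phi>\<close> in \<open>M\<close> the image of \<open>\<phi>\<close> lies in the sum of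
  those translates that are isomorphic to \<open>\<rho>\<close>, and by stability these are images of members of \<open>M'\<close>.\<close>

lemma multiplicity_rep_irreducible: "irreducible_rep Q multiplicity_rep"
  unfolding irreducible_rep_def multiplicity_rep_simps
proof (intro conjI allI impI)
  obtain w0 where w0: "w0 \<in> rspace \<rho>" "w0 \<noteq> 0" using exists_nonzero_\<rho> by blast
  let ?V = "rspace \<rho>"
  show "M \<noteq> {0}"
  proof
    assume "M = {0}"
    then have "(\<lambda>w. if w \<in> ?V then \<iota> w else 0) = 0" using \<iota>_M by blast
    from fun_cong[OF this, of w0] show False using w0 \<iota>_eq_0 by simp
  qed
  fix M' assume M': "subrep Q M' multiplicity_rep"
  note M's = subrepD(1)[OF M'] and M'M = subrepD(2)[OF M', unfolded multiplicity_rep_simps]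
  have stable: "twist (g, a) \<phi> \<in> M'" if "twisted g a" "\<phi> \<in> M'" for g a \<phi>
    using subrepD(3)[OF M', of "(g, a)" \<phi>] that by (simp add: Q_def multiplicity_rep_simps)
  show "M' = {0} \<or> M' = M"
  proof (cases "M' \<subseteq> {0}")
    case True
    then show ?thesis using complex_vector.subspace_0[OF M's] by blast
  next
    case False
    then obtain \<phi>0 where \<phi>0: "\<phi>0 \<in> M'" "\<phi>0 \<noteq> 0" by blast
    let ?Im = "\<Union>\<psi>\<in>M'. \<psi> ` ?V"
    have ImV: "?Im \<subseteq> rspace \<rho>t" using M_D(4) M'M by blast
    have "\<not> ?Im \<subseteq> {0}"
    proof
      assume *: "?Im \<subseteq> {0}"
      have "\<phi>0 w = 0" for w
        using * \<phi>0(1) M_D(3)[OF subsetD[OF M'M \<phi>0(1)], of w] by (cases "w \<in> ?V") auto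
      then show False using \<phi>0(2) by (simp add: fun_eq_iff)
    qed
    then have span_Im: "cspan (\<Union>p\<in>Jt. act \<rho>t p ` ?Im) = rspace \<rho>t"
      by (rule restriction.span_translates[OF \<rho>t_rep(3) ImV])
    let ?E = "cspan ?Im"
    have E: "subrep J ?E \<rho>t"
      using M_image_subrep M'M by (intro subrep_span[OF restriction.linear_action]) auto
    have "\<phi> \<in> M'" if \<phi>: "\<phi> \<in> M" for \<phi>
    proof (cases "\<phi> = 0")
      case True
      then show ?thesis using complex_vector.subspace_0[OF M's] by simp
    next
      case nz: False
      let ?U = "\<phi> ` ?V"
      note irrU = M_image_irreducible[OF \<phi> nz] and \<phi>inj = M_inj[OF \<phi> nz]
      define \<C> where "\<C> = {C. irreducible_subrep J \<rho>t C \<and> \<not> isomorphic_rep J (\<rho>t\<lparr>rspace := ?U\<rparr>) (\<rho>t\<lparr>rspace := C\<rparr>)}"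
      have translate: "act \<rho>t k ` \<psi> ` ?V \<subseteq> ?E \<union> \<Union>\<C>" if k: "k \<in> Jt" and \<psi>: "\<psi> \<in> M'" for k \<psi>
      proof (cases "\<psi> = 0")
        case True
        then show ?thesis using big.act_zero[OF k] complex_vector.span_zero[of ?Im] by auto
      next
        case \<psi>nz: False
        note \<psi>M = subsetD[OF M'M \<psi>]
        let ?C = "act \<rho>t k ` \<psi> ` ?V"
        have irrC: "irreducible_subrep J \<rho>t ?C"
          by (rule restriction.translate_irreducible[OF k M_image_irreducible[OF \<psi>M \<psi>nz]])
        show ?thesis
        proof (cases "isomorphic_rep J (\<rho>t\<lparr>rspace := ?U\<rparr>) (\<rho>t\<lparr>rspace := ?C\<rparr>)")
          case True
          note linU = linear_action_subrep[OF restriction.linear_action irreducible_subrepD(1)[OF irrU]]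
          obtain f where f: "equivariant J (\<rho>t\<lparr>rspace := ?U\<rparr>) (\<rho>t\<lparr>rspace := ?C\<rparr>) f" "bij_betw f ?U ?C"
            using True unfolding isomorphic_rep_iff[OF linU] by auto
          let ?\<beta> = "\<lambda>w. f (\<phi> w)"
          have "equivariant J \<rho> (\<rho>t\<lparr>rspace := ?U\<rparr>) \<phi>"
            by (rule equivariant_codomain[OF M_D(1)[OF \<phi>]]) simp
          then have "equivariant J \<rho> (\<rho>t\<lparr>rspace := ?C\<rparr>) ?\<beta>" using f(1) by (rule equivariant_compose)
          then have \<beta>: "equivariant J \<rho> \<rho>t ?\<beta>"
            by (rule equivariant_codomain_superspace) (rule subrepD(2)[OF irreducible_subrepD(1)[OF irrC]])
          have img: "?\<beta> ` ?V = ?C" using f(2) by (simp add: bij_betw_def image_image)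
          obtain a where a: "twisted (inv k) a" "\<And>w. w \<in> ?V \<Longrightarrow> act \<rho>t k (\<psi> (a w)) = ?\<beta> w"
            using twisted_transport[OF k M_D(1)[OF \<psi>M] M_inj[OF \<psi>M \<psi>nz] \<beta>] img by blast
          have "twist (inv k, a) \<psi> w = ?\<beta> w" if "w \<in> ?V" for w
            using twist_apply[OF that] a(2)[OF that] Jt_carrier[OF k] by simp
          then have "twist (inv k, a) \<psi> ` ?V = ?\<beta> ` ?V" by (rule image_cong[OF refl])
          then have C_eq: "?C = twist (inv k, a) \<psi> ` ?V" using img by (simp only:)
          have "?C \<subseteq> ?Im" unfolding C_eq by (rule UN_upper[OF stable[OF a(1) \<psi>]])
          then show ?thesis using complex_vector.span_superset[of ?Im] by blast
        next
          case False
          then have "?C \<in> \<C>" using irrC by (simp add: \<C>_def)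
          then show ?thesis by blast
        qed
      qed
      have "act \<rho>t p ` ?Im \<subseteq> ?E \<union> \<Union>\<C>" if "p \<in> Jt" for p
        using translate[OF that] unfolding image_UN by blast
      then have "(\<Union>p\<in>Jt. act \<rho>t p ` ?Im) \<subseteq> ?E \<union> \<Union>\<C>" by blast
      then have "cspan (\<Union>p\<in>Jt. act \<rho>t p ` ?Im) \<subseteq> cspan (?E \<union> \<Union>\<C>)"
        by (rule complex_vector.span_mono)
      then have all: "rspace \<rho>t \<subseteq> cspan (?E \<union> \<Union>\<C>)" using span_Im by simp
      have UE: "?U \<subseteq> ?E"
      proof (rule ccontr)
        assume *: "\<not> ?U \<subseteq> ?E"
        have irr\<C>: "irreducible_subrep J \<rho>t W" if "W \<in> \<C>" for W using that by (simp add: \<C>_def)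
        have "?U \<subseteq> cspan (?E \<union> \<Union>\<C>)"
          using subrepD(2)[OF irreducible_subrepD(1)[OF irrU]] all by (rule subset_trans)
        then have "\<exists>W\<in>\<C>. isomorphic_rep J (\<rho>t\<lparr>rspace := ?U\<rparr>) (\<rho>t\<lparr>rspace := W\<rparr>)"
          using irreducible_subset_span[OF restriction.linear_action irr\<C> E irrU _ *, of \<C>] by simp
        then show False by (auto simp: \<C>_def)
      qed
      have "\<phi> w0 \<in> ?E" using UE w0(1) by blast
      then obtain t r where t: "finite t" "t \<subseteq> ?Im" "\<phi> w0 = (\<Sum>v\<in>t. r v *\<^sub>C v)"
        unfolding complex_vector.span_explicit by blast
      have "t \<subseteq> \<Union>((\<lambda>\<psi>. \<psi> ` ?V) ` M')" using t(2) .
      from finite_subset_Union[OF t(1) this] obtain \<F> where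
        \<F>: "finite \<F>" "\<F> \<subseteq> (\<lambda>\<psi>. \<psi> ` ?V) ` M'" "t \<subseteq> \<Union>\<F>" by blast
      obtain F where F: "F \<subseteq> M'" "finite F" "\<F> = (\<lambda>\<psi>. \<psi> ` ?V) ` F"
        using finite_subset_image[OF \<F>(1,2)] by blast
      have tF: "t \<subseteq> (\<Union>\<psi>\<in>F. \<psi> ` ?V)" using \<F>(3) F(3) by simp
      have "\<phi> w0 \<in> cspan (\<Union>\<psi>\<in>F. \<psi> ` ?V)"
        unfolding t(3) using tF by (intro complex_vector.span_sum complex_vector.span_scale complex_vector.span_base) blast
      then have "\<phi> \<in> cspan F"
        using M_finite_span[OF F(2) _ w0 \<phi>] F(1) M'M by blast
      moreover have "cspan F \<subseteq> M'" using F(1) M's by (rule complex_vector.span_minimal)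
      ultimately show ?thesis by blast
    qed
    then show ?thesis using M'M by blast
  qed
qed

text \<open>A member of \<open>M\<close> is determined by its value at a nonzero vector, since \<open>\<rho>\<close> is irreducible; this embeds \<open>M\<close> into \<open>\<rho>t\<close>.\<close>

lemma multiplicity_rep_countable:
  assumes S: "S \<subseteq> M" "complex_vector.independent S"
  shows "countable S"
proof -
  obtain w0 where w0: "w0 \<in> rspace \<rho>" "w0 \<noteq> 0" using exists_nonzero_\<rho> by blast
  let ?ev = "\<lambda>\<phi> :: 'v \<Rightarrow> 'v. \<phi> w0"
  interpret ev: module_hom "scaleC :: complex \<Rightarrow> ('v \<Rightarrow> 'v) \<Rightarrow> _" "scaleC :: complex \<Rightarrow> 'v \<Rightarrow> 'v" ?ev
    by unfold_locales (simp_all add: scaleC_fun_def scaleC_add_right scaleC_add_left scaleC_scaleC scaleC_one)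
  have span_M: "cspan S \<subseteq> M" using S(1) M_subspace by (rule complex_vector.span_minimal)
  have inj: "inj_on ?ev (cspan S)"
  proof (rule inj_onI)
    fix \<phi> \<psi> assume "\<phi> \<in> cspan S" "\<psi> \<in> cspan S" and eq: "\<phi> w0 = \<psi> w0"
    then have d: "\<phi> - \<psi> \<in> M" using span_M M_subspace by (auto intro: complex_vector.subspace_diff)
    show "\<phi> = \<psi>"
    proof (rule ccontr)
      assume "\<phi> \<noteq> \<psi>"
      then have "inj_on (\<phi> - \<psi>) (rspace \<rho>)" using M_inj[OF d] by simp
      moreover have "(\<phi> - \<psi>) w0 = 0" using eq by simp
      ultimately show False
        using linear_between_inj_on_iff[OF M_D(2)[OF d] small.space] w0 by blast
    qed
  qed
  have "complex_vector.independent (?ev ` S)"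
    using S(2) inj by (rule ev.independent_injective_image)
  moreover have "?ev ` S \<subseteq> rspace \<rho>t" using M_D(4)[OF _ w0(1)] S(1) by blast
  ultimately have "countable (?ev ` S)"
    using big.countable_dimension[OF \<rho>t_rep(3)] by blast
  moreover have "inj_on ?ev S"
    using inj complex_vector.span_superset[of S] by (rule inj_on_subset)
  ultimately show ?thesis by (rule countable_image_inj_on)
qed

text \<open>The relation between \<open>a b\<close> and \<open>b a\<close> from the Hecke algebra involves a commutator in \<open>J\<close>, which the translations
  by \<open>g\<^sup>-\<^sup>1\<close> and \<open>h\<^sup>-\<^sup>1\<close> compensate.\<close>

lemma commutative_imp_twist_commute:
  assumes comm: "\<forall>a\<in>carrier hecke. \<forall>b\<in>carrier hecke. a \<otimes>\<^bsub>hecke\<^esub> b = b \<otimes>\<^bsub>hecke\<^esub> a"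
    and a: "twisted g a" and b: "twisted h b" and \<phi>: "\<phi> \<in> M"
  shows "twist (g, a) (twist (h, b) \<phi>) = twist (h, b) (twist (g, a) \<phi>)"
proof (rule M_eqI)
  show "twist (g, a) (twist (h, b) \<phi>) \<in> M" "twist (h, b) (twist (g, a) \<phi>) \<in> M"
    by (rule twist_M[OF a twist_M[OF b \<phi>]] twist_M[OF b twist_M[OF a \<phi>]])+
  fix w assume w: "w \<in> rspace \<rho>"
  note g = twistedD(1)[OF a] and h = twistedD(1)[OF b]
  note gi = Jt_inv[OF g] and hi = Jt_inv[OF h]
  note alin = twistedD(2)[OF a] and blin = twistedD(2)[OF b]
  note car = Jt_carrier[OF g] Jt_carrier[OF h]
  note aw = linear_betweenD(1)[OF alin w] and bw = linear_betweenD(1)[OF blin w]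
  note baw = linear_betweenD(1)[OF blin aw] and abw = linear_betweenD(1)[OF alin bw]
  let ?c = "inv h \<otimes> inv g \<otimes> h \<otimes> g" and ?d = "h \<otimes> g \<otimes> inv h \<otimes> inv g"
  have c: "?c \<in> J" using J_commutator[OF hi gi] car by simp
  have d: "?d \<in> J" using J_commutator[OF h g] .
  note hc = J_conj[OF h c]
  have ghc: "g \<otimes> (h \<otimes> ?c \<otimes> inv h) \<otimes> inv g = ?d" using car by (simp add: m_assoc mult_inv_cancel)
  have "b (a w) = a (b (act \<rho> ?c w))" by (rule commutative_imp_twisted_commute[OF comm a b w])
  also have "\<dots> = act \<rho> ?d (a (b w))"
    using twistedD(3)[OF b c w] twistedD(3)[OF a hc bw] ghc by simp
  finally have ba: "\<phi> (b (a w)) = act \<rho>t ?d (\<phi> (a (b w)))"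
    using equivariantD(2)[OF M_D(1)[OF \<phi>] d abw] by simp
  have "twist (g, a) (twist (h, b) \<phi>) w = act \<rho>t (inv g) (act \<rho>t (inv h) (act \<rho>t ?d (\<phi> (a (b w)))))"
    using twist_apply[OF w] twist_apply[OF aw] ba by simp
  also have "\<dots> = act \<rho>t (inv g \<otimes> (inv h \<otimes> ?d)) (\<phi> (a (b w)))"
    using big.act_comp[OF hi J_Jt[OF d] M_D(4)[OF \<phi> abw]]
      big.act_comp[OF gi Jt_mult[OF hi J_Jt[OF d]] M_D(4)[OF \<phi> abw]] by simp
  also have "inv g \<otimes> (inv h \<otimes> ?d) = inv h \<otimes> inv g" using car by (simp add: m_assoc mult_inv_cancel)
  also have "act \<rho>t (inv h \<otimes> inv g) (\<phi> (a (b w))) = twist (h, b) (twist (g, a) \<phi>) w"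
    using big.act_comp[OF hi gi M_D(4)[OF \<phi> abw]] twist_apply[OF w] twist_apply[OF bw] by simp
  finally show "twist (g, a) (twist (h, b) \<phi>) w = twist (h, b) (twist (g, a) \<phi>) w" .
qed

text \<open>If a translate of \<open>W0\<close> by \<open>p\<close> is the image of \<open>W0\<close> under a homomorphism \<open>\<phi>\<close>, the two embeddings of \<open>\<rho>\<close>
  differ by a twist. The twists commute with each other and act irreducibly on \<open>M\<close>, so by Schur's lemma
  this twist is scalar and the images are equal.\<close>

lemma commutative_imp_multiplicity_free:
  assumes comm: "\<forall>a\<in>carrier hecke. \<forall>b\<in>carrier hecke. a \<otimes>\<^bsub>hecke\<^esub> b = b \<otimes>\<^bsub>hecke\<^esub> a"
  shows "multiplicity_free J \<rho>t"
proof (rule restriction.multiplicity_free_translates[OF W0_irreducible span_translates_W0])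
  fix p \<phi> assume p: "p \<in> Jt" and \<phi>: "equivariant J (\<rho>t\<lparr>rspace := W0\<rparr>) \<rho>t \<phi>"
    and img: "\<phi> ` W0 = act \<rho>t p ` W0"
  let ?V = "rspace \<rho>" and ?\<iota> = "\<lambda>w. if w \<in> rspace \<rho> then \<iota> w else 0"
  have "equivariant J \<rho> (\<rho>t\<lparr>rspace := W0\<rparr>) \<iota>"
    using \<iota>_in_W0 by (rule equivariant_codomain[OF \<iota>_equivariant])
  then have \<beta>: "equivariant J \<rho> \<rho>t (\<lambda>w. \<phi> (\<iota> w))" using \<phi> by (rule equivariant_compose)
  have "(\<lambda>w. \<phi> (\<iota> w)) ` ?V \<subseteq> act \<rho>t p ` \<iota> ` ?V"
    using img unfolding W0_def by (simp add: image_image)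
  then obtain a where a: "twisted (inv p) a" "\<And>w. w \<in> ?V \<Longrightarrow> act \<rho>t p (\<iota> (a w)) = \<phi> (\<iota> w)"
    using twisted_transport[OF p \<iota>_equivariant \<iota>_inj \<beta>] by blast
  have "equivariant Q multiplicity_rep multiplicity_rep (twist (inv p, a))"
    unfolding equivariant_def multiplicity_rep_simps
  proof (intro conjI ballI)
    show "linear_between M M (twist (inv p, a))"
      using linear_actionD(2)[OF multiplicity_rep_linear, of "(inv p, a)"] a(1)
      by (simp add: Q_def multiplicity_rep_simps)
    fix q \<psi> assume q: "q \<in> Q" and \<psi>: "\<psi> \<in> M"
    obtain h b where hb: "q = (h, b)" "twisted h b" using q by (auto simp: Q_def)
    show "twist (inv p, a) (twist q \<psi>) = twist q (twist (inv p, a) \<psi>)"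
      unfolding hb(1) by (rule commutative_imp_twist_commute[OF comm a(1) hb(2) \<psi>])
  qed
  then have "\<exists>c. \<forall>\<psi>\<in>rspace multiplicity_rep. twist (inv p, a) \<psi> = c *\<^sub>C \<psi>"
    using multiplicity_rep_countable
    by (intro schur_countable_dimension[OF multiplicity_rep_linear multiplicity_rep_irreducible])
      (simp_all add: multiplicity_rep_simps)
  then obtain c where c: "twist (inv p, a) ?\<iota> = c *\<^sub>C ?\<iota>" using \<iota>_M by (auto simp: multiplicity_rep_simps)
  have scalar: "\<phi> (\<iota> w) = c *\<^sub>C \<iota> w" if w: "w \<in> ?V" for w
  proof -
    have "a w \<in> ?V" using linear_betweenD(1)[OF twistedD(2)[OF a(1)] w] .
    then show ?thesis
      using fun_cong[OF c, of w] twist_apply[OF w, of "inv p" a ?\<iota>] a(2)[OF w] w Jt_carrier[OF p]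
      by (simp add: scaleC_fun_def)
  qed
  have "\<phi> ` W0 \<subseteq> W0"
    using scalar \<iota>_in_W0 complex_vector.subspace_scale[OF W0_subspace] unfolding W0_def by auto
  then have "act \<rho>t p ` W0 \<subseteq> W0" using img by simp
  then show "act \<rho>t p ` W0 = W0"
    using irreducible_subrepD(1,2)[OF restriction.translate_irreducible[OF p W0_irreducible]]
      irreducible_subrepD(3)[OF W0_irreducible] by blast
qed

theorem commutative_iff: "multiplicity_free J \<rho>t \<longleftrightarrow>
    (\<forall>a\<in>carrier hecke. \<forall>b\<in>carrier hecke. a \<otimes>\<^bsub>hecke\<^esub> b = b \<otimes>\<^bsub>hecke\<^esub> a)"
  using multiplicity_free_imp_commutative commutative_imp_multiplicity_free by blast

end

section \<open>Groups of rational points\<close>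

lemma (in nonarchimedean_local_field) translation_group_points:
  fixes \<G> :: "('f alg_closure^'n^'n) set"
  assumes "group (points_group \<G>)"
  shows "translation_group (points_group \<G>) (points_topology v \<G>)"
proof -
  let ?S = "rational_points \<G>"
  interpret group "points_group \<G>" by (rule assms)
  have closed: "g ** h \<in> ?S" if "g \<in> ?S" "h \<in> ?S" for g h
    using m_closed[of g h] that by (simp add: matrix_group_def)
  show ?thesis
  proof
    show "topspace (points_topology v \<G>) = carrier (points_group \<G>)"
      by (simp add: points_topology_def topspace_matrix_topology matrix_group_def)
    show "second_countable (points_topology v \<G>)"
      unfolding points_topology_def by (rule second_countable_subtopology[OF second_countable_matrix_topology])
  next
    fix U g assume U: "openin (points_topology v \<G>) U" and "g \<in> carrier (points_group \<G>)"
    then have g: "g \<in> ?S" by (simp add: matrix_group_def)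
    obtain N where N: "openin (matrix_topology v) N" "U = N \<inter> ?S"
      using U unfolding points_topology_def openin_subtopology by blast
    have "{A \<in> ?S. g ** A \<in> U} = {A. g ** A \<in> N} \<inter> ?S" "{A \<in> ?S. A ** g \<in> U} = {A. A ** g \<in> N} \<inter> ?S"
      using closed g N(2) by blast+
    then show "openin (points_topology v \<G>) {A \<in> carrier (points_group \<G>). g \<otimes>\<^bsub>points_group \<G>\<^esub> A \<in> U}"
      "openin (points_topology v \<G>) {A \<in> carrier (points_group \<G>). A \<otimes>\<^bsub>points_group \<G>\<^esub> g \<in> U}"
      using openin_matrix_preimage[OF N(1), of g] unfolding points_topology_def openin_subtopology
      by (auto simp: matrix_group_def)
  qed
qed

theorem proposition3p15:
  fixes v :: "'f::field \<Rightarrow> real"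
    and \<G> :: "('f alg_closure^'n^'n) set"
    and B J Jt :: "('f^'n^'n) set"
    and \<rho> \<rho>t :: "('f^'n^'n, 'v::complex_vector) rep"
    and assoc :: "('f^'n^'n) set \<times> ('f^'n^'n, 'v) rep \<Rightarrow> ('f^'n^'n) set \<times> ('f^'n^'n, 'v) rep"
    and G :: "('f^'n^'n) monoid" and T :: "('f^'n^'n) topology" and Z :: "('f^'n^'n) set"
    and \<pi> :: "('f^'n^'n, 'f^'n^'n \<Rightarrow> 'v) rep"
    and H :: "(complex, ('f^'n^'n \<Rightarrow> 'v) \<Rightarrow> 'f^'n^'n \<Rightarrow> 'v) module"
  defines "G \<equiv> points_group \<G>" and "T \<equiv> points_topology v \<G>" and "Z \<equiv> points_center \<G>"
    and "\<pi> \<equiv> compact_induction G T Jt \<rho>t" and "H \<equiv> hecke_algebra G T J \<rho>"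
  assumes "nonarchimedean_local_field v"
    and "connected_reductive_group \<G>"
    and "flat_subgroup v \<G> B"
    and "\<forall>x\<in>cuspidal_pairs G T Z B. assoc x \<in> associated_pairs G T Z B x"
    and "(J, \<rho>) \<in> wc_cuspidal_pairs G T Z B assoc"
    and "assoc (J, \<rho>) = (Jt, \<rho>t)"
  shows "(multiplicity_free B \<pi> \<longleftrightarrow> multiplicity_free J \<rho>t) \<and>
         (multiplicity_free J \<rho>t \<longleftrightarrow> (\<forall>a\<in>carrier H. \<forall>b\<in>carrier H. a \<otimes>\<^bsub>H\<^esub> b = b \<otimes>\<^bsub>H\<^esub> a))"
proof -
  interpret nonarchimedean_local_field v by (rule assms(6))
  have B: "B \<lhd> G" and "derived G (carrier G) \<subseteq> B"
    using assms(8) unfolding flat_subgroup_def G_def by (simp_all add: matrix_group_def)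
  then have comm: "g \<otimes>\<^bsub>G\<^esub> h \<otimes>\<^bsub>G\<^esub> inv\<^bsub>G\<^esub> g \<otimes>\<^bsub>G\<^esub> inv\<^bsub>G\<^esub> h \<in> B" if "g \<in> carrier G" "h \<in> carrier G" for g h
    using that generate.incl[of _ "derived_set G (carrier G)" G] unfolding derived_def by blast
  have "group G" using B by (simp add: normal_def)
  then have tg: "translation_group G T"
    unfolding G_def T_def by (rule translation_group_points)
  have cusp: "(J, \<rho>) \<in> cuspidal_pairs G T Z B" and int: "intertwining G J \<rho> \<subseteq> Jt"
    using assms(10,11) by (auto simp: wc_cuspidal_pairs_def)
  have J: "openin T J" "compactin T J" "\<rho> \<in> Irr G T J"
    using cusp by (auto simp: cuspidal_pairs_def open_compact_subgroups_def)
  have "(Jt, \<rho>t) \<in> associated_pairs G T Z B (J, \<rho>)"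
    using assms(9,11) cusp by metis
  then have Jt: "subgroup Jt G" "openin T Jt" "J = Jt \<inter> B" "\<rho>t \<in> Irr G T Jt" "contains_rep J \<rho>t \<rho>"
    by (auto simp: associated_pairs_def open_compact_mod_subgroups_def)
  obtain \<iota> where "\<iota> \<in> Hom J \<rho> \<rho>t" "inj_on \<iota> (rspace \<rho>)"
    using Jt(5) unfolding contains_rep_def by blast
  then have \<iota>: "equivariant J \<rho> \<rho>t \<iota>" "inj_on \<iota> (rspace \<rho>)"
    by (simp_all add: Hom_def equivariant_def)
  interpret translation_group G T by (rule tg)
  interpret cuspidal_data G T B J Jt \<rho> \<rho>t \<iota>
    by (rule cuspidal_data.intro[OF tg cuspidal_data_axioms.intro]) (fact B comm Jt J \<iota> int)+
  show ?thesis
    unfolding \<pi>_def H_def using multiplicity_free_\<pi>_iff commutative_iff by blast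
qed

end
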